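(* Let $H$ be a semisimple finite dimensional Hopf algebra over a field $k$, and let $A$ be an $H$-semiprime $H$-module algebra which has a right artinian classical right quotient ring $Q$; equip $Q$ with the unique $H$-module algebra structure extending that of $A$. Let $I$ be an $H$-stable left ideal of $A$, and let $I^H=I\cap A^H$. (i) If $I^H=0$ then $I=0$. (ii) If $QI=Q$ then $I^HQ^H=Q^H$.
   Context: All algebras are associative and unital. An $H$-module algebra is a $k$-algebra $A$ with a left $H$-module structure such that the multiplication map $A\otimes_k A\to A$ is $H$-linear, where $H$ acts on $A\otimes_k A$ via its comultiplication. Its subalgebra of invariants is $A^H=\{a\in A\mid ha=\varepsilon(h)a \text{ for all } h\in H\}$, where $\varepsilon$ is the counit of $H$. $A$ is $H$-semiprime if it contains no nonzero nilpotent $H$-stable two-sided ideals. An element of a ring is regular if it is neither a left nor a right zero divisor. A classical right quotient ring of a ring $R$ is a ring $Q$ containing $R$ as a subring such that all regular elements of $R$ are invertible in $Q$ and each $q\in Q$ can be written as $q=as^{-1}$ with $a,s\in R$, $s$ regular. It is known that if $A$ has a right artinian classical right quotient ring $Q$, then the $H$-module structure on $A$ extends uniquely to $Q$ so that $Q$ becomes an $H$-module algebra. Products such as $QI$ and $I^HQ^H$ denote the additive subgroups generated by all products of elements. *)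

theory Defs
  imports Complex_Main "HOL-Library.Multiset"
begin

section \<open>Rings\<close>

text \<open>The sort \<open>{ring, monoid_mult}\<close> is used for associative unital rings; unlike \<open>ring_1\<close> it
  does not exclude the zero ring.\<close>

definition add_subgroup :: "'a::ab_group_add set \<Rightarrow> bool" where
  "add_subgroup S \<longleftrightarrow> 0 \<in> S \<and> (\<forall>x\<in>S. \<forall>y\<in>S. x + y \<in> S) \<and> (\<forall>x\<in>S. - x \<in> S)"

definition left_ideal :: "'a::{ring,monoid_mult} set \<Rightarrow> bool" where
  "left_ideal J \<longleftrightarrow> add_subgroup J \<and> (\<forall>a. \<forall>x\<in>J. a * x \<in> J)"

definition right_ideal :: "'a::{ring,monoid_mult} set \<Rightarrow> bool" where
  "right_ideal J \<longleftrightarrow> add_subgroup J \<and> (\<forall>a. \<forall>x\<in>J. x * a \<in> J)"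

definition two_sided_ideal :: "'a::{ring,monoid_mult} set \<Rightarrow> bool" where
  "two_sided_ideal J \<longleftrightarrow> left_ideal J \<and> right_ideal J"

definition add_prod :: "'a::{ring,monoid_mult} set \<Rightarrow> 'a set \<Rightarrow> 'a set" where
  "add_prod S T = add_subgroup hull {s * t | s t. s \<in> S \<and> t \<in> T}"

primrec ideal_power :: "'a::{ring,monoid_mult} set \<Rightarrow> nat \<Rightarrow> 'a set" where
  "ideal_power J 0 = UNIV"
| "ideal_power J (Suc n) = add_prod (ideal_power J n) J"

definition nilpotent_ideal :: "'a::{ring,monoid_mult} set \<Rightarrow> bool" where
  "nilpotent_ideal J \<longleftrightarrow> (\<exists>n. ideal_power J n = {0})"

definition regular :: "'a::{ring,monoid_mult} \<Rightarrow> bool" where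
  "regular s \<longleftrightarrow> (\<forall>b. s * b = 0 \<longrightarrow> b = 0) \<and> (\<forall>b. b * s = 0 \<longrightarrow> b = 0)"

definition right_artinian :: "'a::{ring,monoid_mult} itself \<Rightarrow> bool" where
  "right_artinian _ \<longleftrightarrow>
    (\<forall>J :: nat \<Rightarrow> 'a set.
      (\<forall>n. right_ideal (J n)) \<and> (\<forall>n. J (Suc n) \<subseteq> J n) \<longrightarrow> (\<exists>N. \<forall>n\<ge>N. J n = J N))"

text \<open>A ring is semisimple if its left regular module is: every submodule is a direct summand.\<close>

definition semisimple_ring :: "'a::{ring,monoid_mult} itself \<Rightarrow> bool" where
  "semisimple_ring _ \<longleftrightarrow>
    (\<forall>L :: 'a set. left_ideal L \<longrightarrow>
      (\<exists>L'. left_ideal L' \<and> L \<inter> L' = {0} \<and> {x + y | x y. x \<in> L \<and> y \<in> L'} = UNIV))"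

text \<open>The target of \<open>\<iota>\<close> is a classical right quotient ring of its source, the inclusion of the
  subring being represented by the embedding \<open>\<iota>\<close>.\<close>

definition classical_right_quotient_ring ::
    "('a::{ring,monoid_mult} \<Rightarrow> 'q::{ring,monoid_mult}) \<Rightarrow> bool" where
  "classical_right_quotient_ring \<iota> \<longleftrightarrow>
    inj \<iota> \<and> \<iota> 1 = 1 \<and> (\<forall>a b. \<iota> (a + b) = \<iota> a + \<iota> b) \<and> (\<forall>a b. \<iota> (a * b) = \<iota> a * \<iota> b) \<and>
    (\<forall>s. regular s \<longrightarrow> (\<exists>u. \<iota> s * u = 1 \<and> u * \<iota> s = 1)) \<and>
    (\<forall>q. \<exists>a s u. regular s \<and> \<iota> s * u = 1 \<and> u * \<iota> s = 1 \<and> q = \<iota> a * u)"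

section \<open>Tensors\<close>

text \<open>A finite multiset \<open>{#(a\<^sub>1, b\<^sub>1), \<dots>, (a\<^sub>n, b\<^sub>n)#}\<close> stands for the formal sum of the
  \<open>a\<^sub>i \<otimes> b\<^sub>i\<close>; it represents an element of \<open>V \<otimes> V\<close>, and every element has such a representative.
  The tensor powers \<open>V \<otimes> V\<close> and \<open>V \<otimes> V \<otimes> V\<close> are the quotients of the commutative monoid of
  formal sums by the congruences \<open>tensor2_eq\<close> and \<open>tensor3_eq\<close> generated by the usual relations.
  The \<open>zero\<close> relations are needed because additivity alone does not identify
  \<open>0 \<otimes> b\<close> with the empty sum in a monoid.\<close>

inductive formal_sum_cong :: "('m multiset \<Rightarrow> 'm multiset \<Rightarrow> bool) \<Rightarrow> 'm multiset \<Rightarrow> 'm multiset \<Rightarrow> bool"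
  for R where
  gen: "R x y \<Longrightarrow> formal_sum_cong R x y"
| refl: "formal_sum_cong R x x"
| sym: "formal_sum_cong R x y \<Longrightarrow> formal_sum_cong R y x"
| trans: "formal_sum_cong R x y \<Longrightarrow> formal_sum_cong R y z \<Longrightarrow> formal_sum_cong R x z"
| add: "formal_sum_cong R x y \<Longrightarrow> formal_sum_cong R x' y' \<Longrightarrow> formal_sum_cong R (x + x') (y + y')"

inductive tensor2_rel ::
    "('k \<Rightarrow> 'v \<Rightarrow> 'v::ab_group_add) \<Rightarrow> ('v \<times> 'v) multiset \<Rightarrow> ('v \<times> 'v) multiset \<Rightarrow> bool"
  for scale where
  add1: "tensor2_rel scale {#(a + a', b)#} {#(a, b), (a', b)#}"
| add2: "tensor2_rel scale {#(a, b + b')#} {#(a, b), (a, b')#}"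
| zero: "tensor2_rel scale {#(0, b)#} {#}"
| balanced: "tensor2_rel scale {#(scale c a, b)#} {#(a, scale c b)#}"

inductive tensor3_rel ::
    "('k \<Rightarrow> 'v \<Rightarrow> 'v::ab_group_add) \<Rightarrow> ('v \<times> 'v \<times> 'v) multiset \<Rightarrow> ('v \<times> 'v \<times> 'v) multiset \<Rightarrow> bool"
  for scale where
  add1: "tensor3_rel scale {#(a + a', b, d)#} {#(a, b, d), (a', b, d)#}"
| add2: "tensor3_rel scale {#(a, b + b', d)#} {#(a, b, d), (a, b', d)#}"
| add3: "tensor3_rel scale {#(a, b, d + d')#} {#(a, b, d), (a, b, d')#}"
| zero: "tensor3_rel scale {#(0, b, d)#} {#}"
| balanced12: "tensor3_rel scale {#(scale c a, b, d)#} {#(a, scale c b, d)#}"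
| balanced23: "tensor3_rel scale {#(a, scale c b, d)#} {#(a, b, scale c d)#}"

abbreviation tensor2_eq where "tensor2_eq scale \<equiv> formal_sum_cong (tensor2_rel scale)"

abbreviation tensor3_eq where "tensor3_eq scale \<equiv> formal_sum_cong (tensor3_rel scale)"

text \<open>Balanced biadditive maps can therefore be evaluated on representatives.\<close>

lemma tensor2_eq_lift:
  fixes f :: "'v::ab_group_add \<Rightarrow> 'v \<Rightarrow> 'w::ab_group_add"
  assumes "tensor2_eq scale x y"
    and "\<And>a a' b. f (a + a') b = f a b + f a' b"
    and "\<And>a b b'. f a (b + b') = f a b + f a b'"
    and "\<And>c a b. f (scale c a) b = f a (scale c b)"
  shows "(\<Sum>(a, b)\<in>#x. f a b) = (\<Sum>(a, b)\<in>#y. f a b)"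
  using assms(1)
proof induction
  case (gen x y)
  have "f 0 b = 0" for b
    using assms(2)[of 0 0 b] by simp
  with gen show ?case
    by cases (simp_all add: assms)
qed simp_all

section \<open>Hopf algebras and module algebras\<close>

locale k_algebra = vector_space scale
  for scale :: "'k::field \<Rightarrow> 'a::{ring,monoid_mult} \<Rightarrow> 'a" +
  assumes scale_mult_left: "scale c x * y = scale c (x * y)"
    and scale_mult_right: "x * scale c y = scale c (x * y)"

definition finite_dimensional :: "('k::field \<Rightarrow> 'v::ab_group_add \<Rightarrow> 'v) \<Rightarrow> bool" where
  "finite_dimensional scale \<longleftrightarrow> (\<exists>B. finite B \<and> module.span scale B = UNIV)"

text \<open>\<open>\<Delta> x\<close> is a chosen representative of the comultiplication of \<open>x\<close>, that is, Sweedler's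
  \<open>\<Sum> x\<^sub>(\<^sub>1\<^sub>) \<otimes> x\<^sub>(\<^sub>2\<^sub>)\<close>; \<open>\<Delta>\<close> is linear and multiplicative only as a map into the tensor square,
  and every condition below is independent of the choice of representatives.\<close>

locale hopf_algebra = k_algebra scale
  for scale :: "'k::field \<Rightarrow> 'h::{ring,monoid_mult} \<Rightarrow> 'h" +
  fixes \<Delta> :: "'h \<Rightarrow> ('h \<times> 'h) multiset"
    and \<epsilon> :: "'h \<Rightarrow> 'k"
    and S :: "'h \<Rightarrow> 'h"
  assumes comult_add: "tensor2_eq scale (\<Delta> (x + y)) (\<Delta> x + \<Delta> y)"
    and comult_scale: "tensor2_eq scale (\<Delta> (scale c x)) {#(scale c a, b). (a, b) \<in># \<Delta> x#}"
    and counit_linear: "Vector_Spaces.linear scale (*) \<epsilon>"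
    and coassoc: "tensor3_eq scale
        (\<Sum>(a, b)\<in>#\<Delta> x. {#(a\<^sub>1, a\<^sub>2, b). (a\<^sub>1, a\<^sub>2) \<in># \<Delta> a#})
        (\<Sum>(a, b)\<in>#\<Delta> x. {#(a, b\<^sub>1, b\<^sub>2). (b\<^sub>1, b\<^sub>2) \<in># \<Delta> b#})"
    and counit_left: "(\<Sum>(a, b)\<in>#\<Delta> x. scale (\<epsilon> a) b) = x"
    and counit_right: "(\<Sum>(a, b)\<in>#\<Delta> x. scale (\<epsilon> b) a) = x"
    and comult_one: "tensor2_eq scale (\<Delta> 1) {#(1, 1)#}"
    and comult_mult: "tensor2_eq scale (\<Delta> (x * y))
        (\<Sum>(a, b)\<in>#\<Delta> x. {#(a * c, b * d). (c, d) \<in># \<Delta> y#})"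
    and counit_one: "\<epsilon> 1 = 1"
    and counit_mult: "\<epsilon> (x * y) = \<epsilon> x * \<epsilon> y"
    and antipode_linear: "Vector_Spaces.linear scale scale S"
    and antipode_left: "(\<Sum>(a, b)\<in>#\<Delta> x. S a * b) = scale (\<epsilon> x) 1"
    and antipode_right: "(\<Sum>(a, b)\<in>#\<Delta> x. a * S b) = scale (\<epsilon> x) 1"

text \<open>\<open>act_mult\<close> is \<open>H\<close>-linearity of the multiplication \<open>A \<otimes> A \<rightarrow> A\<close>, tested on pure tensors.\<close>

locale hmodule_algebra = k_algebra scaleA
  for scaleH :: "'k::field \<Rightarrow> 'h::{ring,monoid_mult} \<Rightarrow> 'h"
    and \<Delta> :: "'h \<Rightarrow> ('h \<times> 'h) multiset"
    and scaleA :: "'k \<Rightarrow> 'a::{ring,monoid_mult} \<Rightarrow> 'a" +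
  fixes act :: "'h \<Rightarrow> 'a \<Rightarrow> 'a"
  assumes act_add_left: "act (g + h) a = act g a + act h a"
    and act_add_right: "act h (a + b) = act h a + act h b"
    and act_scale_left: "act (scaleH c h) a = scaleA c (act h a)"
    and act_scale_right: "act h (scaleA c a) = scaleA c (act h a)"
    and act_one: "act 1 a = a"
    and act_act: "act (g * h) a = act g (act h a)"
    and act_mult: "act h (a * b) = (\<Sum>(h\<^sub>1, h\<^sub>2)\<in>#\<Delta> h. act h\<^sub>1 a * act h\<^sub>2 b)"

definition H_stable :: "('h \<Rightarrow> 'a \<Rightarrow> 'a) \<Rightarrow> 'a set \<Rightarrow> bool" where
  "H_stable act J \<longleftrightarrow> (\<forall>h. \<forall>x\<in>J. act h x \<in> J)"

definition invariants ::
    "('h \<Rightarrow> 'k) \<Rightarrow> ('k \<Rightarrow> 'a \<Rightarrow> 'a) \<Rightarrow> ('h \<Rightarrow> 'a \<Rightarrow> 'a) \<Rightarrow> 'a set" where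
  "invariants \<epsilon> scaleA act = {a. \<forall>h. act h a = scaleA (\<epsilon> h) a}"

definition H_semiprime :: "('h \<Rightarrow> 'a::{ring,monoid_mult} \<Rightarrow> 'a) \<Rightarrow> bool" where
  "H_semiprime act \<longleftrightarrow>
    (\<forall>J. two_sided_ideal J \<and> H_stable act J \<and> nilpotent_ideal J \<longrightarrow> J = {0})"

end

theory Submission
  imports Defs
begin

text \<open>Everything rests on one structural fact: an \<open>H\<close>-stable left ideal \<open>Y\<close> of \<open>Q\<close> on which the
  integral \<open>t\<close> of \<open>H\<close> vanishes is zero. The ring \<open>Q\<close> is again \<open>H\<close>-semiprime. Let \<open>N \<subseteq> W\<close> be
  \<open>H\<close>-stable left ideals with \<open>W\<close> finitely generated. Some power \<open>(W / N)\<^sup>l\<close> has generators that are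
  free modulo a prime \<open>P\<close> of maximal rank. The coefficients of their relations generate an ideal \<open>I\<close>
  inside \<open>P\<close>, the smallest one modulo which the generators are free, and \<open>I\<close> is \<open>H\<close>-stable because
  \<open>W / N\<close> is equivariant (an argument of Skryabin). If \<open>X\<close> is a minimal \<open>H\<close>-stable ideal with
  \<open>W = X W + N\<close>, this forces \<open>X + I = Q\<close> and \<open>X \<inter> I = 0\<close>. For \<open>N = 0\<close> one obtains \<open>X = Q c\<close> with an
  invariant central idempotent \<open>c\<close>; for \<open>W = Q c\<close> one obtains that \<open>W / N\<close> is projective, that is,
  \<open>c - e \<in> N\<close> and \<open>N e = 0\<close> for some \<open>e\<close>. Averaging \<open>e\<close> with \<open>t\<close> then gives \<open>N = 0\<close> as soon as \<open>t\<close>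
  vanishes on \<open>N\<close>.

  Both statements are transferred from \<open>Q\<close> to \<open>A\<close> by the same device: right \<open>Q\<^sup>H\<close>-submodules of \<open>Q\<close>
  satisfy the descending chain condition, so such a submodule is a left ideal of \<open>Q\<close> as soon as it
  is stable under \<open>A\<close>. For (i) this is applied to the largest \<open>H\<close>-stable \<open>A\<close>-submodule on which \<open>t\<close> vanishes,
  for (ii) to \<open>{y. t(A y) \<subseteq> I\<^sup>H Q\<^sup>H}\<close>, which contains \<open>I\<close> and hence \<open>1\<close>.\<close>

section \<open>Subgroups and ideals\<close>

text \<open>An H-semiprime Q need not be semiprime: in characteristic p the group algebra of a
  cyclic group of order p, with its grading, has no proper nonzero graded ideal but a nonzero
  radical. So splittings cannot be read off from a semisimple ring; they come from modules that are
  free modulo an H-stable ideal. Primes are usually not H-stable, which is why freeness is pushed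
  from P down to I. A power of W / N is taken because Q / P is a matrix ring over a division ring,
  and a finitely generated module over it is free only if its length is divisible by the matrix
  size. Maximality of the rank lets the same n vectors generate at every prime, so that Nakayama's
  lemma lifts them to generators. The chain condition concerns right ideals, while W / N is a left
  module. It is therefore applied to spaces of columns, that is, to functions with values in Q. This
  also explains the stability of I: H acts on the generators through a matrix over the convolution
  algebra Hom(H, Q) that is left invertible modulo I, and the chain condition makes it right
  invertible.\<close>

lemma add_subgroupD:
  assumes "add_subgroup S"
  shows add_subgroup_zero: "0 \<in> S"
    and add_subgroup_add: "x \<in> S \<Longrightarrow> y \<in> S \<Longrightarrow> x + y \<in> S"
    and add_subgroup_minus: "x \<in> S \<Longrightarrow> - x \<in> S"
    and add_subgroup_diff: "x \<in> S \<Longrightarrow> y \<in> S \<Longrightarrow> x - y \<in> S"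
proof -
  show z: "0 \<in> S" and a: "x \<in> S \<Longrightarrow> y \<in> S \<Longrightarrow> x + y \<in> S"
    and m: "x \<in> S \<Longrightarrow> - x \<in> S" for x y
    using assms by (auto simp: add_subgroup_def)
  show "x \<in> S \<Longrightarrow> y \<in> S \<Longrightarrow> x - y \<in> S"
    using a[of x "- y"] m[of y] by simp
qed

lemma add_subgroup_sum:
  assumes "add_subgroup S" "\<And>i. i \<in> K \<Longrightarrow> f i \<in> S"
  shows "sum f K \<in> S"
  using assms(2)
  by (induct K rule: infinite_finite_induct)
    (auto simp: add_subgroup_zero[OF assms(1)] add_subgroup_add[OF assms(1)])

lemma add_subgroup_sum_mset:
  assumes "add_subgroup S" "\<And>i. i \<in># K \<Longrightarrow> f i \<in> S"
  shows "(\<Sum>i\<in>#K. f i) \<in> S"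
  using assms(2)
  by (induct K) (auto simp: add_subgroup_zero[OF assms(1)] add_subgroup_add[OF assms(1)])

lemma add_subgroup_Inter: "(\<And>S. S \<in> F \<Longrightarrow> add_subgroup S) \<Longrightarrow> add_subgroup (\<Inter>F)"
  by (auto simp: add_subgroup_def)

lemma add_subgroup_hull: "add_subgroup (add_subgroup hull S)"
  by (rule hull_in) (auto intro: add_subgroup_Inter)

lemma add_subgroup_hull_induct [consumes 1, case_names base zero add minus]:
  assumes "x \<in> add_subgroup hull S"
    and "\<And>x. x \<in> S \<Longrightarrow> P x" and "P 0"
    and "\<And>x y. P x \<Longrightarrow> P y \<Longrightarrow> P (x + y)" and "\<And>x. P x \<Longrightarrow> P (- x)"
  shows "P x"
proof -
  have "add_subgroup hull S \<subseteq> Collect P"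
    by (rule hull_minimal) (use assms in \<open>auto simp: add_subgroup_def\<close>)
  then show ?thesis using assms(1) by auto
qed

lemma left_idealD:
  assumes "left_ideal S"
  shows left_ideal_subgroup: "add_subgroup S"
    and left_ideal_mult: "x \<in> S \<Longrightarrow> a * x \<in> S"
  using assms by (auto simp: left_ideal_def)

lemma right_idealD:
  assumes "right_ideal S"
  shows right_ideal_subgroup: "add_subgroup S"
    and right_ideal_mult: "x \<in> S \<Longrightarrow> x * a \<in> S"
  using assms by (auto simp: right_ideal_def)

lemma idealD:
  assumes "two_sided_ideal S"
  shows ideal_left: "left_ideal S"
    and ideal_right: "right_ideal S"
    and ideal_subgroup: "add_subgroup S"
    and ideal_mult_left: "x \<in> S \<Longrightarrow> a * x \<in> S"
    and ideal_mult_right: "x \<in> S \<Longrightarrow> x * a \<in> S"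
  using assms by (auto simp: two_sided_ideal_def left_ideal_def right_ideal_def)

lemma left_ideal_hull:
  assumes "\<And>a x. x \<in> T \<Longrightarrow> a * x \<in> add_subgroup hull T"
  shows "left_ideal (add_subgroup hull T)"
  unfolding left_ideal_def
proof (intro conjI allI ballI)
  fix a x assume "x \<in> add_subgroup hull T"
  then show "a * x \<in> add_subgroup hull T"
    by (induct rule: add_subgroup_hull_induct)
      (auto simp: assms distrib_left add_subgroupD[OF add_subgroup_hull])
qed (rule add_subgroup_hull)

lemma right_ideal_hull:
  assumes "\<And>a x. x \<in> T \<Longrightarrow> x * a \<in> add_subgroup hull T"
  shows "right_ideal (add_subgroup hull T)"
  unfolding right_ideal_def
proof (intro conjI allI ballI)
  fix a x assume "x \<in> add_subgroup hull T"
  then show "x * a \<in> add_subgroup hull T"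
    by (induct rule: add_subgroup_hull_induct)
      (auto simp: assms distrib_right add_subgroupD[OF add_subgroup_hull])
qed (rule add_subgroup_hull)

definition generated_ideal :: "'a::{ring,monoid_mult} set \<Rightarrow> 'a set" where
  "generated_ideal T = add_subgroup hull {u * x * v | u x v. x \<in> T}"

lemma generated_ideal: "two_sided_ideal (generated_ideal T)"
  unfolding two_sided_ideal_def generated_ideal_def
proof
  show "left_ideal (add_subgroup hull {u * x * v | u x v. x \<in> T})"
  proof (rule left_ideal_hull, clarify)
    fix a u x v assume "x \<in> T"
    then show "a * (u * x * v) \<in> add_subgroup hull {u * x * v | u x v. x \<in> T}"
      by (intro hull_inc CollectI exI[of _ "a * u"] exI[of _ x] exI[of _ v]) (simp add: mult.assoc)
  qed
  show "right_ideal (add_subgroup hull {u * x * v | u x v. x \<in> T})"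
  proof (rule right_ideal_hull, clarify)
    fix a u x v assume "x \<in> T"
    then show "u * x * v * a \<in> add_subgroup hull {u * x * v | u x v. x \<in> T}"
      by (intro hull_inc CollectI exI[of _ u] exI[of _ x] exI[of _ "v * a"]) (simp add: mult.assoc)
  qed
qed

lemma generated_ideal_inc: "T \<subseteq> generated_ideal T"
proof
  fix x assume "x \<in> T"
  then have "1 * x * 1 \<in> generated_ideal T"
    unfolding generated_ideal_def by (intro hull_inc) blast
  then show "x \<in> generated_ideal T" by simp
qed

lemma generated_ideal_minimal:
  assumes "two_sided_ideal P" "T \<subseteq> P" shows "generated_ideal T \<subseteq> P"
proof -
  have "u * x * v \<in> P" if "x \<in> T" for u x v
    using ideal_mult_right[OF assms(1) ideal_mult_left[OF assms(1), of x u], of v]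
      that assms(2) by auto
  then show ?thesis
    unfolding generated_ideal_def
    by (intro hull_minimal ideal_subgroup[OF assms(1)]) blast
qed

text \<open>The number of terms matters: it is what \<open>prime_ideal_wedderburn\<close> minimises
  when it writes 1 as such a sum modulo P.\<close>

lemma generated_ideal_singleton_sum:
  assumes "x \<in> generated_ideal {e}"
  shows "\<exists>(n::nat) u w. x = (\<Sum>i<n. u i * e * w i)"
  using assms unfolding generated_ideal_def
proof (induct rule: add_subgroup_hull_induct)
  case (base x)
  then obtain u v where "x = u * e * v" by auto
  then show ?case by (intro exI[of _ 1] exI[of _ "\<lambda>_. u"] exI[of _ "\<lambda>_. v"]) simp
next
  case zero
  show ?case by (rule exI[of _ 0]) simp
next
  case (add x y)
  then obtain n m :: nat and u w u' w' where
    x: "x = (\<Sum>i<n. u i * e * w i)" and y: "y = (\<Sum>i<m. u' i * e * w' i)" by blast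
  let ?u = "\<lambda>i. if i < n then u i else u' (i - n)"
  let ?w = "\<lambda>i. if i < n then w i else w' (i - n)"
  have "(\<Sum>i<n+k. ?u i * e * ?w i) = x + (\<Sum>i<k. u' i * e * w' i)" for k
    by (induct k) (simp_all add: x add.assoc)
  then have "(\<Sum>i<n+m. ?u i * e * ?w i) = x + y" by (simp add: y)
  then show ?case by (intro exI[of _ "n + m"] exI[of _ ?u] exI[of _ ?w]) simp
next
  case (minus x)
  then obtain n :: nat and u w where "x = (\<Sum>i<n. u i * e * w i)" by blast
  then show ?case
    by (intro exI[of _ n] exI[of _ "\<lambda>i. - u i"] exI[of _ w]) (simp add: sum_negf)
qed

section \<open>Right ideals and the minimum condition\<close>

lemma right_artinian_minimal:
  fixes C :: "'a::{ring,monoid_mult} set set"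
  assumes "right_artinian TYPE('a)" "C \<noteq> {}" "\<And>J. J \<in> C \<Longrightarrow> right_ideal J"
  shows "\<exists>J\<in>C. \<forall>K\<in>C. K \<subseteq> J \<longrightarrow> K = J"
proof (rule ccontr)
  assume no: "\<not> ?thesis"
  obtain J0 where J0: "J0 \<in> C" using assms(2) by blast
  have "\<forall>J\<in>C. \<exists>K\<in>C. K \<subset> J" using no by (metis psubsetI)
  then obtain s where s: "\<And>J. J \<in> C \<Longrightarrow> s J \<in> C \<and> s J \<subset> J" by metis
  define f where "f n = (s ^^ n) J0" for n
  have fC: "f n \<in> C" for n by (induct n) (auto simp: f_def J0 s)
  have fs: "f (Suc n) \<subset> f n" for n using s[OF fC[of n]] by (simp add: f_def)
  obtain N where "\<forall>n\<ge>N. f n = f N"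
    using assms(1,3) fC fs unfolding right_artinian_def by (metis psubset_imp_subset)
  then show False using fs[of N] by (metis le_Suc_eq order_refl psubsetE)
qed

lemma add_subgroup_image:
  assumes "add_subgroup X" "\<And>x y. f (x + y) = f x + f y" shows "add_subgroup (f ` X)"
proof -
  have 0: "f 0 = 0" using assms(2)[of 0 0] by simp
  have m: "f (- x) = - f x" for x
    using assms(2)[of x "- x"] 0 by (simp add: eq_neg_iff_add_eq_0 add.commute)
  show ?thesis
    unfolding add_subgroup_def
  proof (intro conjI ballI)
    show "0 \<in> f ` X" using 0 add_subgroup_zero[OF assms(1)] by (metis image_eqI)
    show "x + y \<in> f ` X" if "x \<in> f ` X" "y \<in> f ` X" for x y
      using that add_subgroup_add[OF assms(1)] by (auto simp flip: assms(2))
    show "- x \<in> f ` X" if "x \<in> f ` X" for x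
      using that add_subgroup_minus[OF assms(1)] by (auto simp flip: m)
  qed
qed

lemma right_ideal_plus:
  assumes "right_ideal R" "right_ideal P" shows "right_ideal {r + p | r p. r \<in> R \<and> p \<in> P}"
    (is "right_ideal ?S")
proof -
  note R = right_ideal_subgroup[OF assms(1)] and P = right_ideal_subgroup[OF assms(2)]
  show ?thesis
    unfolding right_ideal_def add_subgroup_def
  proof (intro conjI allI ballI)
    show "0 \<in> ?S"
      using R P by (intro CollectI exI[of _ 0]) (simp add: add_subgroup_zero)
  next
    fix x y assume "x \<in> ?S" "y \<in> ?S"
    then obtain q p q' p' where "x = q + p" "y = q' + p'" "q \<in> R" "p \<in> P" "q' \<in> R" "p' \<in> P" by blast
    then show "x + y \<in> ?S"
      using R P by (intro CollectI exI[of _ "q + q'"] exI[of _ "p + p'"]) (simp add: add_subgroup_add algebra_simps)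
  next
    fix x assume "x \<in> ?S"
    then obtain q p where x: "x = q + p" "q \<in> R" "p \<in> P" by blast
    then show "- x \<in> ?S"
      using R P by (intro CollectI exI[of _ "- q"] exI[of _ "- p"]) (simp add: add_subgroup_minus)
    show "x * a \<in> ?S" for a
      using x assms
      by (intro CollectI exI[of _ "q * a"] exI[of _ "p * a"]) (simp add: right_ideal_mult distrib_right)
  qed
qed

lemma right_ideal_image_mult:
  assumes "right_ideal X" shows "right_ideal ((*) a ` X)"
  unfolding right_ideal_def
proof (intro conjI ballI allI)
  show "add_subgroup ((*) a ` X)"
    by (rule add_subgroup_image[OF right_ideal_subgroup[OF assms]]) (rule distrib_left)
  show "x * b \<in> (*) a ` X" if "x \<in> (*) a ` X" for x b
    using that right_ideal_mult[OF assms] by (auto simp: mult.assoc)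
qed

lemma right_ideal_UNIV: "right_ideal UNIV"
  by (simp add: right_ideal_def add_subgroup_def)

text \<open>The preimage of the principal right ideal generated by f in the ring modulo P. Quotient
  rings are never formed; statements about them are made about preimages.\<close>

lemma right_ideal_shift:
  assumes "two_sided_ideal P"
  shows "right_ideal {f * q + p | q p. p \<in> P}"
    and "P \<subseteq> {f * q + p | q p. p \<in> P}"
    and "f \<in> {f * q + p | q p. p \<in> P}"
proof -
  have "{f * q + p | q p. p \<in> P} = {r + p | r p. r \<in> (*) f ` UNIV \<and> p \<in> P}" by blast
  then show "right_ideal {f * q + p | q p. p \<in> P}"
    using right_ideal_plus[OF right_ideal_image_mult[OF right_ideal_UNIV] ideal_right[OF assms]]
    by simp
  show "P \<subseteq> {f * q + p | q p. p \<in> P}" by (auto intro: exI[of _ 0])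
  show "f \<in> {f * q + p | q p. p \<in> P}"
    using add_subgroup_zero[OF ideal_subgroup[OF assms]]
    by (intro CollectI exI[of _ 1] exI[of _ 0]) simp
qed

section \<open>Prime ideals of right artinian rings\<close>

definition prime_ideal :: "'a::{ring,monoid_mult} set \<Rightarrow> bool" where
  "prime_ideal P \<longleftrightarrow> two_sided_ideal P \<and> 1 \<notin> P \<and>
    (\<forall>x y. (\<forall>q. x * q * y \<in> P) \<longrightarrow> x \<in> P \<or> y \<in> P)"

lemma prime_idealD:
  assumes "prime_ideal P"
  shows prime_ideal_ideal: "two_sided_ideal P"
    and prime_ideal_proper: "1 \<notin> P"
    and prime_ideal_mult: "x \<notin> P \<Longrightarrow> y \<notin> P \<Longrightarrow> \<exists>q. x * q * y \<notin> P"
  using assms by (auto simp: prime_ideal_def)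

text \<open>Brauer's lemma modulo P. For V minimal among the right ideals inside R that properly
  contain P, a suitable \<open>v1\<close> satisfies v1 V + P = V. So \<open>v1\<close> is congruent
  to \<open>v1 * e\<close> with e in V, and e is idempotent modulo P because \<open>v1\<close> sends
  nothing of V outside P into P. The last property says that \<open>e * x\<close> generates V over P
  again.\<close>

lemma prime_ideal_idempotent:
  fixes P :: "'a::{ring,monoid_mult} set"
  assumes art: "right_artinian TYPE('a)" and pr: "prime_ideal P"
    and R: "right_ideal R" "P \<subseteq> R" "R \<noteq> P"
  obtains e where "e \<in> R" "e \<notin> P" "e * e - e \<in> P" "\<And>x. e * x \<notin> P \<Longrightarrow> \<exists>y. e * x * y - e \<in> P"
proof -
  note id = prime_ideal_ideal[OF pr]
  note P = add_subgroupD[OF ideal_subgroup[OF id]] idealD[OF id]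
  let ?C = "{V. right_ideal V \<and> P \<subseteq> V \<and> V \<subseteq> R \<and> V \<noteq> P}"
  have "\<exists>V\<in>?C. \<forall>K\<in>?C. K \<subseteq> V \<longrightarrow> K = V"
    by (rule right_artinian_minimal[OF art]) (use R in auto)
  then obtain V where V: "V \<in> ?C" and Vm: "\<forall>K\<in>?C. K \<subseteq> V \<longrightarrow> K = V" ..
  have Vmin: "K = V" if "K \<in> ?C" "K \<subseteq> V" for K using Vm that by simp
  from V have Vr: "right_ideal V" and PV: "P \<subseteq> V" "V \<noteq> P" and VR: "V \<subseteq> R" by auto
  note Vs = add_subgroupD[OF right_ideal_subgroup[OF Vr]] right_ideal_mult[OF Vr]
  have shift: "{f * q + p | q p. p \<in> P} = V" if "f \<in> V" "f \<notin> P" for f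
  proof (rule Vmin)
    have "{f * q + p | q p. p \<in> P} \<subseteq> V"
      using Vs(2) Vs(5)[OF that(1)] PV by blast
    moreover have "{f * q + p | q p. p \<in> P} \<noteq> P"
      using right_ideal_shift(3)[OF id, of f] that(2) by metis
    ultimately show "{f * q + p | q p. p \<in> P} \<in> ?C" "{f * q + p | q p. p \<in> P} \<subseteq> V"
      using right_ideal_shift[OF id, of f] VR by auto
  qed
  obtain v where v: "v \<in> V" "v \<notin> P" using PV by blast
  \<comment> \<open>Primeness is used with both factors equal to v: the element
    \<open>v1 = v * q\<close> lies in V and does not map V into P.\<close>
  obtain q where q: "v * q * v \<notin> P" using prime_ideal_mult[OF pr v(2) v(2)] by blast
  define v1 where "v1 = v * q"
  have v1: "v1 \<in> V" "v1 * v \<notin> P" using Vs(5)[OF v(1)] q by (auto simp: v1_def)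
  then have "v1 \<notin> P" using P(9) by blast
  have "v1 * v \<in> V" using Vs(5) v1 by blast
  have eqV: "{v1 * x + p | x p. x \<in> V \<and> p \<in> P} = V"
  proof -
    obtain K where K: "K = {v1 * v * y + p | y p. p \<in> P}" by blast
    have "K = V" unfolding K by (rule shift) fact+
    moreover have "K \<subseteq> {v1 * x + p | x p. x \<in> V \<and> p \<in> P}"
      unfolding K using Vs(5)[OF v(1)] by (fastforce simp: mult.assoc)
    moreover have "{v1 * x + p | x p. x \<in> V \<and> p \<in> P} \<subseteq> V"
      using Vs(2) Vs(5)[OF v1(1)] PV by blast
    ultimately show ?thesis by blast
  qed
  then obtain e p where e: "e \<in> V" "p \<in> P" "v1 = v1 * e + p" using v1(1) by blast
  \<comment> \<open>The elements of V sent into P by \<open>v1\<close> form a right ideal between P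
    and V. It does not contain v, so minimality makes it P.\<close>
  have ann: "{x \<in> V. v1 * x \<in> P} = P" (is "?A = P")
  proof (rule ccontr)
    assume "?A \<noteq> P"
    moreover have "right_ideal ?A"
      using Vs P by (auto simp: right_ideal_def add_subgroup_def distrib_left simp flip: mult.assoc)
    moreover have "P \<subseteq> ?A" using PV P(8) by blast
    moreover have "?A \<subseteq> V" by blast
    ultimately have "?A = V" using VR by (intro Vmin) auto
    then show False using v(1) v1(2) by blast
  qed
  have v1e: "v1 * e - v1 \<in> P" using P(3)[OF e(2)] by (subst (2) e(3)) simp
  have "v1 * (e * e - e) = (v1 * e - v1) * e" by (simp add: algebra_simps)
  then have "v1 * (e * e - e) \<in> P" using P(9)[OF v1e] by simp
  moreover have "e * e - e \<in> V" using Vs(4,5) e(1) by blast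
  ultimately have ee: "e * e - e \<in> P" using ann by blast
  have eP: "e \<notin> P"
  proof
    assume "e \<in> P"
    then have "v1 * e + p \<in> P" using P(2,8) e(2) by blast
    then show False using \<open>v1 \<notin> P\<close> e(3) by simp
  qed
  show thesis
  proof (rule that[OF _ eP ee])
    show "e \<in> R" using e VR by blast
    fix x assume x: "e * x \<notin> P"
    have "e * x \<in> V" using Vs(5) e(1) by blast
    from shift[OF this x] e(1) obtain y p where "e = e * x * y + p" "p \<in> P" by blast
    then have "e * x * y - e = - p" by (metis add_diff_cancel_left' minus_diff_eq)
    then show "\<exists>y. e * x * y - e \<in> P" using P(3)[OF \<open>p \<in> P\<close>] by metis
  qed
qed

text \<open>The ring modulo P is simple. Among the idempotents f modulo P that lie in X, one is
  chosen whose complement, generated by 1 - f and P, is smallest. A complement larger than P would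
  contain an idempotent r from X, and joining r to f would shrink it.\<close>

lemma prime_ideal_comaximal:
  fixes P :: "'a::{ring,monoid_mult} set"
  assumes art: "right_artinian TYPE('a)" and pr: "prime_ideal P"
    and X: "two_sided_ideal X" "\<not> X \<subseteq> P"
  obtains x where "x \<in> X" "1 - x \<in> P"
proof -
  note id = prime_ideal_ideal[OF pr]
  note P = add_subgroupD[OF ideal_subgroup[OF id]] idealD[OF id]
  note Xs = add_subgroupD[OF ideal_subgroup[OF X(1)]] idealD[OF X(1)]
  let ?R = "\<lambda>f. {(1 - f) * q + p | q p. p \<in> P}"
  let ?C = "{R. \<exists>f. f \<in> X \<and> f * f - f \<in> P \<and> R = ?R f}"
  have "?R 0 \<in> ?C" using Xs(1) P(1) by (intro CollectI exI[of _ 0]) simp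
  then have "?C \<noteq> {}" by blast
  moreover have "right_ideal R" if "R \<in> ?C" for R
    using that right_ideal_shift(1)[OF id] by blast
  ultimately have "\<exists>R\<in>?C. \<forall>K\<in>?C. K \<subseteq> R \<longrightarrow> K = R"
    by (intro right_artinian_minimal[OF art])
  then obtain R where RC: "R \<in> ?C" and Rm: "\<forall>K\<in>?C. K \<subseteq> R \<longrightarrow> K = R" ..
  have min: "K = R" if "K \<in> ?C" "K \<subseteq> R" for K using Rm that by simp
  from RC obtain f where f: "f \<in> X" "f * f - f \<in> P" and R: "R = ?R f" by blast
  have Rr: "right_ideal R" "P \<subseteq> R" "1 - f \<in> R"
    unfolding R by (rule right_ideal_shift[OF id])+
  note Rs = add_subgroupD[OF right_ideal_subgroup[OF Rr(1)]] right_ideal_mult[OF Rr(1)]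
  have "1 - f \<in> P"
  proof (rule ccontr)
    assume nf: "1 - f \<notin> P"
    \<comment> \<open>The part of the complement that meets X, enlarged by P. It exceeds P because
      primeness puts some \<open>(1 - f) * q * x\<close> with x in X outside P.\<close>
    define R' where "R' = {r + p | r p. r \<in> R \<inter> X \<and> p \<in> P}"
    have "right_ideal (R \<inter> X)" using Rr(1) Xs(6) by (simp add: right_ideal_def add_subgroup_def)
    then have r': "right_ideal R'" unfolding R'_def by (rule right_ideal_plus[OF _ P(6)])
    have PR': "P \<subseteq> R'"
    proof
      fix p assume "p \<in> P"
      then show "p \<in> R'"
        unfolding R'_def using Rs(1) Xs(1) by (intro CollectI exI[of _ 0] exI[of _ p]) simp
    qed
    have "R' \<noteq> P"
    proof -
      obtain x where x: "x \<in> X" "x \<notin> P" using X(2) by blast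
      obtain q where q: "(1 - f) * q * x \<notin> P" using prime_ideal_mult[OF pr nf x(2)] by blast
      have "(1 - f) * q * x \<in> R \<inter> X" using Rs(5) Rr(3) Xs(8) x(1) by blast
      then have "(1 - f) * q * x + 0 \<in> R'" unfolding R'_def using P(1) by blast
      then show ?thesis using q by auto
    qed
    from prime_ideal_idempotent[OF art pr r' PR' this] obtain e where
      e: "e \<in> R'" "e \<notin> P" "e * e - e \<in> P" by metis
    then obtain r p where r: "e = r + p" "r \<in> R" "r \<in> X" "p \<in> P" unfolding R'_def by blast
    have rP: "r \<notin> P" using e(2) r(1,4) P(2) by blast
    have "r * r - r = (e * e - e) - e * p - p * r + p" unfolding r(1) by (simp add: algebra_simps)
    then have rr: "r * r - r \<in> P" using e(3) r(4) P by auto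
    obtain q p' where qp: "r = (1 - f) * q + p'" "p' \<in> P" using r(2) R by blast
    have "f * r = f * p' - (f * f - f) * q" unfolding qp(1) by (simp add: algebra_simps)
    then have fr: "f * r \<in> P" using f(2) qp(2) P by auto
    \<comment> \<open>As \<open>f * r\<close> vanishes modulo P, f and r join to one idempotent
      modulo P. Since \<open>1 - f' = (1 - r) * (1 - f)\<close>, left multiplication by r kills the
      new complement modulo P.\<close>
    define f' where "f' = f + r - r * f"
    have f'1: "1 - f' = (1 - r) * (1 - f)" by (simp add: f'_def algebra_simps)
    have "f' * f' - f' = (1 - f') * (1 - f') - (1 - f')" by (simp add: algebra_simps)
    also have "\<dots> = (1 - r) * (f * f - f) + (r * r - r) * (1 - f) + (1 - r) * (f * r) * (1 - f)"
      unfolding f'1 by (simp add: algebra_simps)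
    finally have "f' * f' - f' \<in> P" using fr f(2) rr P by auto
    moreover have "f' \<in> X" unfolding f'_def using f(1) r(3) Xs by auto
    ultimately have C: "?R f' \<in> ?C" by blast
    have "?R f' \<subseteq> R"
    proof clarify
      fix q p assume p: "p \<in> P"
      have "(1 - f') * q + p = ((1 - f) * q + p) - r * ((1 - f) * q)"
        unfolding f'1 by (simp add: algebra_simps)
      then show "(1 - f') * q + p \<in> R" using Rs(4,5) Rr r(2) p Rs(2) by (metis subsetD)
    qed
    \<comment> \<open>By minimality the complement has not shrunk and still contains r, so
      \<open>r * r\<close>, and with it r, lies in P.\<close>
    from min[OF C this] r(2) obtain q p where "r = (1 - f') * q + p" "p \<in> P" by blast
    then have "r * r = r * ((1 - f') * q + p)" by simp
    also have "\<dots> = r * p - (r * r - r) * ((1 - f) * q)"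
      unfolding f'1 by (simp add: algebra_simps)
    finally have "r * r = r * p - (r * r - r) * ((1 - f) * q)" .
    moreover have "r * p - (r * r - r) * ((1 - f) * q) \<in> P" using rr \<open>p \<in> P\<close> P(4,8,9) by blast
    ultimately have "r * r \<in> P" by simp
    then have "r * r - (r * r - r) \<in> P" using rr P by blast
    then show False using rP by simp
  qed
  then show thesis using that f(1) by blast
qed

text \<open>Otherwise P' contains an element congruent to 1 modulo P, hence 1. Distinct primes are
  thus incomparable, as the Chinese remainder theorem requires.\<close>

lemma prime_ideal_maximal:
  fixes P :: "'a::{ring,monoid_mult} set"
  assumes "right_artinian TYPE('a)" "prime_ideal P" "prime_ideal P'" "P \<subseteq> P'"
  shows "P = P'"
proof (rule ccontr)
  assume "P \<noteq> P'"
  then have "\<not> P' \<subseteq> P" using assms(4) by blast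
  from prime_ideal_comaximal[OF assms(1,2) prime_ideal_ideal[OF assms(3)] this]
  obtain x where "x \<in> P'" "1 - x \<in> P" by blast
  then have "x + (1 - x) \<in> P'"
    using assms(4) add_subgroup_add[OF ideal_subgroup[OF prime_ideal_ideal[OF assms(3)]]]
    by blast
  then show False using prime_ideal_proper[OF assms(3)] by simp
qed

section \<open>Intersections of primes and the Chinese remainder theorem\<close>

lemma ideal_UNIV: "two_sided_ideal UNIV"
  by (simp add: two_sided_ideal_def left_ideal_def right_ideal_def add_subgroup_def)

lemma ideal_Int:
  "two_sided_ideal X \<Longrightarrow> two_sided_ideal Y \<Longrightarrow> two_sided_ideal (X \<inter> Y)"
  by (simp add: two_sided_ideal_def left_ideal_def right_ideal_def add_subgroup_def)

lemma ideal_Inter: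
  "(\<And>X. X \<in> F \<Longrightarrow> two_sided_ideal X) \<Longrightarrow> two_sided_ideal (\<Inter>F)"
  by (simp add: two_sided_ideal_def left_ideal_def right_ideal_def add_subgroup_def)

lemma prime_ideal_Int:
  assumes "prime_ideal P" "two_sided_ideal X" "two_sided_ideal Y" "\<not> X \<subseteq> P" "\<not> Y \<subseteq> P"
  shows "\<not> X \<inter> Y \<subseteq> P"
proof -
  obtain x y where x: "x \<in> X" "x \<notin> P" "y \<in> Y" "y \<notin> P" using assms(4,5) by blast
  then obtain q where "x * q * y \<notin> P" using prime_ideal_mult[OF assms(1)] by blast
  moreover have "x * q * y \<in> X" "x * q * y \<in> Y"
    using x ideal_mult_left[OF assms(3)] ideal_mult_right[OF assms(2)] by auto
  ultimately show ?thesis by blast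
qed

text \<open>No other member of F lies in P, so by primeness neither does the intersection of X with
  all of them; this intersection is comaximal with P.\<close>

lemma prime_ideal_crt:
  fixes P :: "'a::{ring,monoid_mult} set"
  assumes art: "right_artinian TYPE('a)" and F: "finite F" "\<And>P. P \<in> F \<Longrightarrow> prime_ideal P"
    and P: "P \<in> F" and X: "two_sided_ideal X" "\<not> X \<subseteq> P"
  obtains y where "y \<in> X" "1 - y \<in> P" "\<And>P'. P' \<in> F \<Longrightarrow> P' \<noteq> P \<Longrightarrow> y \<in> P'"
proof -
  have "finite G \<Longrightarrow> G \<subseteq> F - {P} \<Longrightarrow> two_sided_ideal (X \<inter> \<Inter>G) \<and> \<not> X \<inter> \<Inter>G \<subseteq> P" for G
  proof (induct G rule: finite_induct)
    case empty
    then show ?case using X by simp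
  next
    case (insert P' G)
    then have P': "prime_ideal P'" "P' \<noteq> P" using F by auto
    then have "\<not> P' \<subseteq> P" using prime_ideal_maximal[OF art P'(1) F(2)[OF P]] by blast
    moreover have "X \<inter> \<Inter>(insert P' G) = P' \<inter> (X \<inter> \<Inter>G)" by blast
    ultimately show ?case
      using insert prime_ideal_Int[OF F(2)[OF P] prime_ideal_ideal[OF P'(1)]]
        ideal_Int[OF prime_ideal_ideal[OF P'(1)]] by auto
  qed
  from this[of "F - {P}"] F(1) have
    "two_sided_ideal (X \<inter> \<Inter>(F - {P}))" "\<not> X \<inter> \<Inter>(F - {P}) \<subseteq> P" by auto
  from prime_ideal_comaximal[OF art F(2)[OF P] this] obtain y
    where "y \<in> X \<inter> \<Inter>(F - {P})" "1 - y \<in> P" by blast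
  then show thesis using that[of y] by blast
qed

text \<open>By Zorn's lemma there is an ideal maximal among those containing no power of x. It is
  prime: adjoining a or b yields ideals that each contain a power of x, and the product of the two
  powers falls back into it if all \<open>a * q * b\<close> do.\<close>

lemma prime_radical_nil:
  fixes x :: "'a::{ring,monoid_mult}"
  assumes "\<And>P. prime_ideal P \<Longrightarrow> x \<in> P"
  shows "\<exists>n. x ^ n = 0"
proof (rule ccontr)
  assume nn: "\<nexists>n. x ^ n = 0"
  let ?A = "{P. two_sided_ideal P \<and> (\<forall>n. x ^ n \<notin> P)}"
  have "\<exists>M\<in>?A. \<forall>X\<in>?A. M \<subseteq> X \<longrightarrow> X = M"
  proof (rule subset_Zorn_nonempty)
    have "two_sided_ideal ({0} :: 'a set)"
      by (simp add: two_sided_ideal_def left_ideal_def right_ideal_def add_subgroup_def)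
    then show "?A \<noteq> {}" using nn by blast
    fix C assume C: "C \<noteq> {}" "subset.chain ?A C"
    have ch: "X \<subseteq> Y \<or> Y \<subseteq> X" if "X \<in> C" "Y \<in> C" for X Y
      using C(2) that by (auto simp: subset.chain_def)
    have id: "two_sided_ideal X" if "X \<in> C" for X using C(2) that by (auto simp: subset.chain_def)
    have "x ^ n \<notin> X" if "X \<in> C" for X n using C(2) that by (auto simp: subset.chain_def)
    moreover have "two_sided_ideal (\<Union>C)"
      unfolding two_sided_ideal_def left_ideal_def right_ideal_def add_subgroup_def
    proof (intro conjI allI ballI)
      obtain X where "X \<in> C" using C(1) by blast
      then show "0 \<in> \<Union>C" using add_subgroup_zero[OF ideal_subgroup[OF id]] by blast
      then show "0 \<in> \<Union>C" .
    next
      fix a b assume "a \<in> \<Union>C" "b \<in> \<Union>C"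
      then obtain X Y where "X \<in> C" "Y \<in> C" "a \<in> X" "b \<in> Y" by blast
      then obtain Z where "Z \<in> C" "a \<in> Z" "b \<in> Z" using ch[of X Y] by blast
      then show "a + b \<in> \<Union>C" using add_subgroup_add[OF ideal_subgroup[OF id]] by blast
      then show "a + b \<in> \<Union>C" .
    next
      fix a assume "a \<in> \<Union>C"
      then obtain X where X: "X \<in> C" "a \<in> X" by blast
      show "- a \<in> \<Union>C" using X add_subgroup_minus[OF ideal_subgroup[OF id[OF X(1)]]] by blast
      then show "- a \<in> \<Union>C" .
      show "b * a \<in> \<Union>C" "a * b \<in> \<Union>C" for b
        using X ideal_mult_left[OF id[OF X(1)]] ideal_mult_right[OF id[OF X(1)]]
        by blast+
    qed
    ultimately show "\<Union>C \<in> ?A" by blast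
  qed
  then obtain P where PA: "P \<in> ?A" and PM: "\<forall>X\<in>?A. P \<subseteq> X \<longrightarrow> X = P" ..
  have P: "two_sided_ideal P" "\<And>n. x ^ n \<notin> P" using PA by simp_all
  note Ps = add_subgroupD[OF ideal_subgroup[OF P(1)]] idealD[OF P(1)]
  have pow: "\<exists>n. x ^ n \<in> generated_ideal (insert a P)" if a: "a \<notin> P" for a
  proof (rule ccontr)
    assume "\<nexists>n. x ^ n \<in> generated_ideal (insert a P)"
    then have "generated_ideal (insert a P) \<in> ?A" by (simp add: generated_ideal)
    moreover have sub: "insert a P \<subseteq> generated_ideal (insert a P)" by (rule generated_ideal_inc)
    ultimately have "generated_ideal (insert a P) = P" using PM by auto
    then show False using a sub by simp
  qed
  have "prime_ideal P"
    unfolding prime_ideal_def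
  proof (intro conjI allI impI P(1))
    show "1 \<notin> P" using P(2)[of 0] by simp
    fix a b assume ab: "\<forall>q. a * q * b \<in> P"
    show "a \<in> P \<or> b \<in> P"
    proof (rule ccontr)
      assume "\<not> (a \<in> P \<or> b \<in> P)"
      then obtain i j where ij: "x ^ i \<in> generated_ideal (insert a P)" "x ^ j \<in> generated_ideal (insert b P)"
        using pow by blast
      have "a * q * z \<in> P" if "z \<in> generated_ideal (insert b P)" for q z
        using that unfolding generated_ideal_def
      proof (induct rule: add_subgroup_hull_induct)
        case (base z)
        then obtain u y v where z: "z = u * y * v" "y \<in> insert b P" by blast
        have "a * (q * u) * y \<in> P"
          using z(2) ab Ps(8) by (cases "y = b") auto
        then show ?case unfolding z(1) using Ps(9)[of "a * (q * u) * y" v] by (simp add: mult.assoc)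
      qed (auto simp: distrib_left Ps)
      then have az: "a * z \<in> P" if "z \<in> generated_ideal (insert b P)" for z
        using that by (metis mult.right_neutral)
      have "w * z \<in> P" if w: "w \<in> generated_ideal (insert a P)" and z: "z \<in> generated_ideal (insert b P)" for w z
        using w unfolding generated_ideal_def
      proof (induct rule: add_subgroup_hull_induct)
        case (base w)
        then obtain u y v where w: "w = u * y * v" "y \<in> insert a P" by blast
        have "v * z \<in> generated_ideal (insert b P)"
          using z ideal_mult_left[OF generated_ideal] by blast
        then have "y * (v * z) \<in> P" using w(2) az Ps(9) by (cases "y = a") auto
        then show ?case unfolding w(1) using Ps(8)[of "y * (v * z)" u] by (simp add: mult.assoc)
      qed (auto simp: distrib_right Ps)
      then have "x ^ (i + j) \<in> P" using ij by (simp add: power_add)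
      then show False using P(2) by blast
    qed
  qed
  then show False using assms P(2)[of 1] by simp
qed

lemma finite_prime_radical:
  assumes "right_artinian TYPE('a)"
  obtains F :: "'a::{ring,monoid_mult} set set" where "finite F" "\<And>P. P \<in> F \<Longrightarrow> prime_ideal P"
    "\<And>x. x \<in> \<Inter>F \<Longrightarrow> \<exists>n. x ^ n = 0"
proof -
  let ?C = "{\<Inter>F | F. finite F \<and> (\<forall>P\<in>F. prime_ideal (P :: 'a set))}"
  have "?C \<noteq> {}" by blast
  moreover have "right_ideal J" if "J \<in> ?C" for J
  proof -
    from that obtain F where "J = \<Inter>F" "\<forall>P\<in>F. prime_ideal P" by blast
    then show ?thesis
      using ideal_right[OF ideal_Inter, of F] prime_ideal_ideal by blast
  qed
  ultimately have "\<exists>J\<in>?C. \<forall>K\<in>?C. K \<subseteq> J \<longrightarrow> K = J"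
    by (intro right_artinian_minimal[OF assms])
  then obtain J where JC: "J \<in> ?C" and Jm: "\<forall>K\<in>?C. K \<subseteq> J \<longrightarrow> K = J" ..
  have min: "K = J" if "K \<in> ?C" "K \<subseteq> J" for K using Jm that by simp
  obtain F where F: "finite F" "\<forall>P\<in>F. prime_ideal P" "J = \<Inter>F" using JC by blast
  have JP: "J \<subseteq> P" if "prime_ideal P" for P
  proof -
    have "\<Inter>(insert P F) \<in> ?C" using F(1,2) that by blast
    then have "\<Inter>(insert P F) = J" by (rule min) (simp add: F(3))
    then show ?thesis by blast
  qed
  show thesis
  proof (rule that[of F])
    fix x assume "x \<in> \<Inter>F"
    then show "\<exists>n. x ^ n = 0" using JP F(3) by (intro prime_radical_nil) blast
  qed (use F in auto)
qed

lemma prime_radical_unit: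
  fixes x :: "'a::{ring,monoid_mult}"
  assumes "x ^ n = 0"
  shows "\<exists>y. y * (1 - x) = 1"
proof -
  have "(\<Sum>i<n. x ^ i) * (1 - x) = 1 - x ^ n"
  proof (induct n)
    case (Suc n)
    have "(\<Sum>i<Suc n. x ^ i) * (1 - x) = (1 - x ^ n) + x ^ n * (1 - x)"
      by (simp only: sum.lessThan_Suc distrib_right Suc)
    then show ?case by (simp add: right_diff_distrib power_commutes)
  qed simp
  then show ?thesis using assms by auto
qed

section \<open>Congruences, and the ring modulo P as a matrix ring over a division ring\<close>

definition cong_mod :: "'a::ab_group_add set \<Rightarrow> 'a \<Rightarrow> 'a \<Rightarrow> bool" where
  "cong_mod S x y \<longleftrightarrow> x - y \<in> S"

lemma cong_modD: "cong_mod S x y \<Longrightarrow> x - y \<in> S"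
  by (simp add: cong_mod_def)

lemma cong_mod_mono: "S \<subseteq> T \<Longrightarrow> cong_mod S x y \<Longrightarrow> cong_mod T x y"
  by (auto simp: cong_mod_def)

lemma cong_mod_subgroup:
  assumes "add_subgroup S"
  shows cong_mod_refl: "cong_mod S x x"
    and cong_mod_sym: "cong_mod S x y \<Longrightarrow> cong_mod S y x"
    and cong_mod_trans: "cong_mod S x y \<Longrightarrow> cong_mod S y z \<Longrightarrow> cong_mod S x z"
    and cong_mod_add: "cong_mod S x y \<Longrightarrow> cong_mod S x' y' \<Longrightarrow> cong_mod S (x + x') (y + y')"
    and cong_mod_diff: "cong_mod S x y \<Longrightarrow> cong_mod S x' y' \<Longrightarrow> cong_mod S (x - x') (y - y')"
    and cong_mod_mem: "cong_mod S x y \<Longrightarrow> y \<in> S \<Longrightarrow> x \<in> S"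
    and cong_mod_sum: "(\<And>i. i \<in> K \<Longrightarrow> cong_mod S (f i) (g i)) \<Longrightarrow> cong_mod S (sum f K) (sum g K)"
proof -
  note S = add_subgroupD[OF assms]
  show "cong_mod S x x" using S(1) by (simp add: cong_mod_def)
  show "cong_mod S y x" if "cong_mod S x y"
    using S(3)[OF cong_modD[OF that]] by (simp add: cong_mod_def)
  show "cong_mod S x z" if "cong_mod S x y" "cong_mod S y z"
    using S(2)[OF that[THEN cong_modD]] by (simp add: cong_mod_def)
  show "cong_mod S (x + x') (y + y')" if "cong_mod S x y" "cong_mod S x' y'"
    using S(2)[OF that[THEN cong_modD]] by (simp add: cong_mod_def algebra_simps)
  show "cong_mod S (x - x') (y - y')" if "cong_mod S x y" "cong_mod S x' y'"
    using S(4)[OF that[THEN cong_modD]] by (simp add: cong_mod_def algebra_simps)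
  show "x \<in> S" if "cong_mod S x y" "y \<in> S"
    using S(2)[OF cong_modD[OF that(1)] that(2)] by simp
  show "cong_mod S (sum f K) (sum g K)" if "\<And>i. i \<in> K \<Longrightarrow> cong_mod S (f i) (g i)"
    unfolding cong_mod_def sum_subtractf[symmetric]
    by (rule add_subgroup_sum[OF assms]) (use that in \<open>simp add: cong_mod_def\<close>)
qed

lemma cong_mod_left: "left_ideal S \<Longrightarrow> cong_mod S x y \<Longrightarrow> cong_mod S (a * x) (a * y)"
  using left_ideal_mult[of S "x - y" a] by (simp add: cong_mod_def algebra_simps)

lemma cong_mod_right: "right_ideal S \<Longrightarrow> cong_mod S x y \<Longrightarrow> cong_mod S (x * a) (y * a)"
  using right_ideal_mult[of S "x - y" a] by (simp add: cong_mod_def algebra_simps)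

text \<open>Schur's lemma: \<open>prime_ideal_idempotent\<close> gives each nonzero element of e Q e
  modulo P a right inverse, which is again nonzero, and a ring in which this holds has two-sided
  inverses.\<close>

lemma prime_ideal_division:
  fixes P :: "'a::{ring,monoid_mult} set"
  assumes "right_artinian TYPE('a)" "prime_ideal P"
  obtains e where "e \<notin> P" "cong_mod P (e * e) e"
    "\<And>d. e * d * e \<notin> P \<Longrightarrow> \<exists>d'. cong_mod P (e * d * e * (e * d' * e)) e \<and>
        cong_mod P (e * d' * e * (e * d * e)) e"
proof -
  note id = prime_ideal_ideal[OF assms(2)]
  note P = cong_mod_subgroup[OF ideal_subgroup[OF id]]
  note L = cong_mod_left[OF ideal_left[OF id]]
  note R = cong_mod_right[OF ideal_right[OF id]]
  have 1: "right_ideal UNIV" "UNIV \<noteq> P"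
    using prime_ideal_proper[OF assms(2)] by (auto simp: right_ideal_def add_subgroup_def)
  obtain e where e: "e \<notin> P" "e * e - e \<in> P" "\<And>x. e * x \<notin> P \<Longrightarrow> \<exists>y. e * x * y - e \<in> P"
    by (rule prime_ideal_idempotent[OF assms 1(1) _ 1(2)]) auto
  have ee: "cong_mod P (e * e) e" using e(2) by (simp add: cong_mod_def)
  have inv: "\<exists>y. cong_mod P (e * d * e * (e * y * e)) e" if d: "e * d * e \<notin> P" for d
  proof -
    obtain y where y: "cong_mod P (e * (d * e) * y) e"
      using e(3)[of "d * e"] d by (auto simp: cong_mod_def mult.assoc)
    have "cong_mod P (e * d * (e * e) * (y * e)) (e * d * e * (y * e))"
      by (intro R L ee)
    moreover have "cong_mod P (e * (d * e) * y * e) (e * e)" by (intro R y)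
    ultimately have "cong_mod P (e * d * e * (e * y * e)) (e * e)"
      using P(3) by (metis mult.assoc)
    then show ?thesis using P(3) ee by blast
  qed
  show thesis
  proof (rule that[OF e(1) ee])
    fix d assume d: "e * d * e \<notin> P"
    obtain d' where d': "cong_mod P (e * d * e * (e * d' * e)) e" using inv[OF d] by blast
    have "e * d' * e \<notin> P"
    proof
      assume "e * d' * e \<in> P"
      then have "e * d * e * (e * d' * e) \<in> P" by (rule ideal_mult_left[OF id])
      then show False using e(1) P(2)[OF d'] P(6) by blast
    qed
    \<comment> \<open>The right inverse of the right inverse; bracketing the triple product in two
      ways identifies it with \<open>e * d * e\<close>.\<close>
    then obtain d'' where d'': "cong_mod P (e * d' * e * (e * d'' * e)) e" using inv by blast
    have 1: "cong_mod P (e * d * (e * e)) (e * d * e)" by (intro L ee)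
    have 2: "cong_mod P (e * d * e * (e * d' * e * (e * d'' * e))) (e * d * e * e)"
      by (intro L d'')
    have 3: "cong_mod P (e * d * e * (e * d' * e) * (e * d'' * e)) (e * (e * d'' * e))"
      by (intro R d')
    have 4: "cong_mod P (e * e * (d'' * e)) (e * (d'' * e))" by (intro R ee)
    have "cong_mod P (e * d * e) (e * d'' * e)"
      using P(3)[OF P(2)[OF P(3)[OF 2[unfolded mult.assoc] 1[unfolded mult.assoc]]]
          P(3)[OF 3[unfolded mult.assoc] 4[unfolded mult.assoc]]] by (simp add: mult.assoc)
    then have "cong_mod P (e * d' * e * (e * d * e)) (e * d' * e * (e * d'' * e))" by (intro L)
    then show "\<exists>d'. cong_mod P (e * d * e * (e * d' * e)) e \<and> cong_mod P (e * d' * e * (e * d * e)) e"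
      using d' d'' P(3) by blast
  qed
qed

text \<open>Wedderburn's theorem in coordinates: modulo \<open>P\<close> the columns \<open>\<alpha> i\<close> and the rows \<open>\<beta> j\<close>
  are dual bases over the division ring \<open>e Q e\<close>, so the \<open>\<alpha> i * \<beta> j\<close> are matrix units up to
  scalars.\<close>

lemma prime_ideal_wedderburn:
  fixes P :: "'a::{ring,monoid_mult} set"
  assumes art: "right_artinian TYPE('a)" and pr: "prime_ideal P"
  obtains e and m :: nat and \<alpha> \<beta> :: "nat \<Rightarrow> 'a" where "cong_mod P (e * e) e"
    "\<forall>d. e * d * e \<notin> P \<longrightarrow> (\<exists>d'. cong_mod P (e * d' * e * (e * d * e)) e)"
    "m > 0" "\<forall>i<m. cong_mod P (\<alpha> i * e) (\<alpha> i) \<and> cong_mod P (e * \<beta> i) (\<beta> i)"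
    "cong_mod P (\<Sum>i<m. \<alpha> i * \<beta> i) 1"
    "\<forall>i<m. \<forall>j<m. cong_mod P (\<beta> i * \<alpha> j) (if i = j then e else 0)"
proof -
  note id = prime_ideal_ideal[OF pr]
  note Ps = ideal_subgroup[OF id]
  note P = cong_mod_subgroup[OF Ps]
  note [trans] = P(3)
  note L = cong_mod_left[OF ideal_left[OF id]]
  note R = cong_mod_right[OF ideal_right[OF id]]
  obtain e where e: "e \<notin> P" "cong_mod P (e * e) e"
    and div: "\<And>d. e * d * e \<notin> P \<Longrightarrow> \<exists>d'. cong_mod P (e * d * e * (e * d' * e)) e \<and>
        cong_mod P (e * d' * e * (e * d * e)) e"
    by (rule prime_ideal_division[OF assms]) metis
  \<comment> \<open>A shortest expression of 1 through e is wanted, because minimal length makes the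
    columns \<open>u i * e\<close> independent over e Q e modulo P.\<close>
  define good where "good K u w \<longleftrightarrow> finite K \<and> cong_mod P (\<Sum>i\<in>K. u i * e * w i) 1"
    for K :: "nat set" and u w
  obtain K0 where "\<exists>u w. good K0 u w"
  proof -
    have "\<not> generated_ideal {e} \<subseteq> P" using e(1) generated_ideal_inc by blast
    then obtain x where x: "x \<in> generated_ideal {e}" "1 - x \<in> P"
      by (rule prime_ideal_comaximal[OF assms generated_ideal])
    then obtain n :: nat and u w where "x = (\<Sum>i<n. u i * e * w i)"
      using generated_ideal_singleton_sum by blast
    then have "good {..<n} u w" using x(2) P(2)[of 1 x] by (simp add: good_def cong_mod_def)
    then show thesis using that by blast
  qed
  then obtain K u w where K: "good K u w" and min: "\<And>K' u' w'. good K' u' w' \<Longrightarrow> card K \<le> card K'"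
    using ex_has_least_nat[of "\<lambda>K. \<exists>u w. good K u w" K0 card] by metis
  have finK: "finite K" and sumK: "cong_mod P (\<Sum>i\<in>K. u i * e * w i) 1" using K by (auto simp: good_def)
  \<comment> \<open>A coefficient outside P has an inverse; subtracting the relation, multiplied by
    \<open>e * r * e * w k\<close>, removes the term k, contrary to minimality.\<close>
  have indep: "e * d k * e \<in> P" if rel: "(\<Sum>i\<in>K. u i * e * (e * d i * e)) \<in> P" and k: "k \<in> K" for d k
  proof (rule ccontr)
    assume "e * d k * e \<notin> P"
    then obtain r where r: "cong_mod P (e * d k * e * (e * r * e)) e" using div by blast
    define w' where "w' i = w i - e * d i * e * (e * r * e) * w k" for i
    have split: "(\<Sum>i\<in>K. f i) = f k + (\<Sum>i\<in>K-{k}. f i)" for f :: "nat \<Rightarrow> 'a"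
      using finK k by (rule sum.remove)
    have 1: "(\<Sum>i\<in>K. u i * e * (e * d i * e * (e * r * e) * w k)) \<in> P"
      using ideal_mult_right[OF id rel, of "e * r * e * w k"]
      by (simp add: sum_distrib_right mult.assoc)
    have 2: "cong_mod P (u k * e * (e * d k * e * (e * r * e) * w k)) (u k * e * w k)"
    proof -
      have "cong_mod P (u k * e * ((e * d k * e * (e * r * e)) * w k)) (u k * e * (e * w k))"
        by (intro L R r)
      also have "cong_mod P (u k * (e * e) * w k) (u k * e * w k)" by (intro L R e)
      then have "cong_mod P (u k * e * (e * w k)) (u k * e * w k)" by (simp add: mult.assoc)
      finally show ?thesis .
    qed
    have "(\<Sum>i\<in>K-{k}. u i * e * w' i) =
        (\<Sum>i\<in>K. u i * e * w i) - (\<Sum>i\<in>K. u i * e * (e * d i * e * (e * r * e) * w k))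
        + (u k * e * (e * d k * e * (e * r * e) * w k) - u k * e * w k)"
      unfolding split w'_def by (simp add: right_diff_distrib sum_subtractf)
    also have "cong_mod P \<dots> (1 - 0 + 0)"
      by (intro P(4,5) sumK) (use 1 2 in \<open>auto simp: cong_mod_def\<close>)
    finally have "good (K - {k}) u w'" using finK by (simp add: good_def)
    then show False using min k finK by (metis card_Diff1_less not_le)
  qed
  define a where "a i = u i * e" for i
  define b where "b i = e * w i" for i
  have ab: "cong_mod P (\<Sum>i\<in>K. a i * b i) 1"
  proof -
    have "cong_mod P (u i * (e * e) * w i) (u i * e * w i)" for i by (intro L R e)
    then have "cong_mod P (\<Sum>i\<in>K. a i * b i) (\<Sum>i\<in>K. u i * e * w i)"
      unfolding a_def b_def by (intro P(7)) (simp add: mult.assoc)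
    then show ?thesis using P(3) sumK by blast
  qed
  have ae: "cong_mod P (a i * e) (a i)" for i
    unfolding a_def mult.assoc by (intro L e)
  have eb: "cong_mod P (e * b i) (b i)" for i
    unfolding b_def mult.assoc[symmetric] by (intro R e)
  have ba: "cong_mod P (b i * a j) (if i = j then e else 0)" if ij: "i \<in> K" "j \<in> K" for i j
  proof -
    \<comment> \<open>The difference between two expansions of \<open>a j\<close>: one obtained by
      multiplying the expression of 1 by \<open>a j\<close>, the other being \<open>a j * e\<close>.
      Independence forces its coefficients into P.\<close>
    define d where "d i = b i * a j - (if i = j then e else 0)" for i
    have ede: "cong_mod P (e * d i * e) (d i)" for i
    proof -
      have "cong_mod P (e * (b i * a j) * e) (b i * a j)"
      proof -
        have "cong_mod P (e * b i * (a j * e)) (b i * (a j * e))" by (intro R eb)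
        also have "cong_mod P (b i * (a j * e)) (b i * a j)" by (intro L ae)
        finally show ?thesis by (simp add: mult.assoc)
      qed
      moreover have "cong_mod P (e * (if i = j then e else 0) * e) (if i = j then e else 0)"
      proof -
        have "cong_mod P (e * e * e) (e * e)" by (intro R e)
        also have "cong_mod P (e * e) e" by (rule e)
        finally show ?thesis using P(1) by simp
      qed
      ultimately show ?thesis unfolding d_def right_diff_distrib left_diff_distrib by (rule P(5))
    qed
    have "cong_mod P (\<Sum>i\<in>K. u i * e * (e * d i * e)) (\<Sum>i\<in>K. a i * d i)"
      unfolding a_def by (intro P(7) L ede)
    also have "(\<Sum>i\<in>K. a i * d i) = (\<Sum>i\<in>K. a i * b i) * a j - a j * e"
      unfolding d_def right_diff_distrib sum_subtractf
      by (simp add: sum_distrib_right mult.assoc if_distrib sum.delta finK ij cong: if_cong)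
    also have "cong_mod P \<dots> (1 * a j - a j)" by (intro P(5) R ab ae)
    finally have "(\<Sum>i\<in>K. u i * e * (e * d i * e)) \<in> P" by (simp add: cong_mod_def)
    from indep[OF this ij(1)] have "d i \<in> P" using P(6)[OF P(2)[OF ede]] by blast
    then show ?thesis by (simp add: d_def cong_mod_def)
  qed
  obtain h where h: "bij_betw h {..<card K} K"
    using ex_bij_betw_nat_finite[OF finK] by (auto simp: lessThan_atLeast0)
  have hK: "i < card K \<Longrightarrow> h i \<in> K" for i using h by (auto simp: bij_betw_def)
  \<comment> \<open>An empty sum would put 1 into P; this makes the matrix size positive.\<close>
  have "K \<noteq> {}"
  proof
    assume "K = {}"
    then have "- 1 \<in> P" using ab by (simp add: cong_mod_def)
    then have "1 \<in> P" using add_subgroup_minus[OF Ps, of "- 1"] by simp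
    then show False using prime_ideal_proper[OF pr] by blast
  qed
  show thesis
  proof (rule that[OF e(2), of "card K" "\<lambda>i. a (h i)" "\<lambda>i. b (h i)"])
    show "card K > 0" using \<open>K \<noteq> {}\<close> finK by (simp add: card_gt_0_iff)
    have "(\<Sum>i<card K. a (h i) * b (h i)) = (\<Sum>i\<in>K. a i * b i)"
      using h by (rule sum.reindex_bij_betw)
    then show "cong_mod P (\<Sum>i<card K. a (h i) * b (h i)) 1" using ab by simp
    have "cong_mod P (b (h i) * a (h j)) (if i = j then e else 0)" if "i < card K" "j < card K" for i j
      using ba[OF hK hK, OF that] that h by (auto simp: bij_betw_def inj_on_def split: if_splits)
    then show "\<forall>i<card K. \<forall>j<card K. cong_mod P (b (h i) * a (h j)) (if i = j then e else 0)"
      by blast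
    show "\<forall>d. e * d * e \<notin> P \<longrightarrow> (\<exists>d'. cong_mod P (e * d' * e * (e * d * e)) e)"
      using div by blast
  qed (simp add: ae eb)
qed

section \<open>Ranks of finitely generated quotients of left ideals\<close>

locale left_quotient =
  fixes W N :: "'a::{ring,monoid_mult} set"
  assumes W: "left_ideal W" and N: "left_ideal N" and NW: "N \<subseteq> W"
begin

text \<open>The preimage of P (W / N), so that reduction of W / N modulo P becomes a congruence
  inside the ring.\<close>

definition mult_plus :: "'a set \<Rightarrow> 'a set" where
  "mult_plus P = add_subgroup hull ({p * w | p w. p \<in> P \<and> w \<in> W} \<union> N)"

abbreviation cong_plus :: "'a set \<Rightarrow> 'a \<Rightarrow> 'a \<Rightarrow> bool" where
  "cong_plus P \<equiv> cong_mod (mult_plus P)"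

lemma mult_plus_base: "p \<in> P \<Longrightarrow> w \<in> W \<Longrightarrow> p * w \<in> mult_plus P"
  unfolding mult_plus_def by (rule hull_inc) blast

lemma mult_plus_N: "x \<in> N \<Longrightarrow> x \<in> mult_plus P"
  unfolding mult_plus_def by (rule hull_inc) blast

lemma mult_plus_subgroup: "add_subgroup (mult_plus P)"
  unfolding mult_plus_def by (rule add_subgroup_hull)

lemma mult_plus_left_ideal:
  assumes "left_ideal P" shows "left_ideal (mult_plus P)"
  unfolding mult_plus_def
proof (rule left_ideal_hull)
  fix a x assume "x \<in> {p * w | p w. p \<in> P \<and> w \<in> W} \<union> N"
  then show "a * x \<in> add_subgroup hull ({p * w | p w. p \<in> P \<and> w \<in> W} \<union> N)"
  proof
    assume "x \<in> {p * w | p w. p \<in> P \<and> w \<in> W}"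
    then obtain p w where "x = p * w" "p \<in> P" "w \<in> W" by blast
    then show ?thesis
      using mult_plus_base[of "a * p" P w] left_ideal_mult[OF assms]
      by (simp add: mult_plus_def mult.assoc)
  next
    assume "x \<in> N"
    then show ?thesis
      using mult_plus_N[of "a * x" P] left_ideal_mult[OF N] by (simp add: mult_plus_def)
  qed
qed

lemma mult_plus_cong:
  assumes "cong_mod P p p'" "w \<in> W" shows "cong_plus P (p * w) (p' * w)"
  using mult_plus_base[of "p - p'" P w] assms by (simp add: cong_mod_def left_diff_distrib)

definition fin_gen :: "nat \<Rightarrow> (nat \<Rightarrow> 'a) \<Rightarrow> bool" where
  "fin_gen r w \<longleftrightarrow> (\<forall>j<r. w j \<in> W) \<and> (\<forall>x\<in>W. \<exists>q. cong_mod N x (\<Sum>j<r. q j * w j))"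

text \<open>For an ideal P, the l-th power of W / (P W + N) is free over the ring modulo P with
  basis g 0, ..., g (n - 1); here \<open>g k i\<close> is coordinate i of the basis vector
  k.\<close>

definition free_mod :: "'a set \<Rightarrow> nat \<Rightarrow> nat \<Rightarrow> (nat \<Rightarrow> nat \<Rightarrow> 'a) \<Rightarrow> bool" where
  "free_mod P l n g \<longleftrightarrow> (\<forall>k<n. \<forall>i<l. g k i \<in> W) \<and>
    (\<forall>x. (\<forall>i<l. x i \<in> W) \<longrightarrow> (\<exists>s. \<forall>i<l. cong_plus P (x i) (\<Sum>k<n. s k * g k i))) \<and>
    (\<forall>s. (\<forall>i<l. (\<Sum>k<n. s k * g k i) \<in> mult_plus P) \<longrightarrow> (\<forall>k<n. s k \<in> P))"

text \<open>Multiplication by e turns W / (P W + N) into a finitely generated vector space over the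
  division ring e Q e modulo P, and a spanning family of least size is a basis. The pairs come from
  the initial spanning vectors \<open>\<beta> a * w j\<close>.\<close>

lemma division_basis:
  fixes \<alpha> \<beta> :: "nat \<Rightarrow> 'a"
  assumes P: "two_sided_ideal P" and e: "cong_mod P (e * e) e"
    and div: "\<And>d. e * d * e \<notin> P \<Longrightarrow> \<exists>d'. cong_mod P (e * d' * e * (e * d * e)) e"
    and \<alpha>: "\<And>i. i < m \<Longrightarrow> cong_mod P (\<alpha> i * e) (\<alpha> i)"
    and \<beta>: "\<And>i. i < m \<Longrightarrow> cong_mod P (e * \<beta> i) (\<beta> i)"
    and \<alpha>\<beta>: "cong_mod P (\<Sum>i<m. \<alpha> i * \<beta> i) 1"
    and fg: "fin_gen r w"
  obtains K :: "(nat \<times> nat) set" and v where "finite K" "\<forall>k\<in>K. v k \<in> W"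
    "\<forall>x\<in>W. \<exists>d. cong_plus P (e * x) (\<Sum>k\<in>K. e * d k * e * v k)"
    "\<forall>d. (\<Sum>k\<in>K. e * d k * e * v k) \<in> mult_plus P \<longrightarrow> (\<forall>k\<in>K. e * d k * e \<in> P)"
proof -
  note Ps = ideal_subgroup[OF P]
  note Pc = cong_mod_subgroup[OF Ps]
  note L = cong_mod_left[OF ideal_left[OF P]]
  note R = cong_mod_right[OF ideal_right[OF P]]
  note ZL = mult_plus_left_ideal[OF ideal_left[OF P]]
  note Zc = cong_mod_subgroup[OF mult_plus_subgroup[of P]]
  note LZ = cong_mod_left[OF ZL]
  note [trans] = Zc(3)
  define good where "good K v \<longleftrightarrow> finite K \<and> (\<forall>k\<in>K. v k \<in> W) \<and>
      (\<forall>x\<in>W. \<exists>d. cong_plus P (e * x) (\<Sum>k\<in>K. e * d k * e * v k))"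
    for K :: "(nat \<times> nat) set" and v
  have w: "\<And>j. j < r \<Longrightarrow> w j \<in> W" and gen: "\<And>x. x \<in> W \<Longrightarrow> \<exists>q. cong_mod N x (\<Sum>j<r. q j * w j)"
    using fg by (auto simp: fin_gen_def)
  have "good ({..<r} \<times> {..<m}) (\<lambda>(j, a). \<beta> a * w j)"
    unfolding good_def
  proof (intro conjI ballI)
    fix x assume "x \<in> W"
    then obtain q where q: "cong_mod N x (\<Sum>j<r. q j * w j)" using gen by blast
    have "cong_plus P x (\<Sum>j<r. q j * w j)"
      by (rule cong_mod_mono[OF _ q]) (use mult_plus_N in blast)
    then have "cong_plus P (e * x) (e * (\<Sum>j<r. q j * w j))" by (rule LZ)
    also have "\<dots> = (\<Sum>j<r. e * q j * w j)" by (simp add: sum_distrib_left mult.assoc)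
    also have "cong_plus P \<dots> (\<Sum>j<r. (\<Sum>a<m. e * (q j * \<alpha> a) * e * (\<beta> a * w j)))"
    proof (rule Zc(7))
      fix j assume "j \<in> {..<r}"
      then have wj: "w j \<in> W" using w by simp
      \<comment> \<open>Inserting the expansion of 1 gives \<open>\<beta> a * w j\<close> the
        coefficient \<open>e * (q j * \<alpha> a) * e\<close>.\<close>
      have "cong_mod P (e * q j * 1) (e * q j * (\<Sum>a<m. \<alpha> a * \<beta> a))" by (rule L[OF Pc(2)[OF \<alpha>\<beta>]])
      also have "\<dots> = (\<Sum>a<m. e * q j * (\<alpha> a * \<beta> a))" by (rule sum_distrib_left)
      finally have "cong_mod P (e * q j) (\<Sum>a<m. e * q j * (\<alpha> a * \<beta> a))" by simp
      moreover have "cong_mod P (\<Sum>a<m. e * q j * (\<alpha> a * \<beta> a)) (\<Sum>a<m. e * q j * (\<alpha> a * e * \<beta> a))"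
        by (intro Pc(7) L R) (rule Pc(2)[OF \<alpha>], simp)
      ultimately have "cong_mod P (e * q j) (\<Sum>a<m. e * q j * (\<alpha> a * e * \<beta> a))" by (rule Pc(3))
      from mult_plus_cong[OF this wj]
      show "cong_plus P (e * q j * w j) (\<Sum>a<m. e * (q j * \<alpha> a) * e * (\<beta> a * w j))"
        by (simp add: sum_distrib_right mult.assoc)
    qed
    also have "\<dots> = (\<Sum>(j, a)\<in>{..<r} \<times> {..<m}. e * (q j * \<alpha> a) * e * (\<beta> a * w j))"
      by (rule sum.cartesian_product)
    finally show "\<exists>d. cong_plus P (e * x) (\<Sum>k\<in>{..<r} \<times> {..<m}. e * d k * e *
        (case k of (j, a) \<Rightarrow> \<beta> a * w j))"
      by (intro exI[of _ "\<lambda>(j, a). q j * \<alpha> a"]) (simp add: case_prod_beta)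
  qed (use w left_ideal_mult[OF W] in auto)
  then obtain K v where K: "good K v" and min: "\<And>K' v'. good K' v' \<Longrightarrow> card K \<le> card K'"
    using ex_has_least_nat[of "\<lambda>K. \<exists>v. good K v" "{..<r} \<times> {..<m}" card] by metis
  have finK: "finite K" and vW: "\<And>k. k \<in> K \<Longrightarrow> v k \<in> W"
    and span: "\<And>x. x \<in> W \<Longrightarrow> \<exists>d. cong_plus P (e * x) (\<Sum>k\<in>K. e * d k * e * v k)"
    using K by (auto simp: good_def)
  have indep: "e * d k * e \<in> P" if rel: "(\<Sum>i\<in>K. e * d i * e * v i) \<in> mult_plus P" and k: "k \<in> K" for d k
  proof (rule ccontr)
    assume "e * d k * e \<notin> P"
    then obtain r where r: "cong_mod P (e * r * e * (e * d k * e)) e" using div by blast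
    have split: "(\<Sum>i\<in>K. f i) = f k + (\<Sum>i\<in>K-{k}. f i)" for f :: "nat \<times> nat \<Rightarrow> 'a"
      using finK k by (rule sum.remove)
    have "good (K - {k}) v"
      unfolding good_def
    proof (intro conjI ballI)
      fix x assume "x \<in> W"
      then obtain c where c: "cong_plus P (e * x) (\<Sum>i\<in>K. e * c i * e * v i)"
        using span by blast
      \<comment> \<open>The relation, scaled so that its coefficient at k becomes
        \<open>e * c k * e\<close> modulo P, is subtracted from the expansion of
        \<open>e * x\<close>.\<close>
      define c' where "c' i = c i - c k * (e * r * e) * (e * d i)" for i
      have 1: "e * c k * (e * r * e) * (\<Sum>i\<in>K. e * d i * e * v i) \<in> mult_plus P" (is "?r \<in> _")
        by (rule left_ideal_mult[OF ZL rel])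
      have "cong_mod P (e * c k * (e * r * e * (e * d k * e))) (e * c k * e)"
        by (intro L r)
      then have 2: "cong_plus P (e * c k * (e * r * e * (e * d k * e)) * v k) (e * c k * e * v k)"
        by (intro mult_plus_cong vW k)
      have "(\<Sum>i\<in>K-{k}. e * c' i * e * v i) = (\<Sum>i\<in>K. e * c i * e * v i) - ?r
          + (e * c k * (e * r * e * (e * d k * e)) * v k - e * c k * e * v k)"
        unfolding split c'_def distrib_left sum_distrib_left
        by (simp add: right_diff_distrib left_diff_distrib sum_subtractf mult.assoc)
      moreover have "cong_plus P \<dots> (e * x - 0 + 0)"
        by (intro Zc(4,5) Zc(2)[OF c]) (use 1 2 in \<open>auto simp: cong_mod_def\<close>)
      ultimately have "cong_plus P (e * x) (\<Sum>i\<in>K-{k}. e * c' i * e * v i)"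
        using Zc(2) by simp
      then show "\<exists>d. cong_plus P (e * x) (\<Sum>k\<in>K - {k}. e * d k * e * v k)" by blast
    qed (use finK vW in auto)
    then show False using min k finK by (metis card_Diff1_less not_le)
  qed
  show thesis by (rule that[of K v]) (use finK vW span indep in blast)+
qed

text \<open>A dimension count over D = e Q e modulo P: the row e Q has dimension m and e (W / N) has
  dimension \<open>card K\<close>. The power of W / N with exponent \<open>m * c\<close> thus has
  the dimension of a free module of rank \<open>card K * c\<close>. Every c is allowed so that
  several primes can share one exponent.\<close>

lemma free_mod_prime:
  assumes art: "right_artinian TYPE('a)" and pr: "prime_ideal P" and fg: "fin_gen r w"
  shows "\<exists>m>0. \<exists>b. \<forall>c. \<exists>g. free_mod P (m * c) (b * c) g"
proof -
  note P = prime_ideal_ideal[OF pr]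
  note Ps = ideal_subgroup[OF P]
  note Pc = cong_mod_subgroup[OF Ps]
  note L = cong_mod_left[OF ideal_left[OF P]]
  note R = cong_mod_right[OF ideal_right[OF P]]
  note ZL = mult_plus_left_ideal[OF ideal_left[OF P]]
  note Zc = cong_mod_subgroup[OF mult_plus_subgroup[of P]]
  note LZ = cong_mod_left[OF ZL]
  note [trans] = Zc(3) Pc(3)
  obtain e and m :: nat and \<alpha> \<beta> :: "nat \<Rightarrow> 'a" where e: "cong_mod P (e * e) e"
    and div: "\<forall>d. e * d * e \<notin> P \<longrightarrow> (\<exists>d'. cong_mod P (e * d' * e * (e * d * e)) e)"
    and m: "m > 0"
    and \<alpha>\<beta>': "\<forall>i<m. cong_mod P (\<alpha> i * e) (\<alpha> i) \<and> cong_mod P (e * \<beta> i) (\<beta> i)"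
    and \<alpha>\<beta>: "cong_mod P (\<Sum>i<m. \<alpha> i * \<beta> i) 1"
    and \<beta>\<alpha>': "\<forall>i<m. \<forall>j<m. cong_mod P (\<beta> i * \<alpha> j) (if i = j then e else 0)"
    by (rule prime_ideal_wedderburn[OF art pr])
  have \<alpha>: "cong_mod P (\<alpha> i * e) (\<alpha> i)" and \<beta>: "cong_mod P (e * \<beta> i) (\<beta> i)" if "i < m" for i
    using \<alpha>\<beta>' that by simp_all
  have \<beta>\<alpha>: "cong_mod P (\<beta> i * \<alpha> j) (if i = j then e else 0)" if "i < m" "j < m" for i j
    using \<beta>\<alpha>' that by blast
  obtain K :: "(nat \<times> nat) set" and v where finK: "finite K" and vW': "\<forall>k\<in>K. v k \<in> W"
    and span: "\<forall>x\<in>W. \<exists>d. cong_plus P (e * x) (\<Sum>k\<in>K. e * d k * e * v k)"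
    and indep: "\<forall>d. (\<Sum>k\<in>K. e * d k * e * v k) \<in> mult_plus P \<longrightarrow> (\<forall>k\<in>K. e * d k * e \<in> P)"
    by (rule division_basis[OF P e div[rule_format] \<alpha> \<beta> \<alpha>\<beta> fg])
  have vW: "v k \<in> W" if "k \<in> K" for k using vW' that by blast
  have "\<exists>g. free_mod P (m * c) (card K * c) g" for c
  proof -
    have "finite (K \<times> {..<c})" using finK by simp
    then obtain h where h: "bij_betw h {..<card K * c} (K \<times> {..<c})"
      using ex_bij_betw_nat_finite[of "K \<times> {..<c}"]
      by (auto simp: lessThan_atLeast0 card_cartesian_product)
    define h' where "h' = inv_into {..<card K * c} h"
    have h'h: "h' (h i) = i" if "i < card K * c" for i
      unfolding h'_def using h that by (intro inv_into_f_f) (auto simp: bij_betw_def)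
    have hr: "h k \<in> K \<times> {..<c}" if "k < card K * c" for k using h that by (auto simp: bij_betw_def)
    \<comment> \<open>Coordinates come in c blocks of length m. The basis vector for a pair (k, r)
      carries the column of all \<open>\<alpha> a * v k\<close> in block r and is zero
      elsewhere.\<close>
    define g where "g k i = (if i div m = snd (h k) then \<alpha> (i mod m) * v (fst (h k)) else 0)" for k i
    have sum: "(\<Sum>k<card K * c. s (h k) * g k i) = (\<Sum>k\<in>K. s (k, i div m) * (\<alpha> (i mod m) * v k))"
      if i: "i < m * c" for s i
    proof -
      have "i div m < c" using i m by (simp add: less_mult_imp_div_less mult.commute)
      have "(\<Sum>k<card K * c. s (h k) * g k i) =
          (\<Sum>p\<in>K \<times> {..<c}. s p * (if i div m = snd p then \<alpha> (i mod m) * v (fst p) else 0))"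
        unfolding g_def by (rule sum.reindex_bij_betw[OF h])
      also have "\<dots> = (\<Sum>k\<in>K. \<Sum>r<c. s (k, r) * (if i div m = r then \<alpha> (i mod m) * v k else 0))"
        by (simp add: sum.cartesian_product case_prod_beta)
      also have "\<dots> = (\<Sum>k\<in>K. s (k, i div m) * (\<alpha> (i mod m) * v k))"
        using \<open>i div m < c\<close> by (simp add: if_distrib sum.delta' cong: if_cong)
      finally show ?thesis .
    qed
    have "free_mod P (m * c) (card K * c) g"
      unfolding free_mod_def
    proof (intro conjI allI impI)
      fix k i assume "k < card K * c"
      then show "g k i \<in> W"
        using hr[of k] vW left_ideal_mult[OF W] add_subgroup_zero[OF left_ideal_subgroup[OF W]]
        by (auto simp: g_def)
    next
      fix x assume x: "\<forall>i<m * c. x i \<in> W"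
      define d where "d a i = (SOME d. cong_plus P (e * (\<beta> a * x i))
          (\<Sum>k\<in>K. e * d k * e * v k))" for a i
      have d: "cong_plus P (e * (\<beta> a * x i)) (\<Sum>k\<in>K. e * d a i k * e * v k)"
        if "i < m * c" for a i
      proof -
        have "\<beta> a * x i \<in> W" using that x left_ideal_mult[OF W] by blast
        from someI_ex[OF span[rule_format, OF this]] show ?thesis unfolding d_def .
      qed
      \<comment> \<open>For fixed k and r the coefficients in D form an m by m matrix, here
        assembled into one ring element by means of the \<open>\<alpha> a\<close> and
        \<open>\<beta> a'\<close>.\<close>
      define s where "s = (\<lambda>(k, r). \<Sum>a'<m. \<Sum>a<m. \<alpha> a * (e * d a (r * m + a') k * e) * \<beta> a')"
      have "cong_plus P (x i) (\<Sum>k<card K * c. s (h k) * g k i)" if i: "i < m * c" for i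
      proof -
        have xi: "x i \<in> W" using x i by blast
        have im: "i mod m < m" "i div m * m + i mod m = i" using m by auto
        have "cong_plus P (1 * x i) ((\<Sum>a<m. \<alpha> a * \<beta> a) * x i)"
          by (intro mult_plus_cong Pc(2)[OF \<alpha>\<beta>] xi)
        also have "\<dots> = (\<Sum>a<m. \<alpha> a * \<beta> a * x i)" by (rule sum_distrib_right)
        also have "cong_plus P \<dots> (\<Sum>a<m. \<alpha> a * (e * \<beta> a) * x i)"
          by (intro Zc(7) mult_plus_cong L R xi) (rule Pc(2)[OF \<beta>], simp)
        also have "\<dots> = (\<Sum>a<m. \<alpha> a * (e * (\<beta> a * x i)))" by (simp add: mult.assoc)
        also have "cong_plus P \<dots> (\<Sum>a<m. \<alpha> a * (\<Sum>k\<in>K. e * d a i k * e * v k))"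
          by (intro Zc(7) LZ d i)
        also have "\<dots> = (\<Sum>k\<in>K. \<Sum>a<m. \<alpha> a * (e * d a i k * e) * v k)"
          unfolding sum_distrib_left mult.assoc by (rule sum.swap)
        also have "cong_plus P \<dots> (\<Sum>k\<in>K. s (k, i div m) * (\<alpha> (i mod m) * v k))"
        proof (rule Zc(7))
          fix k assume k: "k \<in> K"
          have "cong_mod P (s (k, i div m) * \<alpha> (i mod m))
              (\<Sum>a'<m. \<Sum>a<m. \<alpha> a * (e * d a (i div m * m + a') k * e) * (if a' = i mod m then e else 0))"
            unfolding s_def prod.case sum_distrib_right mult.assoc[of _ "\<beta> _" "\<alpha> _"]
            by (intro Pc(7) L \<beta>\<alpha>) (use im in auto)
          also have "\<dots> = (\<Sum>a<m. \<Sum>a'<m. \<alpha> a * (e * d a (i div m * m + a') k * e) *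
              (if a' = i mod m then e else 0))"
            by (rule sum.swap)
          also have "\<dots> = (\<Sum>a<m. \<alpha> a * (e * d a i k * e) * e)"
            using im by (simp add: if_distrib sum.delta cong: if_cong)
          also have "cong_mod P \<dots> (\<Sum>a<m. \<alpha> a * (e * d a i k * e))"
          proof (rule Pc(7))
            fix a
            have "cong_mod P (\<alpha> a * (e * d a i k * (e * e))) (\<alpha> a * (e * d a i k * e))" by (intro L e)
            then show "cong_mod P (\<alpha> a * (e * d a i k * e) * e) (\<alpha> a * (e * d a i k * e))"
              by (simp add: mult.assoc)
          qed
          finally have "cong_plus P ((\<Sum>a<m. \<alpha> a * (e * d a i k * e)) * v k)
              (s (k, i div m) * \<alpha> (i mod m) * v k)"
            using k by (intro mult_plus_cong vW) (auto intro: Pc(2))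
          then show "cong_plus P (\<Sum>a<m. \<alpha> a * (e * d a i k * e) * v k)
              (s (k, i div m) * (\<alpha> (i mod m) * v k))"
            by (simp add: sum_distrib_right mult.assoc)
        qed
        finally show ?thesis by (simp add: sum[OF i])
      qed
      then show "\<exists>s. \<forall>i<m * c. cong_plus P (x i) (\<Sum>k<card K * c. s k * g k i)"
        by (intro exI[of _ "\<lambda>k. s (h k)"]) simp
    next
      fix s k assume s: "\<forall>i<m * c. (\<Sum>k<card K * c. s k * g k i) \<in> mult_plus P" and k: "k < card K * c"
      obtain k' r where hk: "h k = (k', r)" by (cases "h k")
      then have k': "k' \<in> K" "r < c" using hr[OF k] by auto
      define s' where "s' p = s (h' p)" for p
      have "s' (h k) = s k" if "k < card K * c" for k by (simp add: s'_def h'h that)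
      then have s': "(\<Sum>k<card K * c. s k * g k i) = (\<Sum>k<card K * c. s' (h k) * g k i)" for i by simp
      \<comment> \<open>The matrix entries of the coefficient: multiplying the relation at
        coordinate \<open>r * m + a\<close> by \<open>\<beta> a'\<close> gives a relation over D
        among the \<open>v k\<close>.\<close>
      have "\<beta> a' * s' (k', r) * \<alpha> a \<in> P" if a: "a < m" "a' < m" for a a'
      proof -
        define i where "i = r * m + a"
        have i: "i div m = r" "i mod m = a" using a m by (auto simp: i_def)
        have "i < m * c"
        proof -
          have "i < (r + 1) * m" using a by (simp add: i_def)
          also have "\<dots> \<le> c * m" using k' by (intro mult_right_mono) auto
          finally show ?thesis by (simp add: mult.commute)
        qed
        then have "(\<Sum>k<card K * c. s' (h k) * g k i) \<in> mult_plus P" using s s' by metis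
        then have "(\<Sum>k\<in>K. s' (k, r) * (\<alpha> a * v k)) \<in> mult_plus P"
          using sum[OF \<open>i < m * c\<close>, of s'] i by simp
        then have 1: "\<beta> a' * (\<Sum>k\<in>K. s' (k, r) * (\<alpha> a * v k)) \<in> mult_plus P"
          by (rule left_ideal_mult[OF ZL])
        have ede: "cong_mod P (e * (\<beta> a' * s' (k, r) * \<alpha> a) * e) (\<beta> a' * s' (k, r) * \<alpha> a)" for k
        proof -
          have "cong_mod P (e * \<beta> a' * (s' (k, r) * (\<alpha> a * e))) (\<beta> a' * (s' (k, r) * (\<alpha> a * e)))"
            by (intro R \<beta> a)
          also have "cong_mod P (\<beta> a' * (s' (k, r) * (\<alpha> a * e))) (\<beta> a' * (s' (k, r) * \<alpha> a))"
            by (intro L \<alpha> a)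
          finally show ?thesis by (simp add: mult.assoc)
        qed
        have "cong_plus P (\<Sum>k\<in>K. e * (\<beta> a' * s' (k, r) * \<alpha> a) * e * v k)
            (\<Sum>k\<in>K. \<beta> a' * s' (k, r) * \<alpha> a * v k)"
          by (intro Zc(7) mult_plus_cong ede vW) simp
        also have "\<dots> = \<beta> a' * (\<Sum>k\<in>K. s' (k, r) * (\<alpha> a * v k))"
          by (simp add: sum_distrib_left mult.assoc)
        finally have "(\<Sum>k\<in>K. e * (\<beta> a' * s' (k, r) * \<alpha> a) * e * v k) \<in> mult_plus P"
          using 1 by (rule Zc(6))
        from indep[rule_format, OF this k'(1)] show ?thesis using Pc(6)[OF Pc(2)[OF ede]] by blast
      qed
      note \<beta>s\<alpha> = this
      \<comment> \<open>An element whose matrix entries are all in P lies in P: insert the expansion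
        of 1 on both sides.\<close>
      have "\<alpha> a' * (\<beta> a' * s' (k', r) * \<alpha> a) * \<beta> a \<in> P" if "a < m" "a' < m" for a a'
        by (rule ideal_mult_right[OF P], rule ideal_mult_left[OF P])
          (rule \<beta>s\<alpha>[OF that])
      then have "(\<Sum>a'<m. \<Sum>a<m. \<alpha> a' * (\<beta> a' * s' (k', r) * \<alpha> a) * \<beta> a) \<in> P"
        by (intro add_subgroup_sum[OF Ps]) auto
      then have "(\<Sum>a'<m. \<alpha> a' * \<beta> a') * s' (k', r) * (\<Sum>a<m. \<alpha> a * \<beta> a) \<in> P"
        by (simp add: sum_distrib_left sum_distrib_right mult.assoc)
          (subst sum.swap, simp)
      moreover have "cong_mod P ((\<Sum>a'<m. \<alpha> a' * \<beta> a') * s' (k', r) * (\<Sum>a<m. \<alpha> a * \<beta> a))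
          (1 * s' (k', r) * 1)"
        using Pc(3)[OF R[OF R[OF \<alpha>\<beta>]] L[OF \<alpha>\<beta>]] .
      ultimately have "s' (k', r) \<in> P" using Pc(2,6) by fastforce
      then show "s k \<in> P" using hk k by (metis s'_def h'h)
    qed
    then show ?thesis by blast
  qed
  then show ?thesis using m by blast
qed

end

text \<open>Nakayama's lemma for finitely many vectors modulo a submodule G. In its own relation
  \<open>u t\<close> has a coefficient from J, so \<open>1 - q t\<close> has a left inverse and
  \<open>u t\<close> can be eliminated; the other relations keep their coefficients in J.\<close>

lemma nakayama:
  fixes u :: "'j \<Rightarrow> 'i \<Rightarrow> 'a::{ring,monoid_mult}"
  assumes J: "two_sided_ideal J" "\<And>x. x \<in> J \<Longrightarrow> \<exists>y. y * (1 - x) = 1"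
    and G: "\<And>x y. x \<in> G \<Longrightarrow> y \<in> G \<Longrightarrow> (\<lambda>i. x i + y i) \<in> G"
      "\<And>a x. x \<in> G \<Longrightarrow> (\<lambda>i. a * x i) \<in> G"
    and "finite T"
    and "\<And>j. j \<in> T \<Longrightarrow> \<exists>q. (\<forall>k. q k \<in> J) \<and> (\<lambda>i. u j i - (\<Sum>k\<in>T. q k * u k i)) \<in> G"
    and "(\<lambda>_. 0) \<in> G"
  shows "\<forall>j\<in>T. u j \<in> G"
  using assms(5,6)
proof (induct T rule: finite_induct)
  case (insert t T)
  note Js = add_subgroupD[OF ideal_subgroup[OF J(1)]] idealD[OF J(1)]
  obtain q where q: "\<And>k. q k \<in> J" "(\<lambda>i. u t i - (\<Sum>k\<in>insert t T. q k * u k i)) \<in> G"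
    using insert(4)[of t] by blast
  obtain y where y: "y * (1 - q t) = 1" using J(2) q(1) by blast
  have ut: "(\<lambda>i. u t i - (\<Sum>k\<in>T. y * q k * u k i)) \<in> G"
  proof -
    have "y * (u t i - (\<Sum>k\<in>insert t T. q k * u k i)) = u t i - (\<Sum>k\<in>T. y * q k * u k i)" for i
    proof -
      have "y * (u t i - (\<Sum>k\<in>insert t T. q k * u k i))
          = y * (1 - q t) * u t i - y * (\<Sum>k\<in>T. q k * u k i)"
        using insert(1,2) by (simp add: algebra_simps)
      then show ?thesis unfolding y by (simp add: sum_distrib_left mult.assoc)
    qed
    then show ?thesis using G(2)[OF q(2), of y] by simp
  qed
  have T: "\<forall>j\<in>T. u j \<in> G"
  proof (rule insert(3))
    fix j assume "j \<in> T"
    then obtain c where c: "\<And>k. c k \<in> J" "(\<lambda>i. u j i - (\<Sum>k\<in>insert t T. c k * u k i)) \<in> G"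
      using insert(4)[of j] by blast
    have "(\<lambda>i. (u j i - (\<Sum>k\<in>insert t T. c k * u k i)) +
        c t * (u t i - (\<Sum>k\<in>T. y * q k * u k i))) \<in> G"
      by (rule G(1)[OF c(2) G(2)[OF ut]])
    moreover have "(u j i - (\<Sum>k\<in>insert t T. c k * u k i)) + c t * (u t i - (\<Sum>k\<in>T. y * q k * u k i))
        = u j i - (\<Sum>k\<in>T. (c k + c t * (y * q k)) * u k i)" for i
      using insert(1,2) by (simp add: algebra_simps sum.distrib sum_distrib_left)
    ultimately have "(\<lambda>i. u j i - (\<Sum>k\<in>T. (c k + c t * (y * q k)) * u k i)) \<in> G" by simp
    moreover have "c k + c t * (y * q k) \<in> J" for k
      using c(1) by (intro Js(2) Js(8) q(1))
    ultimately show "\<exists>q. (\<forall>k. q k \<in> J) \<and> (\<lambda>i. u j i - (\<Sum>k\<in>T. q k * u k i)) \<in> G"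
      by (intro exI[of _ "\<lambda>k. c k + c t * (y * q k)"]) simp
  qed
  have "(\<lambda>i. \<Sum>k\<in>T. y * q k * u k i) \<in> G"
    using insert(1) T
  proof (induct T rule: finite_induct)
    case empty
    then show ?case using assms(7) by simp
  next
    case (insert k T)
    then show ?case using G(1)[OF G(2)[of "u k" "y * q k"]] by simp
  qed
  from G(1)[OF ut this] have "u t \<in> G" by simp
  then show ?case using T by blast
qed simp

section \<open>Gluing generators over finitely many primes\<close>

context left_quotient
begin

text \<open>The exponents found at the separate primes differ; their product is a multiple of each,
  which \<open>free_mod_prime\<close> allows for.\<close>

lemma free_mod_uniform:
  assumes art: "right_artinian TYPE('a)" and F: "finite F" "\<And>P. P \<in> F \<Longrightarrow> prime_ideal P"
    and fg: "fin_gen r w"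
  obtains l n g where "l > 0" "\<forall>P\<in>F. free_mod P l (n P) (g P)"
proof -
  define good where "good P m b \<longleftrightarrow> m > 0 \<and> (\<forall>c. \<exists>g. free_mod P (m * c) (b * c) g)" for P m b
  have "\<forall>P\<in>F. \<exists>m b. good P m b"
    using free_mod_prime[OF art F(2) fg] unfolding good_def by blast
  then obtain m b where mb: "\<forall>P\<in>F. good P (m P) (b P)" by metis
  define l where "l = (\<Prod>P\<in>F. m P)"
  define c where "c P = (\<Prod>P\<in>F-{P}. m P)" for P
  have l: "l = m P * c P" if "P \<in> F" for P
    unfolding l_def c_def using F(1) that by (rule prod.remove)
  have "\<forall>P\<in>F. \<exists>g. free_mod P l (b P * c P) g"
    using mb l by (metis good_def)
  then obtain g where g: "\<forall>P\<in>F. free_mod P l (b P * c P) (g P)" by metis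
  show thesis
  proof (rule that[OF _ g])
    show "l > 0" unfolding l_def using mb by (auto simp: good_def intro!: prod_pos)
  qed
qed

text \<open>For p in J, a product p x has the coefficients of x multiplied by p, which lie in J. The
  element is placed in a single coordinate because the generators live in a power of W.\<close>

lemma mult_plus_coeff:
  fixes g :: "nat \<Rightarrow> nat \<Rightarrow> 'a"
  assumes J: "two_sided_ideal J" and y: "y \<in> mult_plus J"
    and gen: "\<And>x. x \<in> W \<Longrightarrow> \<exists>s. \<forall>i<l. cong_mod N (if i = i0 then x else 0) (\<Sum>k<n. s k * g k i)"
  shows "\<exists>s. (\<forall>k. s k \<in> J) \<and> (\<forall>i<l. cong_mod N (if i = i0 then y else 0) (\<Sum>k<n. s k * g k i))"
proof -
  note Js = ideal_subgroup[OF J]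
  note Ns = left_ideal_subgroup[OF N]
  note Nc = cong_mod_subgroup[OF Ns]
  have N0: "\<exists>s. (\<forall>k. s k \<in> J) \<and> (\<forall>i<l. cong_mod N (if i = i0 then y else 0) (\<Sum>k<n. s k * g k i))"
    if "y \<in> N" for y
    using that add_subgroup_zero[OF Js] add_subgroup_zero[OF Ns]
    by (intro exI[of _ "\<lambda>_. 0"]) (simp add: cong_mod_def)
  show ?thesis
    using y unfolding mult_plus_def
  proof (induct rule: add_subgroup_hull_induct)
    case (base y)
    then show ?case
    proof
      assume "y \<in> {p * w |p w. p \<in> J \<and> w \<in> W}"
      then obtain p x where y: "y = p * x" "p \<in> J" "x \<in> W" by blast
      from gen[OF y(3)] obtain s
        where s: "\<forall>i<l. cong_mod N (if i = i0 then x else 0) (\<Sum>k<n. s k * g k i)" ..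
      have "cong_mod N (if i = i0 then y else 0) (\<Sum>k<n. p * s k * g k i)" if "i < l" for i
      proof -
        have "cong_mod N (p * (if i = i0 then x else 0)) (p * (\<Sum>k<n. s k * g k i))"
          using s that by (intro cong_mod_left[OF N]) blast
        moreover have "p * (if i = i0 then x else 0) = (if i = i0 then y else 0)" by (simp add: y)
        ultimately show ?thesis by (simp add: sum_distrib_left mult.assoc)
      qed
      then show ?thesis
        using ideal_mult_right[OF J y(2)] by (intro exI[of _ "\<lambda>k. p * s k"]) simp
    qed (rule N0)
  next
    case zero
    show ?case by (rule N0[OF add_subgroup_zero[OF Ns]])
  next
    case (add x y)
    then obtain s s' where s: "\<forall>k. s k \<in> J" "\<forall>k. s' k \<in> J"
      "\<forall>i<l. cong_mod N (if i = i0 then x else 0) (\<Sum>k<n. s k * g k i)"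
      "\<forall>i<l. cong_mod N (if i = i0 then y else 0) (\<Sum>k<n. s' k * g k i)" by blast
    have "cong_mod N (if i = i0 then x + y else 0) (\<Sum>k<n. (s k + s' k) * g k i)" if "i < l" for i
      using Nc(4)[OF s(3)[rule_format, OF that] s(4)[rule_format, OF that]]
      by (simp add: distrib_right sum.distrib split: if_splits)
    then show ?case
      using s(1,2) add_subgroup_add[OF Js] by (intro exI[of _ "\<lambda>k. s k + s' k"]) simp
  next
    case (minus x)
    then obtain s where s: "\<forall>k. s k \<in> J"
      "\<forall>i<l. cong_mod N (if i = i0 then x else 0) (\<Sum>k<n. s k * g k i)" by blast
    have "cong_mod N (if i = i0 then - x else 0) (\<Sum>k<n. - s k * g k i)" if "i < l" for i
      using Nc(5)[OF Nc(1)[of 0] s(2)[rule_format, OF that]] by (simp add: sum_negf split: if_splits)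
    then show ?case
      using s(1) add_subgroup_minus[OF Js] by (intro exI[of _ "\<lambda>k. - s k"]) simp
  qed
qed

text \<open>Some power \<open>(W / N)\<^sup>l\<close> has \<open>n\<close> generators which are free modulo a prime \<open>P\<close>. Here \<open>P\<close> is a
  prime for which the rank of \<open>W / N\<close> is maximal; at the other primes the generators found
  locally are padded with zeros before they are glued by the Chinese remainder theorem.\<close>

lemma maximal_rank:
  assumes art: "right_artinian TYPE('a)" and fg: "fin_gen r w" and ne: "W \<noteq> N"
  obtains l n :: nat and g P where "prime_ideal P" "l > 0" "n > 0" "\<forall>k<n. \<forall>i<l. g k i \<in> W"
    "\<forall>x. (\<forall>i<l. x i \<in> W) \<longrightarrow> (\<exists>s. \<forall>i<l. cong_mod N (x i) (\<Sum>k<n. s k * g k i))"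
    "\<forall>s. (\<forall>i<l. (\<Sum>k<n. s k * g k i) \<in> N) \<longrightarrow> (\<forall>k<n. s k \<in> P)"
proof -
  obtain F where F: "finite F" "\<And>P. P \<in> F \<Longrightarrow> prime_ideal P"
    and nil: "\<And>x::'a. x \<in> \<Inter>F \<Longrightarrow> \<exists>n. x ^ n = 0"
    by (rule finite_prime_radical[OF art]) blast
  define J where "J = \<Inter>F"
  have J: "two_sided_ideal J" unfolding J_def
    using F(2) prime_ideal_ideal by (intro ideal_Inter) blast
  have Junit: "\<exists>y. y * (1 - x) = 1" if "x \<in> J" for x
    using nil[of x] prime_radical_unit[of x] that by (auto simp: J_def)
  have id: "two_sided_ideal P" if "P \<in> F" for P using F(2)[OF that] by (rule prime_ideal_ideal)
  note Ws = left_ideal_subgroup[OF W] and Ns = left_ideal_subgroup[OF N]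
  note Zs = mult_plus_subgroup
  \<comment> \<open>Without primes 1 would be nilpotent and the ring zero, although W and N
    differ.\<close>
  have "F \<noteq> {}"
  proof
    assume "F = {}"
    then obtain n where "(1::'a) ^ n = 0" using nil[of 1] by auto
    then have "x = 0" for x :: 'a using mult_1[of x] by simp
    then have "x \<in> N" for x using add_subgroup_zero[OF Ns] by metis
    then show False using ne NW by blast
  qed
  obtain l n0 g0 where l: "l > 0" and fr: "\<forall>P\<in>F. free_mod P l (n0 P) (g0 P)"
    by (rule free_mod_uniform[OF art F fg])
  define n where "n = Max (n0 ` F)"
  have n0: "n0 P \<le> n" if "P \<in> F" for P using F(1) that by (simp add: n_def)
  obtain P0 where P0: "P0 \<in> F" "n0 P0 = n"
    using Max_in[of "n0 ` F"] F(1) \<open>F \<noteq> {}\<close> unfolding n_def by (metis (mono_tags) finite_imageI image_iff image_is_empty)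
  have "\<forall>P\<in>F. \<exists>z. 1 - z \<in> P \<and> (\<forall>P'\<in>F. P' \<noteq> P \<longrightarrow> z \<in> P')"
  proof
    fix P assume P: "P \<in> F"
    have "\<not> UNIV \<subseteq> P" using prime_ideal_proper[OF F(2)[OF P]] by blast
    then obtain z where "z \<in> UNIV" "1 - z \<in> P" "\<And>P'. P' \<in> F \<Longrightarrow> P' \<noteq> P \<Longrightarrow> z \<in> P'"
      using prime_ideal_crt[OF art F P ideal_UNIV] by metis
    then show "\<exists>z. 1 - z \<in> P \<and> (\<forall>P'\<in>F. P' \<noteq> P \<longrightarrow> z \<in> P')" by blast
  qed
  then obtain z where z: "\<And>P. P \<in> F \<Longrightarrow> 1 - z P \<in> P"
    and z': "\<And>P P'. P \<in> F \<Longrightarrow> P' \<in> F \<Longrightarrow> P' \<noteq> P \<Longrightarrow> z P \<in> P'" by metis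
  have zsum: "cong_mod P (\<Sum>P'\<in>F. z P' * f P') (f P)" if P: "P \<in> F" for P f
  proof -
    have "(\<Sum>P'\<in>F. z P' * f P') - f P = (\<Sum>P'\<in>F-{P}. z P' * f P') - (1 - z P) * f P"
      using F(1) P by (simp add: sum.remove algebra_simps)
    moreover have "\<dots> \<in> P"
      using z[OF P] z' P ideal_mult_right[OF id[OF P]]
      by (intro add_subgroup_diff[OF ideal_subgroup[OF id[OF P]]]
          add_subgroup_sum[OF ideal_subgroup[OF id[OF P]]]) auto
    ultimately show ?thesis by (simp add: cong_mod_def)
  qed
  have zJ: "1 - (\<Sum>P\<in>F. z P) \<in> J"
    unfolding J_def
  proof
    fix P assume P: "P \<in> F"
    from zsum[OF P, of "\<lambda>_. 1"] show "1 - (\<Sum>P\<in>F. z P) \<in> P"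
      using cong_mod_sym[OF ideal_subgroup[OF id[OF P]]] by (auto simp: cong_mod_def)
  qed
  \<comment> \<open>\<open>z P\<close> times an element of P lies in every member of F: at P because
    of the second factor, elsewhere because of the first.\<close>
  have zZ: "z P * y \<in> mult_plus J" if P: "P \<in> F" and y: "y \<in> mult_plus P" for P y
    using y unfolding mult_plus_def[of P]
  proof (induct rule: add_subgroup_hull_induct)
    case (base x)
    then show ?case
    proof
      assume "x \<in> {p * w |p w. p \<in> P \<and> w \<in> W}"
      then obtain p w where x: "x = p * w" "p \<in> P" "w \<in> W" by blast
      have "z P * p \<in> P'" if "P' \<in> F" for P'
        using that x(2) z'[OF P that] ideal_mult_left[OF id] ideal_mult_right[OF id]
        by (cases "P' = P") auto
      then have "z P * p * w \<in> mult_plus J" by (intro mult_plus_base x) (simp add: J_def)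
      then show ?thesis by (simp add: x mult.assoc)
    next
      assume "x \<in> N"
      then show ?thesis by (intro mult_plus_N left_ideal_mult[OF N])
    qed
  qed (auto simp: add_subgroupD[OF Zs] distrib_left)
  \<comment> \<open>Since the \<open>z P\<close> add up to 1 modulo J, local congruences at all P in
    F combine to one modulo J W + N.\<close>
  have Zcap: "y \<in> mult_plus J" if y: "y \<in> W" "\<And>P. P \<in> F \<Longrightarrow> y \<in> mult_plus P" for y
  proof -
    have "y = (\<Sum>P\<in>F. z P * y) + (1 - (\<Sum>P\<in>F. z P)) * y"
      by (simp add: algebra_simps sum_distrib_right)
    also have "\<dots> \<in> mult_plus J"
      by (intro add_subgroup_add[OF Zs] add_subgroup_sum[OF Zs] zZ mult_plus_base zJ y)
    finally show ?thesis .
  qed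
  define gp where "gp P k i = (if k < n0 P then g0 P k i else 0)" for P k i
  define g where "g k i = (\<Sum>P\<in>F. z P * gp P k i)" for k i
  have gpW: "gp P k i \<in> W" if "P \<in> F" "i < l" for P k i
    using that fr add_subgroup_zero[OF Ws] by (auto simp: gp_def free_mod_def)
  have gW: "g k i \<in> W" if "i < l" for k i
    unfolding g_def by (intro add_subgroup_sum[OF Ws] left_ideal_mult[OF W] gpW that)
  have ggp: "cong_plus P (g k i) (gp P k i)" if P: "P \<in> F" and i: "i < l" for P k i
  proof -
    have "g k i - gp P k i = (\<Sum>P'\<in>F-{P}. z P' * gp P' k i) - (1 - z P) * gp P k i"
      unfolding g_def using F(1) P by (simp add: sum.remove algebra_simps)
    also have "\<dots> \<in> mult_plus P"
      using z[OF P] z' P i by (intro add_subgroup_diff[OF Zs] add_subgroup_sum[OF Zs] mult_plus_base gpW) auto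
    finally show ?thesis by (simp add: cong_mod_def)
  qed
  have sgp: "(\<Sum>k<n. s k * gp P k i) = (\<Sum>k<n0 P. s k * g0 P k i)" if "P \<in> F" for P s i
  proof -
    have "(\<Sum>k<n0 P. s k * g0 P k i) = (\<Sum>k<n0 P. s k * gp P k i)"
      by (intro sum.cong) (auto simp: gp_def)
    also have "\<dots> = (\<Sum>k<n. s k * gp P k i)"
      using n0[OF that] by (intro sum.mono_neutral_left) (auto simp: gp_def)
    finally show ?thesis ..
  qed
  have sg: "cong_plus P (\<Sum>k<n. s k * g k i) (\<Sum>k<n0 P. s k * g0 P k i)"
    if "P \<in> F" "i < l" for P s i
    unfolding sgp[OF that(1), symmetric]
    by (intro cong_mod_sum[OF Zs] cong_mod_left[OF mult_plus_left_ideal[OF ideal_left[OF id]]] ggp that)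
  have genJ: "\<exists>s. \<forall>i<l. cong_plus J (x i) (\<Sum>k<n. s k * g k i)" if x: "\<forall>i<l. x i \<in> W" for x
  proof -
    have "\<forall>P\<in>F. \<exists>s. \<forall>i<l. cong_plus P (x i) (\<Sum>k<n0 P. s k * g0 P k i)"
      using fr x unfolding free_mod_def by blast
    then obtain s where s: "\<forall>P\<in>F. \<forall>i<l. cong_plus P (x i) (\<Sum>k<n0 P. s P k * g0 P k i)"
      by metis
    \<comment> \<open>The local coefficients are glued by the same \<open>z P\<close> as the
      generators.\<close>
    define s' where "s' k = (\<Sum>P\<in>F. z P * s P k)" for k
    have "cong_plus J (x i) (\<Sum>k<n. s' k * g k i)" if i: "i < l" for i
      unfolding cong_mod_def
    proof (rule Zcap)
      show "x i - (\<Sum>k<n. s' k * g k i) \<in> W"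
        using x i by (intro add_subgroup_diff[OF Ws] add_subgroup_sum[OF Ws] left_ideal_mult[OF W] gW) auto
      fix P assume P: "P \<in> F"
      have "cong_plus P (\<Sum>k<n. s' k * g k i) (\<Sum>k<n. s P k * g k i)"
        unfolding s'_def by (intro cong_mod_sum[OF Zs] mult_plus_cong zsum P gW i)
      then have "cong_plus P (\<Sum>k<n. s' k * g k i) (\<Sum>k<n0 P. s P k * g0 P k i)"
        by (rule cong_mod_trans[OF Zs]) (rule sg[OF P i])
      moreover have "cong_plus P (x i) (\<Sum>k<n0 P. s P k * g0 P k i)" using s P i by blast
      ultimately have "cong_plus P (x i) (\<Sum>k<n. s' k * g k i)"
        using cong_mod_trans[OF Zs] cong_mod_sym[OF Zs] by blast
      then show "x i - (\<Sum>k<n. s' k * g k i) \<in> mult_plus P" by (rule cong_modD)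
    qed
    then show ?thesis by blast
  qed
  have wW: "\<And>j. j < r \<Longrightarrow> w j \<in> W" and gw: "\<And>x. x \<in> W \<Longrightarrow> \<exists>q. cong_mod N x (\<Sum>j<r. q j * w j)"
    using fg by (auto simp: fin_gen_def)
  have ZJ: "\<exists>q. (\<forall>j. q j \<in> J) \<and> cong_mod N y (\<Sum>j<r. q j * w j)" if "y \<in> mult_plus J" for y
    using mult_plus_coeff[OF J that, where l = 1 and ?i0.0 = 0 and n = r and g = "\<lambda>j _. w j"] gw
    by simp
  define G where "G = {x. \<exists>s. \<forall>i<l. cong_mod N (x i) (\<Sum>k<n. s k * g k i)}"
  define T where "T = {..<r} \<times> {..<l}"
  \<comment> \<open>The vector with \<open>w j\<close> at coordinate i' and zero elsewhere. Modulo N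
    these finitely many vectors generate the whole power, so Nakayama's lemma need only treat
    them.\<close>
  define u where "u = (\<lambda>(j, i') (i::nat). if i = i' then w j else 0)"
  have G0: "x \<in> G" if "\<forall>i<l. x i \<in> N" for x
    using that unfolding G_def by (intro CollectI exI[of _ "\<lambda>_. 0"]) (simp add: cong_mod_def)
  have Gadd: "(\<lambda>i. x i + y i) \<in> G" if "x \<in> G" "y \<in> G" for x y
  proof -
    obtain s s' where "\<forall>i<l. cong_mod N (x i) (\<Sum>k<n. s k * g k i)"
      "\<forall>i<l. cong_mod N (y i) (\<Sum>k<n. s' k * g k i)" using \<open>x \<in> G\<close> \<open>y \<in> G\<close> by (auto simp: G_def)
    then show ?thesis unfolding G_def
      using cong_mod_add[OF Ns] by (intro CollectI exI[of _ "\<lambda>k. s k + s' k"]) (simp add: distrib_right sum.distrib)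
  qed
  have Gmult: "(\<lambda>i. a * x i) \<in> G" if "x \<in> G" for a x
  proof -
    obtain s where "\<forall>i<l. cong_mod N (x i) (\<Sum>k<n. s k * g k i)" using \<open>x \<in> G\<close> by (auto simp: G_def)
    then have "\<forall>i<l. cong_mod N (a * x i) (a * (\<Sum>k<n. s k * g k i))" using cong_mod_left[OF N] by blast
    then show ?thesis unfolding G_def
      by (intro CollectI exI[of _ "\<lambda>k. a * s k"]) (simp add: sum_distrib_left mult.assoc)
  qed
  have usum: "(\<Sum>p\<in>T. q p * u p i) = (\<Sum>j<r. q (j, i) * w j)" if "i < l" for q i
  proof -
    have "(\<Sum>p\<in>T. q p * u p i) = (\<Sum>j<r. \<Sum>i'<l. q (j, i') * (if i = i' then w j else 0))"
      unfolding T_def u_def by (simp add: sum.cartesian_product case_prod_beta)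
    also have "\<dots> = (\<Sum>j<r. q (j, i) * w j)"
      using that by (simp add: if_distrib sum.delta' cong: if_cong)
    finally show ?thesis .
  qed
  have "\<forall>p\<in>T. u p \<in> G"
  proof (rule nakayama[OF J Junit Gadd Gmult])
    show "finite T" by (simp add: T_def)
    show "(\<lambda>_. 0) \<in> G" using add_subgroup_zero[OF Ns] by (intro G0) simp
    fix p assume p: "p \<in> T"
    have "\<forall>i<l. u p i \<in> W" using p wW add_subgroup_zero[OF Ws] by (auto simp: u_def T_def)
    then obtain s where s: "\<And>i. i < l \<Longrightarrow> u p i - (\<Sum>k<n. s k * g k i) \<in> mult_plus J"
      using genJ[of "u p"] by (auto simp: cong_mod_def)
    have "\<forall>i. \<exists>q. i < l \<longrightarrow> (\<forall>j. q j \<in> J) \<and> cong_mod N (u p i - (\<Sum>k<n. s k * g k i)) (\<Sum>j<r. q j * w j)"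
      using ZJ[OF s] by blast
    then obtain q where q: "\<And>i j. i < l \<Longrightarrow> q i j \<in> J"
      "\<And>i. i < l \<Longrightarrow> cong_mod N (u p i - (\<Sum>k<n. s k * g k i)) (\<Sum>j<r. q i j * w j)" by metis
    define q' where "q' = (\<lambda>(j, i). if i < l then q i j else 0)"
    have "(\<lambda>i. (\<Sum>k<n. s k * g k i) + (u p i - (\<Sum>k<n. s k * g k i) - (\<Sum>p'\<in>T. q' p' * u p' i))) \<in> G"
    proof (rule Gadd)
      show "(\<lambda>i. \<Sum>k<n. s k * g k i) \<in> G"
        unfolding G_def using cong_mod_refl[OF Ns] by blast
      show "(\<lambda>i. u p i - (\<Sum>k<n. s k * g k i) - (\<Sum>p'\<in>T. q' p' * u p' i)) \<in> G"
        using q(2) by (intro G0) (simp add: usum q'_def cong_mod_def)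
    qed
    moreover have "q' p' \<in> J" for p'
      using q(1) add_subgroup_zero[OF ideal_subgroup[OF J]] by (auto simp: q'_def split: prod.split)
    ultimately show "\<exists>q. (\<forall>k. q k \<in> J) \<and> (\<lambda>i. u p i - (\<Sum>k\<in>T. q k * u k i)) \<in> G"
      by (intro exI[of _ q']) simp
  qed
  note uG = this
  have gen: "x \<in> G" if x: "\<forall>i<l. x i \<in> W" for x
  proof -
    have "\<forall>i. \<exists>q. i < l \<longrightarrow> cong_mod N (x i) (\<Sum>j<r. q j * w j)" using gw x by blast
    then obtain q where q: "\<And>i. i < l \<Longrightarrow> cong_mod N (x i) (\<Sum>j<r. q i j * w j)" by metis
    have fin: "finite T" by (simp add: T_def)
    have "(\<lambda>i. \<Sum>p\<in>T. q (snd p) (fst p) * u p i) \<in> G"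
      using fin uG
    proof (induct T rule: finite_induct)
      case empty
      then show ?case using add_subgroup_zero[OF Ns] by (simp add: G0)
    next
      case (insert p T)
      then show ?case using Gadd[OF Gmult[of "u p" "q (snd p) (fst p)"]] by simp
    qed
    moreover have "(\<lambda>i. x i - (\<Sum>p\<in>T. q (snd p) (fst p) * u p i)) \<in> G"
      using q by (intro G0) (simp add: usum cong_mod_def)
    ultimately show ?thesis using Gadd by fastforce
  qed
  \<comment> \<open>At \<open>P0\<close> the rank is n, so no padding occurs there and the glued
    vectors reduce to a basis.\<close>
  have free: "s k \<in> P0" if s: "\<forall>i<l. (\<Sum>k<n. s k * g k i) \<in> N" and k: "k < n" for s k
  proof -
    have "(\<Sum>k<n0 P0. s k * g0 P0 k i) \<in> mult_plus P0" if "i < l" for i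
      using cong_mod_mem[OF Zs cong_mod_sym[OF Zs sg[OF P0(1) that]]] s that mult_plus_N by blast
    then show ?thesis using fr P0 k unfolding free_mod_def by blast
  qed
  have "n > 0"
  proof (rule ccontr)
    assume "\<not> n > 0"
    have "x \<in> N" if "x \<in> W" for x
    proof -
      have "(\<lambda>_. x) \<in> G" using that by (intro gen) simp
      then show ?thesis using l \<open>\<not> n > 0\<close> by (auto simp: G_def cong_mod_def)
    qed
    then show False using ne NW by blast
  qed
  show thesis
  proof (rule that[OF F(2)[OF P0(1)] l \<open>n > 0\<close>, of g])
    show "\<forall>k<n. \<forall>i<l. g k i \<in> W" using gW by blast
    show "\<forall>x. (\<forall>i<l. x i \<in> W) \<longrightarrow> (\<exists>s. \<forall>i<l. cong_mod N (x i) (\<Sum>k<n. s k * g k i))"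
      using gen unfolding G_def by blast
    show "\<forall>s. (\<forall>i<l. (\<Sum>k<n. s k * g k i) \<in> N) \<longrightarrow> (\<forall>k<n. s k \<in> P0)"
      using free by blast
  qed
qed

end

section \<open>Sweedler sums\<close>

lemma tensor3_eq_lift:
  fixes f :: "'v::ab_group_add \<Rightarrow> 'v \<Rightarrow> 'v \<Rightarrow> 'w::ab_group_add"
  assumes "tensor3_eq scale x y"
    and "\<And>a a' b d. f (a + a') b d = f a b d + f a' b d"
    and "\<And>a b b' d. f a (b + b') d = f a b d + f a b' d"
    and "\<And>a b d d'. f a b (d + d') = f a b d + f a b d'"
    and "\<And>c a b d. f (scale c a) b d = f a (scale c b) d"
    and "\<And>c a b d. f a (scale c b) d = f a b (scale c d)"
  shows "(\<Sum>(a, b, d)\<in>#x. f a b d) = (\<Sum>(a, b, d)\<in>#y. f a b d)"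
  using assms(1)
proof induction
  case (gen x y)
  have "f 0 b d = 0" for b d
    using assms(2)[of 0 0 b d] by simp
  with gen show ?case
    by cases (simp_all add: assms)
qed simp_all

text \<open>Sweedler's sum of f(h1, h2). As \<open>\<Delta> h\<close> is only a representative,
  rules that rewrite \<open>\<Delta>\<close> itself demand linearity of f in its arguments.\<close>

definition sweedler ::
    "('h \<Rightarrow> ('h \<times> 'h) multiset) \<Rightarrow> 'h \<Rightarrow> ('h \<Rightarrow> 'h \<Rightarrow> 'w::comm_monoid_add) \<Rightarrow> 'w" where
  "sweedler \<Delta> h f = (\<Sum>(a, b)\<in>#\<Delta> h. f a b)"

lemma sum_mset_hom:
  assumes "g 0 = 0" "\<And>x y. g (x + y) = g x + g y"
  shows "g (\<Sum>p\<in>#M. f p) = (\<Sum>p\<in>#M. g (f p))"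
  by (induct M) (simp_all add: assms)

lemma sum_mset_sum_mset: "(\<Sum>x\<in>#(\<Sum>p\<in>#M. F p). f x) = (\<Sum>p\<in>#M. \<Sum>x\<in>#F p. f x)"
  by (induct M) simp_all

lemma sweedler_hom:
  assumes "g 0 = 0" "\<And>x y. g (x + y) = g x + g y"
  shows "g (sweedler \<Delta> h f) = sweedler \<Delta> h (\<lambda>a b. g (f a b))"
  unfolding sweedler_def case_prod_beta by (rule sum_mset_hom[OF assms])

lemma sweedler_mult_left:
  "c * sweedler \<Delta> h f = sweedler \<Delta> h (\<lambda>a b. c * f a b)" for c :: "'a::ring"
  by (rule sweedler_hom) (simp_all add: distrib_left)

lemma sweedler_mult_right:
  "sweedler \<Delta> h f * c = sweedler \<Delta> h (\<lambda>a b. f a b * c)" for c :: "'a::ring"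
  by (rule sweedler_hom[of "\<lambda>x. x * c"]) (simp_all add: distrib_right)

lemma sweedler_swap:
  "sweedler \<Delta> x (\<lambda>a b. sweedler \<Delta> y (\<lambda>c d. f a b c d))
    = sweedler \<Delta> y (\<lambda>c d. sweedler \<Delta> x (\<lambda>a b. f a b c d))"
  unfolding sweedler_def case_prod_beta by (rule sum_mset.swap)

lemma sweedler_add: "sweedler \<Delta> h (\<lambda>a b. f a b + g a b) = sweedler \<Delta> h f + sweedler \<Delta> h g"
  unfolding sweedler_def case_prod_beta by (rule sum_mset.distrib)

lemma sweedler_zero: "sweedler \<Delta> h (\<lambda>a b. 0) = 0"
  unfolding sweedler_def case_prod_beta by simp

lemma sweedler_diff:
  fixes f :: "'h \<Rightarrow> 'h \<Rightarrow> 'w::ab_group_add"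
  shows "sweedler \<Delta> h (\<lambda>a b. f a b - g a b) = sweedler \<Delta> h f - sweedler \<Delta> h g"
  using sweedler_add[of \<Delta> h "\<lambda>a b. f a b - g a b" g] by (simp add: eq_diff_eq)

lemma sweedler_sum: "sweedler \<Delta> h (\<lambda>a b. \<Sum>k\<in>K. f k a b) = (\<Sum>k\<in>K. sweedler \<Delta> h (f k))"
proof (induct K rule: infinite_finite_induct)
  case (insert k K)
  then show ?case by (simp add: sweedler_add)
qed (simp_all add: sweedler_zero)

lemma sweedler_mem:
  assumes "add_subgroup S" "\<And>a b. f a b \<in> S" shows "sweedler \<Delta> h f \<in> S"
  unfolding sweedler_def case_prod_beta
  by (rule add_subgroup_sum_mset[OF assms(1)]) (rule assms(2))

text \<open>Unlike \<open>Vector_Spaces.linear\<close> it does not contain the vector space axioms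
  of source and target, so that closure under composition carries no such side conditions.\<close>

definition k_linear :: "('k \<Rightarrow> 'v \<Rightarrow> 'v::ab_group_add) \<Rightarrow> ('k \<Rightarrow> 'w \<Rightarrow> 'w::ab_group_add) \<Rightarrow> ('v \<Rightarrow> 'w) \<Rightarrow> bool" where
  "k_linear s s' f \<longleftrightarrow> (\<forall>x y. f (x + y) = f x + f y) \<and> (\<forall>c x. f (s c x) = s' c (f x))"

lemma k_linearD:
  assumes "k_linear s s' f"
  shows k_linear_add: "f (x + y) = f x + f y"
    and k_linear_scale: "f (s c x) = s' c (f x)"
    and k_linear_zero: "f 0 = 0"
    and k_linear_minus: "f (- x) = - f x"
proof -
  show add: "f (x + y) = f x + f y" for x y using assms by (simp add: k_linear_def)
  show "f (s c x) = s' c (f x)" using assms by (simp add: k_linear_def)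
  show z: "f 0 = 0" using add[of 0 0] by simp
  show "f (- x) = - f x" using add[of x "- x"] z by (simp add: eq_neg_iff_add_eq_0 add.commute)
qed

lemma k_linear_sum: "k_linear s s' f \<Longrightarrow> f (sum g K) = (\<Sum>k\<in>K. f (g k))"
  by (induct K rule: infinite_finite_induct) (auto simp: k_linear_zero k_linear_add)

lemma k_linear_comp: "k_linear s s' f \<Longrightarrow> k_linear s' s'' g \<Longrightarrow> k_linear s s'' (\<lambda>x. g (f x))"
  by (simp add: k_linear_def)

definition k_bilinear where
  "k_bilinear s s' \<phi> \<longleftrightarrow> (\<forall>a. k_linear s s' (\<phi> a)) \<and> (\<forall>b. k_linear s s' (\<lambda>a. \<phi> a b))"

definition k_trilinear where
  "k_trilinear s s' f \<longleftrightarrow> (\<forall>a b. k_linear s s' (f a b)) \<and> (\<forall>a d. k_linear s s' (\<lambda>b. f a b d))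
    \<and> (\<forall>b d. k_linear s s' (\<lambda>a. f a b d))"

lemma k_linear_sweedler:
  assumes "vector_space s'" "\<And>a b. k_linear s s' (\<lambda>x. f x a b)"
  shows "k_linear s s' (\<lambda>x. sweedler \<Delta> h (f x))"
proof -
  interpret vector_space s' by fact
  have f: "f (x + y) a b = f x a b + f y a b" "f (s c x) a b = s' c (f x a b)" for x y c a b
    using assms(2)[of a b] by (simp_all add: k_linear_def)
  then have "f (x + y) = (\<lambda>a b. f x a b + f y a b)" "f (s c x) = (\<lambda>a b. s' c (f x a b))" for x y c
    by blast+
  then show ?thesis
    by (simp add: k_linear_def sweedler_add scale_right_distrib sweedler_hom[of "s' c" for c])
qed

lemma (in k_algebra) k_linear_mult_left: "k_linear s scale f \<Longrightarrow> k_linear s scale (\<lambda>x. a * f x)"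
  by (simp add: k_linear_def distrib_left scale_mult_right)

lemma (in k_algebra) k_linear_mult_right: "k_linear s scale f \<Longrightarrow> k_linear s scale (\<lambda>x. f x * a)"
  by (simp add: k_linear_def distrib_right scale_mult_left)

lemma (in k_algebra) k_linear_id: "k_linear scale scale (\<lambda>x. x)"
  by (simp add: k_linear_def)

lemma (in vector_space) k_linear_scale_left: "k_linear s (*) f \<Longrightarrow> k_linear s scale (\<lambda>x. scale (f x) v)"
  by (simp add: k_linear_def scale_left_distrib)

lemma (in vector_space) k_linear_scale_right: "k_linear s scale f \<Longrightarrow> k_linear s scale (\<lambda>x. scale c (f x))"
  by (simp add: k_linear_def scale_right_distrib scale_left_commute)

section \<open>Identities and integrals in a Hopf algebra\<close>

context hopf_algebra
begin

lemma sweedler_add_arg: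
  assumes "k_bilinear scale s' f"
  shows "sweedler \<Delta> (x + y) f = sweedler \<Delta> x f + sweedler \<Delta> y f"
proof -
  have "(\<Sum>(a, b)\<in>#\<Delta> (x + y). f a b) = (\<Sum>(a, b)\<in>#\<Delta> x + \<Delta> y. f a b)"
    by (rule tensor2_eq_lift[OF comult_add]) (use assms in \<open>auto simp: k_bilinear_def k_linear_def\<close>)
  then show ?thesis by (simp add: sweedler_def)
qed

lemma sweedler_scale_arg:
  assumes "vector_space s'" "k_bilinear scale s' f"
  shows "sweedler \<Delta> (scale c x) f = s' c (sweedler \<Delta> x f)"
proof -
  interpret V: vector_space s' by fact
  have f: "f (scale c a) b = s' c (f a b)" for a b using assms(2) by (auto simp: k_bilinear_def k_linear_def)
  have "(\<Sum>(a, b)\<in>#\<Delta> (scale c x). f a b) = (\<Sum>(a, b)\<in>#{#(scale c a, b). (a, b) \<in># \<Delta> x#}. f a b)"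
    by (rule tensor2_eq_lift[OF comult_scale]) (use assms in \<open>auto simp: k_bilinear_def k_linear_def\<close>)
  also have "\<dots> = sweedler \<Delta> x (\<lambda>a b. s' c (f a b))"
    by (simp add: sweedler_def image_mset.compositionality o_def case_prod_unfold f)
  also have "\<dots> = s' c (sweedler \<Delta> x f)"
    by (rule sweedler_hom[symmetric]) (simp_all add: V.scale_right_distrib)
  finally show ?thesis by (simp add: sweedler_def)
qed

lemma k_linear_comult:
  "vector_space s' \<Longrightarrow> k_bilinear scale s' f \<Longrightarrow> k_linear scale s' (\<lambda>h. sweedler \<Delta> h f)"
  by (simp add: k_linear_def sweedler_add_arg sweedler_scale_arg)

lemma sweedler_mult:
  assumes "k_bilinear scale s' f"
  shows "sweedler \<Delta> (x * y) f = sweedler \<Delta> x (\<lambda>a b. sweedler \<Delta> y (\<lambda>c d. f (a * c) (b * d)))"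
proof -
  have "(\<Sum>(a, b)\<in>#\<Delta> (x * y). f a b)
      = (\<Sum>(a, b)\<in>#(\<Sum>(a, b)\<in>#\<Delta> x. {#(a * c, b * d). (c, d) \<in># \<Delta> y#}). f a b)"
    by (rule tensor2_eq_lift[OF comult_mult]) (use assms in \<open>auto simp: k_bilinear_def k_linear_def\<close>)
  then show ?thesis
    by (simp add: sweedler_def sum_mset_sum_mset case_prod_unfold image_mset.compositionality o_def)
qed

lemma sweedler_coassoc:
  assumes "k_trilinear scale s' f"
  shows "sweedler \<Delta> x (\<lambda>a b. sweedler \<Delta> a (\<lambda>a\<^sub>1 a\<^sub>2. f a\<^sub>1 a\<^sub>2 b))
    = sweedler \<Delta> x (\<lambda>a b. sweedler \<Delta> b (f a))"
proof -
  have "(\<Sum>(a, b, d)\<in>#(\<Sum>(a, b)\<in>#\<Delta> x. {#(a\<^sub>1, a\<^sub>2, b). (a\<^sub>1, a\<^sub>2) \<in># \<Delta> a#}). f a b d)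
      = (\<Sum>(a, b, d)\<in>#(\<Sum>(a, b)\<in>#\<Delta> x. {#(a, b\<^sub>1, b\<^sub>2). (b\<^sub>1, b\<^sub>2) \<in># \<Delta> b#}). f a b d)"
    by (rule tensor3_eq_lift[OF coassoc]) (use assms in \<open>auto simp: k_trilinear_def k_linear_def\<close>)
  then show ?thesis
    by (simp add: sweedler_def sum_mset_sum_mset case_prod_unfold image_mset.compositionality o_def)
qed

lemma sweedler_counit_left:
  assumes "k_linear scale s' f"
  shows "sweedler \<Delta> x (\<lambda>a b. s' (\<epsilon> a) (f b)) = f x"
proof -
  have "f x = f (sweedler \<Delta> x (\<lambda>a b. scale (\<epsilon> a) b))" by (simp add: sweedler_def counit_left)
  also have "\<dots> = sweedler \<Delta> x (\<lambda>a b. f (scale (\<epsilon> a) b))"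
    by (rule sweedler_hom) (simp_all add: k_linearD[OF assms])
  finally show ?thesis by (simp add: k_linearD[OF assms])
qed

lemma sweedler_counit_right:
  assumes "k_linear scale s' f"
  shows "sweedler \<Delta> x (\<lambda>a b. s' (\<epsilon> b) (f a)) = f x"
proof -
  have "f x = f (sweedler \<Delta> x (\<lambda>a b. scale (\<epsilon> b) a))" by (simp add: sweedler_def counit_right)
  also have "\<dots> = sweedler \<Delta> x (\<lambda>a b. f (scale (\<epsilon> b) a))"
    by (rule sweedler_hom) (simp_all add: k_linearD[OF assms])
  finally show ?thesis by (simp add: k_linearD[OF assms])
qed

lemma counit_k_linear: "k_linear scale (*) \<epsilon>"
  using counit_linear by (simp add: k_linear_def Vector_Spaces.linear_iff)

lemma antipode_k_linear: "k_linear scale scale S"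
  using antipode_linear by (simp add: k_linear_def Vector_Spaces.linear_iff)

text \<open>The integral is the component of \<open>1\<close> in a complement of the kernel of \<open>\<epsilon>\<close>.\<close>

lemma semisimple_integral:
  assumes "semisimple_ring TYPE('h)"
  obtains t where "\<And>h. h * t = scale (\<epsilon> h) t" "\<epsilon> t = 1"
proof -
  let ?K = "{h. \<epsilon> h = 0}"
  note e = k_linearD[OF counit_k_linear]
  have K: "left_ideal ?K"
    by (simp add: left_ideal_def add_subgroup_def e counit_mult)
  obtain L where L: "left_ideal L" "?K \<inter> L = {0}" "{x + y | x y. x \<in> ?K \<and> y \<in> L} = UNIV"
    using assms[unfolded semisimple_ring_def, rule_format, OF K] by (elim exE conjE)
  have "1 \<in> {x + y | x y. x \<in> ?K \<and> y \<in> L}" unfolding L(3) by (rule UNIV_I)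
  then obtain \<kappa> t where t: "1 = \<kappa> + t" "\<epsilon> \<kappa> = 0" "t \<in> L" by auto
  have et: "\<epsilon> t = 1" using t(1,2) e(1)[of \<kappa> t] counit_one by simp
  have "h * t = scale (\<epsilon> h) t" for h
  proof -
    have "h * t - scale (\<epsilon> h) t = (h - scale (\<epsilon> h) 1) * t"
      by (simp add: left_diff_distrib scale_mult_left)
    then have "h * t - scale (\<epsilon> h) t \<in> L" using left_ideal_mult[OF L(1) t(3)] by simp
    moreover have "\<epsilon> (h * t - scale (\<epsilon> h) t) = 0"
      using e(1)[of "h * t - scale (\<epsilon> h) t" "scale (\<epsilon> h) t"] by (simp add: counit_mult e et)
    ultimately have "h * t - scale (\<epsilon> h) t \<in> ?K \<inter> L" by simp
    then show ?thesis unfolding L(2) by simp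
  qed
  then show thesis using that et by blast
qed

text \<open>That is, t1 \<otimes> h t2 = S(h) t1 \<otimes> t2. Inserting \<epsilon>(h1) = S(h1) h2
  turns the left side into S(h1) h2 t1 \<otimes> h3 t2, in which h2 and h3 act on t through
  \<Delta>; the integral property then leaves a counit.\<close>

lemma integral_move:
  assumes t: "\<And>h. h * t = scale (\<epsilon> h) t" and vs: "vector_space s'" and f: "k_bilinear scale s' f"
  shows "sweedler \<Delta> t (\<lambda>a b. f a (h * b)) = sweedler \<Delta> t (\<lambda>a b. f (S h * a) b)"
proof -
  have f1: "k_linear scale s' (f a)" and f2: "k_linear scale s' (\<lambda>a. f a b)" for a b
    using f by (auto simp: k_bilinear_def)
  have f1': "k_linear scale s' (\<lambda>x. f a (g x))" if "k_linear scale scale g" for a g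
    using k_linear_comp[OF that f1] .
  have f2': "k_linear scale s' (\<lambda>x. f (g x) b)" if "k_linear scale scale g" for b g
    using k_linear_comp[OF that f2] .
  note lin = k_linear_mult_left k_linear_mult_right k_linear_id antipode_k_linear
  have tri: "k_trilinear scale s' (\<lambda>x y z. sweedler \<Delta> t (\<lambda>c d. f (S x * y * c) (z * d)))"
    unfolding k_trilinear_def
    by (intro conjI allI k_linear_sweedler[OF vs] f1' f2' lin)
  have "sweedler \<Delta> t (\<lambda>a b. f a (h * b))
      = sweedler \<Delta> h (\<lambda>a b. s' (\<epsilon> a) (sweedler \<Delta> t (\<lambda>c d. f c (b * d))))"
    by (rule sweedler_counit_left[symmetric]) (intro k_linear_sweedler[OF vs] f1' lin)
  also have "\<dots> = sweedler \<Delta> h (\<lambda>a b. sweedler \<Delta> t (\<lambda>c d. f (scale (\<epsilon> a) c) (b * d)))"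
  proof -
    interpret V: vector_space s' by fact
    show ?thesis
      by (simp add: k_linear_scale[OF f2] sweedler_hom[of "s' c" for c] V.scale_right_distrib)
  qed
  also have "\<dots> = sweedler \<Delta> h (\<lambda>a b. sweedler \<Delta> a (\<lambda>a\<^sub>1 a\<^sub>2. sweedler \<Delta> t (\<lambda>c d. f (S a\<^sub>1 * a\<^sub>2 * c) (b * d))))"
  proof -
    have "f (scale (\<epsilon> a) c) x = sweedler \<Delta> a (\<lambda>a\<^sub>1 a\<^sub>2. f (S a\<^sub>1 * a\<^sub>2 * c) x)" for a c x
    proof -
      have "scale (\<epsilon> a) c = sweedler \<Delta> a (\<lambda>a\<^sub>1 a\<^sub>2. S a\<^sub>1 * a\<^sub>2) * c"
        by (simp add: sweedler_def antipode_left scale_mult_left)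
      then show ?thesis
        unfolding sweedler_mult_right by (simp add: sweedler_hom[of "\<lambda>a. f a x"] k_linearD[OF f2])
    qed
    then show ?thesis by (simp add: sweedler_swap[of _ t])
  qed
  also have "\<dots> = sweedler \<Delta> h (\<lambda>a b. sweedler \<Delta> b (\<lambda>b\<^sub>1 b\<^sub>2. sweedler \<Delta> t (\<lambda>c d. f (S a * b\<^sub>1 * c) (b\<^sub>2 * d))))"
    by (rule sweedler_coassoc[OF tri])
  also have "\<dots> = sweedler \<Delta> h (\<lambda>a b. sweedler \<Delta> (b * t) (\<lambda>c d. f (S a * c) d))"
  proof -
    have "k_bilinear scale s' (\<lambda>c d. f (S a * c) d)" for a
      unfolding k_bilinear_def by (intro conjI allI f1 f2' lin)
    from sweedler_mult[OF this] show ?thesis by (simp add: mult.assoc)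
  qed
  also have "\<dots> = sweedler \<Delta> h (\<lambda>a b. s' (\<epsilon> b) (sweedler \<Delta> t (\<lambda>c d. f (S a * c) d)))"
  proof -
    have "k_bilinear scale s' (\<lambda>c d. f (S a * c) d)" for a
      unfolding k_bilinear_def by (intro conjI allI f1 f2' lin)
    then show ?thesis by (simp add: t sweedler_scale_arg[OF vs])
  qed
  also have "\<dots> = sweedler \<Delta> t (\<lambda>a b. f (S h * a) b)"
    by (rule sweedler_counit_right) (intro k_linear_sweedler[OF vs] f2' lin)
  finally show ?thesis .
qed

text \<open>The functional \<open>\<phi>\<close> exists because the elements \<open>\<Sum> f(t\<^sub>(\<^sub>1\<^sub>)) t\<^sub>(\<^sub>2\<^sub>)\<close> form a left ideal, and
  a nonzero \<open>w'\<close> in a complement would give \<open>w' = \<Sum> S(t\<^sub>(\<^sub>1\<^sub>)) t\<^sub>(\<^sub>2\<^sub>) w' = 0\<close>.\<close>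

lemma integral_functional:
  assumes ss: "semisimple_ring TYPE('h)" and fd: "finite_dimensional scale"
    and t: "\<And>h. h * t = scale (\<epsilon> h) t" "\<epsilon> t = 1"
  obtains \<phi> where "k_linear scale (*) \<phi>" "sweedler \<Delta> t (\<lambda>a b. scale (\<phi> a) b) = 1"
proof -
  define \<Lambda> where "\<Lambda> = {f. k_linear scale (*) f}"
  define w where "w f = sweedler \<Delta> t (\<lambda>a b. scale (f a) b)" for f
  have vs: "vector_space scale" ..
  note lin = k_linear_mult_left k_linear_mult_right k_linear_id antipode_k_linear
  have wadd: "w (\<lambda>x. f x + g x) = w f + w g" for f g
    by (simp add: w_def scale_left_distrib sweedler_add)
  have wmult: "h * w f = w (\<lambda>x. f (S h * x))" if f: "f \<in> \<Lambda>" for h f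
  proof -
    have "k_bilinear scale scale (\<lambda>a b. scale (f a) b)"
      using f unfolding k_bilinear_def \<Lambda>_def
      by (auto intro: k_linear_scale_left k_linear_scale_right k_linear_id)
    from integral_move[OF t(1) vs this, of h] show ?thesis
      by (simp add: w_def sweedler_mult_left scale_mult_right)
  qed
  have W: "left_ideal (w ` \<Lambda>)"
    unfolding left_ideal_def add_subgroup_def
  proof (intro conjI allI ballI)
    have "w (\<lambda>_. 0) = 0" by (simp add: w_def sweedler_zero)
    then show "0 \<in> w ` \<Lambda>" by (intro image_eqI[of _ _ "\<lambda>_. 0"]) (simp_all add: \<Lambda>_def k_linear_def)
  next
    fix x y assume "x \<in> w ` \<Lambda>" "y \<in> w ` \<Lambda>"
    then obtain f g where "f \<in> \<Lambda>" "g \<in> \<Lambda>" "x = w f" "y = w g" by blast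
    then show "x + y \<in> w ` \<Lambda>"
      by (intro image_eqI[of _ _ "\<lambda>x. f x + g x"]) (auto simp: wadd \<Lambda>_def k_linear_def algebra_simps)
  next
    fix x assume "x \<in> w ` \<Lambda>"
    then obtain f where f: "f \<in> \<Lambda>" "x = w f" by blast
    have "- x = w (\<lambda>x. - f x)"
      using wadd[of f "\<lambda>x. - f x"] f by (simp add: w_def sweedler_zero eq_neg_iff_add_eq_0 add.commute minus_unique)
    then show "- x \<in> w ` \<Lambda>"
      using f by (intro image_eqI[of _ _ "\<lambda>x. - f x"]) (auto simp: \<Lambda>_def k_linear_def)
  next
    fix h x assume "x \<in> w ` \<Lambda>"
    then obtain f where f: "f \<in> \<Lambda>" "x = w f" by blast
    have "k_linear scale (*) (\<lambda>x. f (S h * x))"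
      using f by (intro k_linear_comp[OF k_linear_mult_left[OF k_linear_id]]) (simp add: \<Lambda>_def)
    then show "h * x \<in> w ` \<Lambda>"
      using f by (intro image_eqI[of _ _ "\<lambda>x. f (S h * x)"]) (auto simp: \<Lambda>_def wmult)
  qed
  obtain L where L: "left_ideal L" "w ` \<Lambda> \<inter> L = {0}" "{x + y | x y. x \<in> w ` \<Lambda> \<and> y \<in> L} = UNIV"
    using ss[unfolded semisimple_ring_def, rule_format, OF W] by (elim exE conjE)
  have "1 \<in> {x + y | x y. x \<in> w ` \<Lambda> \<and> y \<in> L}" unfolding L(3) by (rule UNIV_I)
  then obtain x y where xy: "1 = x + y" "x \<in> w ` \<Lambda>" "y \<in> L" by (elim CollectE exE conjE)
  \<comment> \<open>From \<open>w f = w f * x + w f * y\<close> the last term lies in the left ideal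
    of all \<open>w f\<close>, and it lies in the complement L because y does.\<close>
  have wy: "w f * y = 0" if "f \<in> \<Lambda>" for f
  proof -
    have "w f = w f * (x + y)" unfolding xy(1)[symmetric] by simp
    then have "w f = w f * x + w f * y" by (simp only: distrib_left)
    then have "w f * y = w f - w f * x" by (metis add_diff_cancel_left')
    also have "\<dots> \<in> w ` \<Lambda>"
      using that xy(2) by (intro add_subgroup_diff[OF left_ideal_subgroup[OF W]] left_ideal_mult[OF W]) auto
    finally show ?thesis using left_ideal_mult[OF L(1) xy(3)] L(2) by blast
  qed
  obtain B0 where B0: "finite B0" "span B0 = UNIV" using fd by (auto simp: finite_dimensional_def)
  obtain B where B: "B \<subseteq> B0" "independent B" "span B = UNIV"
    using maximal_independent_subset[of B0] B0(2) by (metis span_mono span_span top.extremum_uniqueI span_superset)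
  have finB: "finite B" using B(1) B0(1) by (rule finite_subset)
  have coord: "k_linear scale (*) (\<lambda>x. representation B x b)" for b
    using representation_add[OF B(2)] representation_scale[OF B(2)] B(3) by (simp add: k_linear_def)
  have repr: "x = (\<Sum>b\<in>B. scale (representation B x b) b)" for x
    using sum_representation_eq[OF B(2) _ finB order_refl, of x] B(3) by simp
  have "y = sweedler \<Delta> t (\<lambda>a b. S a * b) * y"
    by (simp add: sweedler_def antipode_left t scale_mult_left)
  also have "\<dots> = sweedler \<Delta> t (\<lambda>a b. S a * b * y)" by (rule sweedler_mult_right)
  also have "\<dots> = sweedler \<Delta> t (\<lambda>a b. \<Sum>\<beta>\<in>B. S \<beta> * scale (representation B a \<beta>) b * y)"
  proof -
    \<comment> \<open>Expanding the left tensor factor of \<Delta> t in the basis turns it into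
      coordinate functionals, to which \<open>wy\<close> applies.\<close>
    have Sa: "S a = (\<Sum>\<beta>\<in>B. scale (representation B a \<beta>) (S \<beta>))" for a
      by (subst (1) repr[of a]) (simp add: k_linear_sum[OF antipode_k_linear] k_linearD[OF antipode_k_linear])
    have "S a * b * y = (\<Sum>\<beta>\<in>B. S \<beta> * scale (representation B a \<beta>) b * y)" for a b
      by (subst Sa) (simp add: sum_distrib_right scale_mult_left scale_mult_right)
    then show ?thesis by (intro arg_cong[of _ _ "sweedler \<Delta> t"] ext)
  qed
  also have "\<dots> = (\<Sum>\<beta>\<in>B. S \<beta> * (w (\<lambda>a. representation B a \<beta>) * y))"
    by (simp add: sweedler_sum w_def sweedler_mult_left sweedler_mult_right mult.assoc)
  also have "\<dots> = 0" using wy coord by (simp add: \<Lambda>_def)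
  finally have "1 \<in> w ` \<Lambda>" using xy by simp
  then show thesis using that by (auto simp: w_def \<Lambda>_def)
qed

text \<open>The map \<open>S'\<close> plays the role of the inverse of the antipode; it is obtained from the integral
  directly, without proving that \<open>S\<close> is bijective.\<close>

lemma skew_antipode:
  assumes ss: "semisimple_ring TYPE('h)" and fd: "finite_dimensional scale"
  obtains S' where "k_linear scale scale S'" "\<And>h. sweedler \<Delta> h (\<lambda>a b. b * S' a) = scale (\<epsilon> h) 1"
proof -
  obtain t where t: "\<And>h. h * t = scale (\<epsilon> h) t" "\<epsilon> t = 1" using semisimple_integral[OF ss] by blast
  obtain \<phi> where l: "k_linear scale (*) \<phi>" "sweedler \<Delta> t (\<lambda>a b. scale (\<phi> a) b) = 1"
    by (rule integral_functional[OF ss fd t])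
  have vs: "vector_space scale" ..
  \<comment> \<open>Thus S'(y) = \<phi>(y t1) t2, chosen so that the sum of h2 S'(h1) is the
    functional applied to the left factor of \<Delta>(h t) = \<epsilon>(h) \<Delta>(t).\<close>
  define S' where "S' y = sweedler \<Delta> t (\<lambda>a b. scale (\<phi> (y * a)) b)" for y
  have bil: "k_bilinear scale scale (\<lambda>a b. scale (\<phi> a) b)"
    using l unfolding k_bilinear_def
    by (auto intro: k_linear_scale_left k_linear_scale_right k_linear_id)
  show thesis
  proof (rule that[of S'])
    show "k_linear scale scale S'"
      unfolding S'_def
      by (intro k_linear_sweedler[OF vs] k_linear_scale_left
          k_linear_comp[OF k_linear_mult_right[OF k_linear_id] l(1)])
    fix h
    have "sweedler \<Delta> h (\<lambda>a b. b * S' a)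
        = sweedler \<Delta> h (\<lambda>a b. sweedler \<Delta> t (\<lambda>c d. scale (\<phi> (a * c)) (b * d)))"
      by (simp add: S'_def sweedler_mult_left scale_mult_right)
    also have "\<dots> = sweedler \<Delta> (h * t) (\<lambda>a b. scale (\<phi> a) b)" by (rule sweedler_mult[OF bil, symmetric])
    also have "\<dots> = scale (\<epsilon> h) 1" by (simp add: t sweedler_scale_arg[OF vs bil] l)
    finally show "sweedler \<Delta> h (\<lambda>a b. b * S' a) = scale (\<epsilon> h) 1" .
  qed
qed

end

section \<open>Chain conditions for functions\<close>

definition right_subspace :: "('i \<Rightarrow> 'a::{ring,monoid_mult}) set \<Rightarrow> bool" where
  "right_subspace V \<longleftrightarrow> (\<lambda>_. 0) \<in> V \<and> (\<forall>f\<in>V. \<forall>g\<in>V. (\<lambda>i. f i + g i) \<in> V)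
    \<and> (\<forall>f\<in>V. \<forall>a. (\<lambda>i. f i * a) \<in> V)"

lemma right_subspaceD:
  assumes "right_subspace V"
  shows right_subspace_zero: "(\<lambda>_. 0) \<in> V"
    and right_subspace_add: "f \<in> V \<Longrightarrow> g \<in> V \<Longrightarrow> (\<lambda>i. f i + g i) \<in> V"
    and right_subspace_mult: "f \<in> V \<Longrightarrow> (\<lambda>i. f i * a) \<in> V"
    and right_subspace_diff: "f \<in> V \<Longrightarrow> g \<in> V \<Longrightarrow> (\<lambda>i. f i - g i) \<in> V"
proof -
  show "(\<lambda>_. 0) \<in> V" and a: "f \<in> V \<Longrightarrow> g \<in> V \<Longrightarrow> (\<lambda>i. f i + g i) \<in> V"
    and m: "f \<in> V \<Longrightarrow> (\<lambda>i. f i * a) \<in> V" for f g a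
    using assms by (auto simp: right_subspace_def)
  show "f \<in> V \<Longrightarrow> g \<in> V \<Longrightarrow> (\<lambda>i. f i - g i) \<in> V"
    using a[of f "\<lambda>i. g i * (- 1)"] m[of g "- 1"] by simp
qed

lemma right_subspace_hull: "right_subspace (right_subspace hull X)"
  by (rule hull_in) (auto simp: right_subspace_def)

text \<open>Restriction to B lands in a finite power of the ring, which inherits the chain
  condition. As B need not be the whole domain, stabilisation is expressed as agreement on B. The
  induction splits a chain into the values at b and the members vanishing at b.\<close>

lemma right_artinian_fun:
  fixes V :: "nat \<Rightarrow> ('i \<Rightarrow> 'a::{ring,monoid_mult}) set"
  assumes "right_artinian TYPE('a)" "finite B"
    and "\<And>m. right_subspace (V m)" "\<And>m. V (Suc m) \<subseteq> V m"
  shows "\<exists>M. \<forall>m\<ge>M. \<forall>f\<in>V M. \<exists>g\<in>V m. \<forall>i\<in>B. f i = g i"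
  using assms(2-4)
proof (induct B arbitrary: V rule: finite_induct)
  case empty
  show ?case
    by (intro exI[of _ 0] allI impI ballI bexI[of _ "\<lambda>_. 0"]) (simp_all add: right_subspace_zero[OF empty(1)])
next
  case (insert b B)
  have dec: "V m \<subseteq> V m'" if "m' \<le> m" for m m'
    using that insert(5) by (rule lift_Suc_antimono_le[rotated])
  define p where "p m = {f b | f. f \<in> V m}" for m
  define K where "K m = {f \<in> V m. f b = 0}" for m
  have "right_ideal (p m)" for m
    unfolding right_ideal_def add_subgroup_def
  proof (intro conjI ballI allI)
    note V = right_subspaceD[OF insert(4)[of m]]
    show "0 \<in> p m" unfolding p_def by (intro CollectI exI[of _ "\<lambda>_. 0"] conjI V(1)) simp
  next
    note V = right_subspaceD[OF insert(4)[of m]]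
    fix x y assume "x \<in> p m" "y \<in> p m"
    then obtain f g where "x = f b" "f \<in> V m" "y = g b" "g \<in> V m" by (auto simp: p_def)
    then show "x + y \<in> p m"
      unfolding p_def by (intro CollectI exI[of _ "\<lambda>i. f i + g i"] conjI V(2)) simp_all
  next
    note V = right_subspaceD[OF insert(4)[of m]]
    fix x assume "x \<in> p m"
    then obtain f where f: "x = f b" "f \<in> V m" by (auto simp: p_def)
    then show "- x \<in> p m"
      unfolding p_def by (intro CollectI exI[of _ "\<lambda>i. 0 - f i"] conjI V(4) V(1)) simp_all
    show "x * a \<in> p m" for a
      unfolding p_def by (intro CollectI exI[of _ "\<lambda>i. f i * a"] conjI V(3)) (simp_all add: f)
  qed
  moreover have "p (Suc m) \<subseteq> p m" for m using insert(5) by (auto simp: p_def)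
  ultimately obtain M1 where M1: "\<forall>m\<ge>M1. p m = p M1"
    using assms(1) unfolding right_artinian_def by blast
  have "right_subspace (K m)" for m
    using right_subspaceD[OF insert(4)[of m]] by (simp add: K_def right_subspace_def)
  moreover have "K (Suc m) \<subseteq> K m" for m using insert(5) by (auto simp: K_def)
  ultimately obtain M2 where M2: "\<forall>m\<ge>M2. \<forall>f\<in>K M2. \<exists>g\<in>K m. \<forall>i\<in>B. f i = g i"
    using insert(3)[of K] by blast
  show ?case
  proof (intro exI[of _ "max M1 M2"] allI impI ballI)
    \<comment> \<open>Beyond both bounds, f is matched at b by some g in \<open>V m\<close>; the
      difference vanishes at b and is matched on B by some k.\<close>
    fix m f assume m: "max M1 M2 \<le> m" and f: "f \<in> V (max M1 M2)"
    then have "f b \<in> p (max M1 M2)" by (auto simp: p_def)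
    then have "f b \<in> p m" using M1 m by (metis max.cobounded1 max.boundedE)
    then obtain g where g: "g \<in> V m" "f b = g b" by (auto simp: p_def)
    have "g \<in> V (max M1 M2)" using g(1) dec[OF m] by blast
    then have "(\<lambda>i. f i - g i) \<in> V (max M1 M2)"
      using f by (intro right_subspace_diff[OF insert(4)])
    then have "(\<lambda>i. f i - g i) \<in> K M2"
      using dec[of M2 "max M1 M2"] g(2) by (auto simp: K_def)
    then obtain k where k: "k \<in> K m" "\<forall>i\<in>B. f i - g i = k i" using M2 m by force
    show "\<exists>g\<in>V m. \<forall>i\<in>insert b B. f i = g i"
    proof (intro bexI[of _ "\<lambda>i. g i + k i"] ballI)
      show "(\<lambda>i. g i + k i) \<in> V m"
        using g(1) k(1) by (intro right_subspace_add[OF insert(4)]) (auto simp: K_def)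
      show "f i = g i + k i" if "i \<in> insert b B" for i
      proof (cases "i = b")
        case True
        then show ?thesis using g(2) k(1) by (simp add: K_def)
      next
        case False
        then have "f i - g i = k i" using that k(2) by blast
        then show ?thesis by (simp add: diff_eq_eq add.commute)
      qed
    qed
  qed
qed

section \<open>Module algebras over a semisimple Hopf algebra\<close>

text \<open>The integral t, the map S' and the finite basis B become fixed parameters;
  \<open>hopf_algebra_semisimple_data\<close> derives them from semisimplicity and finite
  dimension.\<close>

locale semisimple_module_algebra =
  H: hopf_algebra scaleH \<Delta> \<epsilon> S + hmodule_algebra scaleH \<Delta> scaleQ act
  for scaleH :: "'k::field \<Rightarrow> 'h::{ring,monoid_mult} \<Rightarrow> 'h"
    and \<Delta> \<epsilon> S
    and scaleQ :: "'k \<Rightarrow> 'q::{ring,monoid_mult} \<Rightarrow> 'q"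
    and act +
  fixes t :: 'h and S' :: "'h \<Rightarrow> 'h" and B :: "'h set"
  assumes integral: "h * t = scaleH (\<epsilon> h) t"
    and counit_integral: "\<epsilon> t = 1"
    and skew_antipode_linear: "k_linear scaleH scaleH S'"
    and skew_antipode: "sweedler \<Delta> h (\<lambda>a b. b * S' a) = scaleH (\<epsilon> h) 1"
    and basis: "finite B" "H.independent B" "H.span B = UNIV"
begin

section \<open>Consequences of the module algebra axioms\<close>

abbreviation lin :: "('h \<Rightarrow> 'q) \<Rightarrow> bool" where "lin \<equiv> k_linear scaleH scaleQ"

lemma vs: "vector_space scaleQ" ..

lemma act_sweedler: "act h (a * b) = sweedler \<Delta> h (\<lambda>x y. act x a * act y b)"
  by (simp add: act_mult sweedler_def)

lemma act_zero: "act h 0 = 0"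
  using act_add_right[of h 0 0] by simp

lemma act_minus: "act h (- a) = - act h a"
  using act_add_right[of h a "- a"] by (simp add: act_zero eq_neg_iff_add_eq_0 add.commute)

lemma act_diff: "act h (a - b) = act h a - act h b"
  using act_add_right[of h a "- b"] by (simp add: act_minus)

lemma act_sum: "act h (sum f K) = (\<Sum>k\<in>K. act h (f k))"
  by (induct K rule: infinite_finite_induct) (simp_all add: act_zero act_add_right)

lemma act_sweedler_sum: "act h (sweedler \<Delta> g f) = sweedler \<Delta> g (\<lambda>a b. act h (f a b))"
  by (rule sweedler_hom) (simp_all add: act_zero act_add_right)

lemma lin_act: "k_linear scaleH scaleH f \<Longrightarrow> lin (\<lambda>x. act (f x) a)"
  by (simp add: k_linear_def act_add_left act_scale_left)

lemma lin_act_right: "lin f \<Longrightarrow> lin (\<lambda>x. act h (f x))"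
  by (simp add: k_linear_def act_add_right act_scale_right)

lemma lin_tau: "lin (\<lambda>h. act h a)"
  by (rule lin_act) (rule H.k_linear_id)

lemma act_sweedler_left: "act (sweedler \<Delta> g f) x = sweedler \<Delta> g (\<lambda>a b. act (f a b) x)"
  by (rule sweedler_hom[of "\<lambda>h. act h x"]) (simp_all add: k_linearD[OF lin_tau])

lemma lin_add: "lin f \<Longrightarrow> lin g \<Longrightarrow> lin (\<lambda>h. f h + g h)"
  by (simp add: k_linear_def scale_right_distrib algebra_simps)

lemma lin_diff: "lin f \<Longrightarrow> lin g \<Longrightarrow> lin (\<lambda>h. f h - g h)"
  by (simp add: k_linear_def scale_right_diff_distrib algebra_simps)

lemma lin_zero: "lin (\<lambda>h. 0)"
  by (simp add: k_linear_def)

lemma lin_sum: "(\<And>k. k \<in> K \<Longrightarrow> lin (f k)) \<Longrightarrow> lin (\<lambda>h. \<Sum>k\<in>K. f k h)"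
  by (induct K rule: infinite_finite_induct) (simp_all add: lin_zero lin_add)

text \<open>Turns the agreement on B supplied by \<open>right_artinian_fun\<close> into equality of
  linear maps.\<close>

lemma lin_eqI:
  assumes "lin f" "lin g" "\<And>b. b \<in> B \<Longrightarrow> f b = g b" shows "f = g"
proof
  fix h
  have "h \<in> H.span B" using basis(3) by simp
  then show "f h = g h"
  proof (induct rule: H.span_induct)
    case base
    show ?case
      unfolding H.subspace_def by (simp add: k_linearD[OF assms(1)] k_linearD[OF assms(2)])
  qed (rule assms(3))
qed

text \<open>The unit condition follows from linearity of the multiplication: let h1 act on the
  product of 1 and S(h2) 1. This gives (h1 1) (h2 S(h3) 1) = h 1, while h1 S(h2) 1 is \<epsilon>(h)
  1.\<close>

lemma act_one_right: "act h 1 = scaleQ (\<epsilon> h) 1"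
proof -
  note lins = k_linear_mult_left k_linear_mult_right lin_act lin_act_right H.k_linear_mult_left
    H.k_linear_mult_right H.k_linear_id H.antipode_k_linear
  have tri: "k_trilinear scaleH scaleQ (\<lambda>a b c. act a 1 * act b (act (S c) 1))"
    unfolding k_trilinear_def by (intro conjI allI lins)
  have "scaleQ (\<epsilon> h) 1 = act (sweedler \<Delta> h (\<lambda>a b. a * S b)) 1"
    by (simp add: sweedler_def H.antipode_right act_scale_left act_one)
  also have "\<dots> = sweedler \<Delta> h (\<lambda>a b. act a (1 * act (S b) 1))"
    by (simp add: act_sweedler_left act_act)
  also have "\<dots> = sweedler \<Delta> h (\<lambda>a b. sweedler \<Delta> a (\<lambda>x y. act x 1 * act y (act (S b) 1)))"
    unfolding act_sweedler ..
  also have "\<dots> = sweedler \<Delta> h (\<lambda>a b. sweedler \<Delta> b (\<lambda>x y. act a 1 * act x (act (S y) 1)))"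
    by (rule H.sweedler_coassoc[OF tri])
  also have "\<dots> = sweedler \<Delta> h (\<lambda>a b. act a 1 * act (sweedler \<Delta> b (\<lambda>x y. x * S y)) 1)"
    by (simp add: act_sweedler_left act_act sweedler_mult_left)
  also have "\<dots> = sweedler \<Delta> h (\<lambda>a b. scaleQ (\<epsilon> b) (act a 1))"
    by (simp add: sweedler_def[of \<Delta> _ "\<lambda>x y. x * S y"] H.antipode_right act_scale_left act_one scale_mult_right)
  also have "\<dots> = act h 1" by (rule H.sweedler_counit_right[OF lin_tau])
  finally show ?thesis ..
qed

text \<open>Letting h2 act on the product of S'(h1) x and y gives (h2 S'(h1) x) (h3 y), where the
  skew antipode cancels. A left factor can thus be pulled inside an action.\<close>

lemma mult_act:
  "x * act h y = sweedler \<Delta> h (\<lambda>a b. act b (act (S' a) x * y))"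
proof -
  note lins = k_linear_mult_left k_linear_mult_right lin_act lin_act_right H.k_linear_mult_left
    H.k_linear_mult_right H.k_linear_id skew_antipode_linear
  have tri: "k_trilinear scaleH scaleQ (\<lambda>a b c. act b (act (S' a) x) * act c y)"
    unfolding k_trilinear_def by (intro conjI allI lins)
  have "sweedler \<Delta> h (\<lambda>a b. act b (act (S' a) x * y))
      = sweedler \<Delta> h (\<lambda>a b. sweedler \<Delta> b (\<lambda>b c. act b (act (S' a) x) * act c y))"
    unfolding act_sweedler ..
  also have "\<dots> = sweedler \<Delta> h (\<lambda>c b. sweedler \<Delta> c (\<lambda>a c. act c (act (S' a) x) * act b y))"
    by (rule H.sweedler_coassoc[OF tri, symmetric])
  also have "\<dots> = sweedler \<Delta> h (\<lambda>c b. act (sweedler \<Delta> c (\<lambda>a c. c * S' a)) x * act b y)"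
    by (simp add: act_sweedler_left act_act sweedler_mult_right)
  also have "\<dots> = sweedler \<Delta> h (\<lambda>c b. scaleQ (\<epsilon> c) (x * act b y))"
    by (simp add: skew_antipode act_scale_left act_one scale_mult_left)
  also have "\<dots> = x * act h y"
    by (rule H.sweedler_counit_left) (intro lins)
  finally show ?thesis ..
qed

section \<open>Invariants and right submodules over them\<close>

abbreviation "QH \<equiv> invariants \<epsilon> scaleQ act"

lemma act_integral_invariant: "act t x \<in> QH"
  by (simp add: invariants_def integral act_scale_left flip: act_act)

lemma act_integral_one: "act t 1 = 1"
  by (simp add: act_one_right counit_integral)

lemma act_mult_invariant:
  assumes "z \<in> QH" shows "act h (x * z) = act h x * z"
proof -
  have "act h (x * z) = sweedler \<Delta> h (\<lambda>a b. scaleQ (\<epsilon> b) (act a x * z))"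
    using assms by (simp add: act_sweedler invariants_def scale_mult_right)
  also have "\<dots> = act h x * z"
    by (rule H.sweedler_counit_right) (intro k_linear_mult_right lin_tau)
  finally show ?thesis .
qed

lemma invariants_mult: "x \<in> QH \<Longrightarrow> y \<in> QH \<Longrightarrow> x * y \<in> QH"
  using act_mult_invariant[of y _ x] by (simp add: invariants_def scale_mult_left)

lemma invariants_subgroup: "add_subgroup QH"
  by (simp add: add_subgroup_def invariants_def act_zero act_add_right act_minus scale_right_distrib)

text \<open>With \<open>q = 1\<close> it recovers y from the function h \<mapsto> h y; for any q the
  right-hand side is y times an invariant.\<close>

lemma integral_retract:
  "sweedler \<Delta> t (\<lambda>a b. act b (act (S' a) y * q)) = y * act t q"
  by (rule mult_act[symmetric])

text \<open>Right \<open>Q\<^sup>H\<close>-submodules \<open>Y\<close> of \<open>Q\<close> satisfy the descending chain condition, hence \<open>s Y = Y\<close>: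
  with the help of the integral, \<open>Y\<close> is recovered from the right \<open>Q\<close>-module spanned by the functions
  \<open>h \<mapsto> h y\<close>.\<close>

lemma inverse_stable:
  assumes art: "right_artinian TYPE('q)" and Y: "add_subgroup Y"
    and YQ: "\<And>y z. y \<in> Y \<Longrightarrow> z \<in> QH \<Longrightarrow> y * z \<in> Y"
    and sY: "\<And>y. y \<in> Y \<Longrightarrow> s * y \<in> Y" and u: "u * s = 1" and y: "y \<in> Y"
  shows "u * y \<in> Y"
proof -
  define X where "X m = {\<lambda>h. act h (s ^ m * y) | y. y \<in> Y}" for m
  define V where "V m = right_subspace hull (X m)" for m
  have V: "right_subspace (V m)" for m unfolding V_def by (rule right_subspace_hull)
  have "X (Suc m) \<subseteq> X m" for m
    using sY by (fastforce simp: X_def power_Suc2 mult.assoc simp del: power_Suc)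
  then have dec: "V (Suc m) \<subseteq> V m" for m unfolding V_def by (rule hull_mono)
  \<comment> \<open>Functions F such that the retraction of every F q lies in s^m Y. Quantifying
    over q makes this a right Q-module, and h \<mapsto> h y belongs to it for y in s^m Y because
    \<open>act t q\<close> is invariant.\<close>
  define U where "U m = {F. lin F \<and> (\<forall>q. sweedler \<Delta> t (\<lambda>a b. act b (F (S' a) * q)) \<in> {s ^ m * y | y. y \<in> Y})}" for m
  have sub: "V m \<subseteq> U m" for m
    unfolding V_def
  proof (rule hull_minimal)
    show "X m \<subseteq> U m"
    proof
      fix F assume "F \<in> X m"
      then obtain y where F: "F = (\<lambda>h. act h (s ^ m * y))" "y \<in> Y" by (auto simp: X_def)
      then show "F \<in> U m"
        using YQ[OF F(2) act_integral_invariant] by (auto simp: U_def lin_tau integral_retract mult.assoc)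
    qed
    show "right_subspace (U m)"
      unfolding right_subspace_def
    proof (intro conjI ballI allI)
      show "(\<lambda>_. 0) \<in> U m"
        using add_subgroup_zero[OF Y] by (force simp: U_def lin_zero act_zero sweedler_zero)
    next
      fix f g assume f: "f \<in> U m" and g: "g \<in> U m"
      have "sweedler \<Delta> t (\<lambda>a b. act b ((f (S' a) + g (S' a)) * q)) \<in> {s ^ m * y | y. y \<in> Y}" for q
      proof -
        have "sweedler \<Delta> t (\<lambda>a b. act b (f (S' a) * q)) \<in> {s ^ m * y | y. y \<in> Y}"
          "sweedler \<Delta> t (\<lambda>a b. act b (g (S' a) * q)) \<in> {s ^ m * y | y. y \<in> Y}"
          using f g by (simp_all only: U_def mem_Collect_eq)
        then obtain y y' where "y \<in> Y" "sweedler \<Delta> t (\<lambda>a b. act b (f (S' a) * q)) = s ^ m * y"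
          "y' \<in> Y" "sweedler \<Delta> t (\<lambda>a b. act b (g (S' a) * q)) = s ^ m * y'"
          by (elim CollectE exE conjE)
        then have "sweedler \<Delta> t (\<lambda>a b. act b ((f (S' a) + g (S' a)) * q)) = s ^ m * (y + y')"
          by (simp add: distrib_right distrib_left act_add_right sweedler_add)
        then show ?thesis using add_subgroup_add[OF Y \<open>y \<in> Y\<close> \<open>y' \<in> Y\<close>] by blast
      qed
      then show "(\<lambda>i. f i + g i) \<in> U m" using f g by (simp add: U_def lin_add)
    next
      fix f a assume "f \<in> U m"
      then show "(\<lambda>i. f i * a) \<in> U m" by (simp add: U_def k_linear_mult_right mult.assoc)
    qed
  qed
  obtain M where M: "\<forall>m\<ge>M. \<forall>f\<in>V M. \<exists>g\<in>V m. \<forall>i\<in>B. f i = g i"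
    using right_artinian_fun[where V = V, OF art basis(1) V dec] by (elim exE)
  define f where "f h = act h (s ^ M * y)" for h
  have "f = (\<lambda>h. act h (s ^ M * y))" by (simp add: f_def fun_eq_iff)
  then have "f \<in> X M" using y unfolding X_def by blast
  then have fV: "f \<in> V M" unfolding V_def by (rule hull_inc)
  have "\<exists>g\<in>V (Suc M). \<forall>i\<in>B. f i = g i" by (rule M[rule_format, OF _ fV]) simp
  then obtain g where g: "g \<in> V (Suc M)" "\<forall>i\<in>B. f i = g i" ..
  then have gU: "g \<in> U (Suc M)" using sub by blast
  \<comment> \<open>Agreement on the basis gives equality; retracting with \<open>q = 1\<close>
    shows that \<open>s ^ M * y\<close> lies in s^(M+1) Y.\<close>
  have "f = g" by (rule lin_eqI) (use g(2) gU in \<open>auto simp: U_def f_def[abs_def] lin_tau\<close>)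
  then have "sweedler \<Delta> t (\<lambda>a b. act b (f (S' a) * 1)) \<in> {s ^ Suc M * y | y. y \<in> Y}"
    using gU by (simp only: U_def mem_Collect_eq)
  then obtain y' where y': "y' \<in> Y" "s ^ M * y = s ^ M * (s * y')"
    unfolding f_def integral_retract act_integral_one by (auto simp: power_Suc2 mult.assoc simp del: power_Suc)
  have "x = x'" if "s ^ M * x = s ^ M * x'" for x x'
    using that
  proof (induct M arbitrary: x x')
    case (Suc M)
    then have "u * s * (s ^ M * x) = u * s * (s ^ M * x')" by (simp add: mult.assoc)
    then show ?case using Suc(1) u by simp
  qed simp
  from this[OF y'(2)] have "u * y = u * s * y'" by (simp add: mult.assoc)
  then show ?thesis using y'(1) u by simp
qed

end

section \<open>The convolution algebra of linear maps from H to Q\<close>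

context semisimple_module_algebra
begin

definition conv :: "('h \<Rightarrow> 'q) \<Rightarrow> ('h \<Rightarrow> 'q) \<Rightarrow> 'h \<Rightarrow> 'q" where
  "conv f g h = sweedler \<Delta> h (\<lambda>a b. f a * g b)"

definition conv_one :: "'h \<Rightarrow> 'q" where
  "conv_one h = scaleQ (\<epsilon> h) 1"

lemma lin_conv_one: "lin conv_one"
  using k_linear_scale_left[OF H.counit_k_linear, of 1] by (simp add: conv_one_def[abs_def])

lemma lin_conv: "lin f \<Longrightarrow> lin g \<Longrightarrow> lin (conv f g)"
  unfolding conv_def[abs_def]
  by (intro H.k_linear_comult vs) (simp add: k_bilinear_def k_linear_mult_left k_linear_mult_right)

lemma conv_assoc:
  assumes "lin f" "lin g" "lin k" shows "conv (conv f g) k = conv f (conv g k)"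
proof
  fix h
  have "k_trilinear scaleH scaleQ (\<lambda>a b c. f a * g b * k c)"
    using assms unfolding k_trilinear_def by (intro conjI allI k_linear_mult_left k_linear_mult_right)
  from H.sweedler_coassoc[OF this, of h] show "conv (conv f g) k h = conv f (conv g k) h"
    by (simp add: conv_def sweedler_mult_left sweedler_mult_right mult.assoc)
qed

lemma conv_one_left: "lin f \<Longrightarrow> conv conv_one f = f"
  by (simp add: fun_eq_iff conv_def conv_one_def scale_mult_left H.sweedler_counit_left)

lemma conv_one_right: "lin f \<Longrightarrow> conv f conv_one = f"
  by (simp add: fun_eq_iff conv_def conv_one_def scale_mult_right H.sweedler_counit_right)

lemma conv_zero_right: "conv f (\<lambda>_. 0) h = 0"
  by (simp add: conv_def sweedler_zero)

lemma conv_zero_left: "conv (\<lambda>_. 0) f h = 0"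
  by (simp add: conv_def sweedler_zero)

lemma conv_add_right: "conv f (\<lambda>h. g h + k h) h = conv f g h + conv f k h"
  by (simp add: conv_def distrib_left sweedler_add)

lemma conv_add_left: "conv (\<lambda>h. g h + k h) f h = conv g f h + conv k f h"
  by (simp add: conv_def distrib_right sweedler_add)

lemma conv_diff_right: "conv f (\<lambda>h. g h - k h) h = conv f g h - conv f k h"
  by (simp add: conv_def right_diff_distrib sweedler_diff)

lemma conv_sum_right: "conv f (\<lambda>h. \<Sum>k\<in>K. g k h) h = (\<Sum>k\<in>K. conv f (g k) h)"
  by (simp add: conv_def sum_distrib_left sweedler_sum)

lemma conv_sum_left: "conv (\<lambda>h. \<Sum>k\<in>K. g k h) f h = (\<Sum>k\<in>K. conv (g k) f h)"
  by (simp add: conv_def sum_distrib_right sweedler_sum)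

lemma conv_mult_right: "conv f (\<lambda>h. g h * a) h = conv f g h * a"
  by (simp add: conv_def sweedler_mult_right mult.assoc)

lemma conv_mem_left:
  assumes "two_sided_ideal I" "\<And>h. f h \<in> I" shows "conv f g h \<in> I"
  unfolding conv_def
  by (intro sweedler_mem ideal_subgroup ideal_mult_right assms)

lemma conv_mem_right:
  assumes "left_ideal I" "\<And>h. g h \<in> I" shows "conv f g h \<in> I"
  unfolding conv_def
  by (intro sweedler_mem left_ideal_subgroup left_ideal_mult assms)

text \<open>A matrix over the convolution algebra modulo \<open>I\<close> with a left inverse acts injectively on
  columns, hence surjectively by the descending chain condition.\<close>

lemma conv_matrix_surjective:
  fixes C E :: "nat \<Rightarrow> nat \<Rightarrow> 'h \<Rightarrow> 'q"
  assumes art: "right_artinian TYPE('q)" and I: "two_sided_ideal I"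
    and C: "\<And>j k. lin (C j k)" and E: "\<And>j k. lin (E j k)"
    and EC: "\<And>j k h. j < n \<Longrightarrow> k < n \<Longrightarrow>
      (\<Sum>i<n. conv (E j i) (C i k) h) - (if j = k then conv_one h else 0) \<in> I"
    and z: "\<And>k. lin (z k)"
  obtains z' where "\<And>k. lin (z' k)" "\<And>k h. k < n \<Longrightarrow> z k h - (\<Sum>i<n. conv (C k i) (z' i) h) \<in> I"
proof -
  note Is = add_subgroupD[OF ideal_subgroup[OF I]]
  note Ic = cong_mod_subgroup[OF ideal_subgroup[OF I]]
  define \<phi> where "\<phi> z = (\<lambda>k h. \<Sum>i<n. conv (C k i) (z i) h)" for z :: "nat \<Rightarrow> 'h \<Rightarrow> 'q"
  define L where "L = {z :: nat \<Rightarrow> 'h \<Rightarrow> 'q. \<forall>k. lin (z k)}"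
  define LI where "LI = {z \<in> L. \<forall>k<n. \<forall>h. z k h \<in> I}"
  have \<phi>L: "\<phi> z \<in> L" if "z \<in> L" for z
    using that by (auto simp: \<phi>_def L_def intro!: lin_sum lin_conv C)
  have \<phi>diff: "\<phi> (\<lambda>k h. z k h - z' k h) = (\<lambda>k h. \<phi> z k h - \<phi> z' k h)" for z z'
    by (simp add: \<phi>_def fun_eq_iff conv_diff_right sum_subtractf)
  have \<phi>add: "\<phi> (\<lambda>k h. z k h + z' k h) = (\<lambda>k h. \<phi> z k h + \<phi> z' k h)" for z z'
    by (simp add: \<phi>_def fun_eq_iff conv_add_right sum.distrib)
  have \<phi>mult: "\<phi> (\<lambda>k h. z k h * a) = (\<lambda>k h. \<phi> z k h * a)" for z a
    by (simp add: \<phi>_def fun_eq_iff conv_mult_right sum_distrib_right)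
  have \<phi>zero: "\<phi> (\<lambda>k h. 0) = (\<lambda>k h. 0)"
    by (simp add: \<phi>_def fun_eq_iff conv_zero_right)
  \<comment> \<open>E times \<open>\<phi> z\<close> recovers z modulo I, since E C is the identity
    matrix modulo I.\<close>
  have inj: "z \<in> LI" if zL: "z \<in> L" and "\<phi> z \<in> LI" for z
  proof -
    have zl: "lin (z k)" for k using zL by (simp add: L_def)
    have "z j h \<in> I" if j: "j < n" for j h
    proof -
      define D where "D k = (\<lambda>h. (\<Sum>i<n. conv (E j i) (C i k) h) - (if j = k then conv_one h else 0))" for k
      have "(\<Sum>i<n. conv (E j i) (\<phi> z i) h) \<in> I"
        using \<open>\<phi> z \<in> LI\<close>
        by (intro add_subgroup_sum[OF ideal_subgroup[OF I]] conv_mem_right ideal_left[OF I])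
          (auto simp: LI_def)
      moreover have "(\<Sum>i<n. conv (E j i) (\<phi> z i) h)
          = (\<Sum>k<n. conv (\<lambda>h. \<Sum>i<n. conv (E j i) (C i k) h) (z k) h)"
      proof -
        have "(\<Sum>i<n. conv (E j i) (\<phi> z i) h) = (\<Sum>i<n. \<Sum>k<n. conv (E j i) (conv (C i k) (z k)) h)"
          by (simp add: \<phi>_def conv_sum_right)
        also have "\<dots> = (\<Sum>k<n. \<Sum>i<n. conv (conv (E j i) (C i k)) (z k) h)"
          by (subst sum.swap) (simp add: conv_assoc[OF E C zl])
        finally show ?thesis by (simp add: conv_sum_left)
      qed
      moreover have "\<dots> = (\<Sum>k<n. conv (D k) (z k) h) + z j h"
      proof -
        have "conv (\<lambda>h. \<Sum>i<n. conv (E j i) (C i k) h) (z k) h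
            = conv (D k) (z k) h + (if j = k then z k h else 0)" for k
          using conv_add_left[of "D k" "\<lambda>h. if j = k then conv_one h else 0" "z k" h]
          by (cases "j = k") (simp_all add: D_def conv_one_left[OF zl] conv_zero_left)
        then show ?thesis using j by (simp add: sum.distrib sum.delta)
      qed
      ultimately have Dz: "(\<Sum>k<n. conv (D k) (z k) h) + z j h \<in> I" by simp
      have "(\<Sum>k<n. conv (D k) (z k) h) \<in> I"
        using EC[OF j] by (intro add_subgroup_sum[OF ideal_subgroup[OF I]] conv_mem_left[OF I])
          (auto simp: D_def)
      from Is(4)[OF Dz this] show ?thesis by simp
    qed
    then show ?thesis using zL by (simp add: LI_def)
  qed
  \<comment> \<open>The m-th image of the space of columns, enlarged by the columns with values in
    I.\<close>
  define U where "U = rec_nat L (\<lambda>_ U. {\<lambda>k h. \<phi> z k h + y k h | z y. z \<in> U \<and> y \<in> LI})"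
  have U0: "U 0 = L" by (simp add: U_def)
  have US: "U (Suc m) = {\<lambda>k h. \<phi> z k h + y k h | z y. z \<in> U m \<and> y \<in> LI}" for m
    by (simp add: U_def)
  have UL: "U m \<subseteq> L" for m
  proof (induct m)
    case (Suc m)
    show ?case
    proof
      fix x assume "x \<in> U (Suc m)"
      then obtain z y where "x = (\<lambda>k h. \<phi> z k h + y k h)" "z \<in> U m" "y \<in> LI" unfolding US by blast
      then show "x \<in> L" using Suc \<phi>L[of z] by (auto simp: L_def LI_def intro!: lin_add)
    qed
  qed (simp add: U0)
  have dec: "U (Suc m) \<subseteq> U m" for m
  proof (induct m)
    case 0
    then show ?case using UL[of "Suc 0"] by (simp add: U0)
  next
    case (Suc m)
    show ?case
    proof
      fix x assume "x \<in> U (Suc (Suc m))"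
      then obtain z y where "x = (\<lambda>k h. \<phi> z k h + y k h)" "z \<in> U (Suc m)" "y \<in> LI"
        unfolding US[of "Suc m"] by (elim CollectE exE conjE)
      moreover have "z \<in> U m" using Suc calculation(2) by (rule subsetD)
      ultimately show "x \<in> U (Suc m)" unfolding US[of m] by (intro CollectI exI conjI)
    qed
  qed
  have LI0: "(\<lambda>k h. 0) \<in> LI" using Is(1) by (simp add: LI_def L_def lin_zero)
  have sub: "(\<lambda>k h. 0) \<in> U m \<and> (\<forall>x\<in>U m. \<forall>x'\<in>U m. (\<lambda>k h. x k h + x' k h) \<in> U m) \<and>
      (\<forall>x\<in>U m. \<forall>a. (\<lambda>k h. x k h * a) \<in> U m)" for m
  proof (induct m)
    case 0
    then show ?case by (simp add: U0 L_def lin_zero lin_add k_linear_mult_right)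
  next
    case (Suc m)
    show ?case
    proof (intro conjI ballI allI)
      show "(\<lambda>k h. 0) \<in> U (Suc m)"
        unfolding US using Suc LI0 by (intro CollectI exI[of _ "\<lambda>k h. 0"]) (simp add: \<phi>zero)
    next
      fix x x' assume "x \<in> U (Suc m)" "x' \<in> U (Suc m)"
      then obtain z y z' y' where x: "x = (\<lambda>k h. \<phi> z k h + y k h)" "z \<in> U m" "y \<in> LI"
        "x' = (\<lambda>k h. \<phi> z' k h + y' k h)" "z' \<in> U m" "y' \<in> LI" unfolding US by blast
      have "(\<lambda>k h. y k h + y' k h) \<in> LI" using x Is(2) by (simp add: LI_def L_def lin_add)
      then show "(\<lambda>k h. x k h + x' k h) \<in> U (Suc m)"
        unfolding US using Suc x
        by (intro CollectI exI[of _ "\<lambda>k h. z k h + z' k h"] exI[of _ "\<lambda>k h. y k h + y' k h"])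
          (simp add: \<phi>add fun_eq_iff algebra_simps)
    next
      fix x a assume "x \<in> U (Suc m)"
      then obtain z y where x: "x = (\<lambda>k h. \<phi> z k h + y k h)" "z \<in> U m" "y \<in> LI" unfolding US by blast
      have "(\<lambda>k h. y k h * a) \<in> LI"
        using x ideal_mult_right[OF I] by (simp add: LI_def L_def k_linear_mult_right)
      then show "(\<lambda>k h. x k h * a) \<in> U (Suc m)"
        unfolding US using Suc x
        by (intro CollectI exI[of _ "\<lambda>k h. z k h * a"] exI[of _ "\<lambda>k h. y k h * a"])
          (simp add: \<phi>mult fun_eq_iff algebra_simps)
    qed
  qed
  define V where "V m = {\<lambda>(k, h). x k h | x. x \<in> U m}" for m
  have "right_subspace (V m)" for m
    unfolding right_subspace_def
  proof (intro conjI ballI allI)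
    show "(\<lambda>_. 0) \<in> V m"
      unfolding V_def using sub[of m] by (intro CollectI exI[of _ "\<lambda>k h. 0"]) (auto simp: fun_eq_iff)
  next
    fix f g assume "f \<in> V m" "g \<in> V m"
    then obtain x x' where "f = (\<lambda>(k, h). x k h)" "x \<in> U m" "g = (\<lambda>(k, h). x' k h)" "x' \<in> U m"
      unfolding V_def by blast
    then show "(\<lambda>i. f i + g i) \<in> V m"
      unfolding V_def using sub[of m] by (intro CollectI exI[of _ "\<lambda>k h. x k h + x' k h"]) (auto simp: fun_eq_iff)
  next
    fix f a assume "f \<in> V m"
    then obtain x where "f = (\<lambda>(k, h). x k h)" "x \<in> U m" unfolding V_def by blast
    then show "(\<lambda>i. f i * a) \<in> V m"
      unfolding V_def using sub[of m] by (intro CollectI exI[of _ "\<lambda>k h. x k h * a"]) (auto simp: fun_eq_iff)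
  qed
  moreover have "V (Suc m) \<subseteq> V m" for m unfolding V_def using dec[of m] by blast
  moreover have "finite ({..<n} \<times> B)" using basis(1) by simp
  ultimately obtain M where M: "\<forall>m\<ge>M. \<forall>f\<in>V M. \<exists>g\<in>V m. \<forall>i\<in>{..<n} \<times> B. f i = g i"
    using right_artinian_fun[where V = V, OF art] by blast
  \<comment> \<open>Stationarity at step m modulo I. The chain condition gives it at M, injectivity
    moves it down step by step, and at 0 it is surjectivity.\<close>
  define P where "P m \<longleftrightarrow> (\<forall>x\<in>U m. \<exists>x'\<in>U (Suc m). (\<lambda>k h. x k h - x' k h) \<in> LI)" for m
  have "P M"
    unfolding P_def
  proof
    fix x assume x: "x \<in> U M"
    then have xV: "(\<lambda>(k, h). x k h) \<in> V M" unfolding V_def by blast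
    have "\<exists>g\<in>V (Suc M). \<forall>i\<in>{..<n} \<times> B. (\<lambda>(k, h). x k h) i = g i"
      by (rule M[rule_format, OF _ xV]) simp
    then obtain x' where x': "x' \<in> U (Suc M)" "\<And>k b. k < n \<Longrightarrow> b \<in> B \<Longrightarrow> x k b = x' k b"
      unfolding V_def by fastforce
    have l: "lin (x k)" "lin (x' k)" for k using x x'(1) UL by (auto simp: L_def)
    have "x k = x' k" if "k < n" for k by (rule lin_eqI[OF l]) (use x'(2) that in auto)
    then have "(\<lambda>k h. x k h - x' k h) \<in> LI" using l Is(1) by (simp add: LI_def L_def lin_diff)
    then show "\<exists>x'\<in>U (Suc M). (\<lambda>k h. x k h - x' k h) \<in> LI" using x'(1) by blast
  qed
  moreover have "P m" if P: "P (Suc m)" for m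
    unfolding P_def
  proof
    fix x assume x: "x \<in> U m"
    have "\<phi> x \<in> U (Suc m)"
      unfolding US using x LI0 by (intro CollectI exI[of _ x] exI[of _ "\<lambda>k h. 0"]) simp
    then obtain x' where x': "x' \<in> U (Suc (Suc m))" "(\<lambda>k h. \<phi> x k h - x' k h) \<in> LI"
      using P unfolding P_def by blast
    then obtain w y where w: "x' = (\<lambda>k h. \<phi> w k h + y k h)" "w \<in> U (Suc m)" "y \<in> LI"
      unfolding US[of "Suc m"] by blast
    have xw: "(\<lambda>k h. x k h - w k h) \<in> L" using x w(2) UL by (auto simp: L_def intro!: lin_diff)
    have "\<phi> (\<lambda>k h. x k h - w k h) k h \<in> I" if "k < n" for k h
    proof -
      have "(\<phi> x k h - x' k h) + y k h \<in> I"
        using x'(2) w(3) that by (intro Is(2)) (auto simp: LI_def)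
      then show ?thesis unfolding \<phi>diff by (simp add: w(1))
    qed
    then have "\<phi> (\<lambda>k h. x k h - w k h) \<in> LI" using \<phi>L[OF xw] by (simp add: LI_def)
    from inj[OF xw this] show "\<exists>x'\<in>U (Suc m). (\<lambda>k h. x k h - x' k h) \<in> LI" using w(2) by blast
  qed
  ultimately have "P 0" by (induct M) auto
  then obtain x' where x': "x' \<in> U (Suc 0)" "(\<lambda>k h. z k h - x' k h) \<in> LI"
    using z unfolding P_def U0 by (auto simp: L_def)
  then obtain z' y where z': "x' = (\<lambda>k h. \<phi> z' k h + y k h)" "z' \<in> L" "y \<in> LI"
    unfolding US U0 by blast
  show thesis
  proof (rule that[of z'])
    show "lin (z' k)" for k using z'(2) by (simp add: L_def)
    show "z k h - (\<Sum>i<n. conv (C k i) (z' i) h) \<in> I" if "k < n" for k h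
    proof -
      have "(z k h - x' k h) + y k h \<in> I" using x'(2) z'(3) that by (intro Is(2)) (auto simp: LI_def)
      then show ?thesis by (simp add: z'(1) \<phi>_def)
    qed
  qed
qed

text \<open>Freeness of \<open>(W / N)\<^sup>l\<close> modulo \<open>I\<close> is preserved by the base change along
  \<open>a \<mapsto> (h \<mapsto> h a)\<close>, because \<open>W / N\<close> carries an action of \<open>H\<close>. Hence the smallest possible
  \<open>I\<close> is \<open>H\<close>-stable.\<close>

lemma relation_coefficients_stable:
  assumes art: "right_artinian TYPE('q)" and W: "left_ideal W" "H_stable act W"
    and N: "left_ideal N" "H_stable act N" and I: "two_sided_ideal I"
    and g: "\<And>k i. k < (n::nat) \<Longrightarrow> i < (l::nat) \<Longrightarrow> g k i \<in> W"
    and gen: "\<And>x. (\<And>i. i < l \<Longrightarrow> x i \<in> W) \<Longrightarrow> \<exists>s. \<forall>i<l. cong_mod N (x i) (\<Sum>k<n. s k * g k i)"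
    and rel: "\<And>s k. (\<And>i. i < l \<Longrightarrow> (\<Sum>k<n. s k * g k i) \<in> N) \<Longrightarrow> k < n \<Longrightarrow> s k \<in> I"
    and s: "\<And>i. i < l \<Longrightarrow> (\<Sum>k<n. s k * g k i) \<in> N" and k: "k < n"
  shows "act h (s k) \<in> I"
proof -
  note Is = ideal_subgroup[OF I]
  note Ns = left_ideal_subgroup[OF N(1)]
  note Nc = cong_mod_subgroup[OF Ns]
  note [trans] = Nc(3)
  have actN: "act h x \<in> N" if "x \<in> N" for h x using N(2) that by (simp add: H_stable_def)
  have "\<forall>b k. \<exists>c. k < n \<longrightarrow> (\<forall>i<l. cong_mod N (act b (g k i)) (\<Sum>j<n. c j * g j i))"
    using gen[of "\<lambda>i. act b (g k i)" for b k] g W(2) by (auto simp: H_stable_def)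
  then obtain c where c: "\<And>b k i. k < n \<Longrightarrow> i < l \<Longrightarrow> cong_mod N (act b (g k i)) (\<Sum>j<n. c b k j * g j i)"
    by metis
  \<comment> \<open>The matrix of the action on the generators, chosen on the basis of H and
    extended linearly so as to lie over the convolution algebra.\<close>
  define C where "C k j h = (\<Sum>b\<in>B. scaleQ (H.representation B h b) (c b k j))" for k j h
  have C: "lin (C k j)" for k j
    unfolding C_def[abs_def]
    using H.representation_add[OF basis(2)] H.representation_scale[OF basis(2)]
    by (intro lin_sum k_linear_scale_left) (simp add: k_linear_def basis(3))
  have gC: "cong_mod N (act h (g k i)) (\<Sum>j<n. C k j h * g j i)" if "k < n" "i < l" for h k i
  proof -
    let ?r = "H.representation B h"
    have "h = (\<Sum>b\<in>B. scaleH (?r b) b)"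
      using H.sum_representation_eq[OF basis(2) _ basis(1) order_refl, of h] basis(3) by simp
    then have "act h (g k i) = act (\<Sum>b\<in>B. scaleH (?r b) b) (g k i)" by (rule arg_cong)
    also have "\<dots> = (\<Sum>b\<in>B. scaleQ (?r b) 1 * act b (g k i))"
      by (subst k_linear_sum[OF lin_tau]) (simp add: act_scale_left scale_mult_left)
    also have "cong_mod N \<dots> (\<Sum>b\<in>B. scaleQ (?r b) 1 * (\<Sum>j<n. c b k j * g j i))"
      by (intro Nc(7) cong_mod_left[OF N(1)] c that)
    also have "\<dots> = (\<Sum>j<n. C k j h * g j i)"
      unfolding C_def sum_distrib_left sum_distrib_right
      by (subst sum.swap) (simp add: scale_mult_left)
    finally show ?thesis .
  qed
  \<comment> \<open>The candidate inverse h \<mapsto> h2 C(S'(h1)): on the generators it undoes the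
    action of H because h2 S'(h1) is a counit.\<close>
  define E where "E j k h = sweedler \<Delta> h (\<lambda>a b. act b (C j k (S' a)))" for j k h
  have E: "lin (E j k)" for j k
    unfolding E_def[abs_def]
    by (intro H.k_linear_comult vs)
      (auto simp: k_bilinear_def intro!: lin_tau lin_act_right k_linear_comp[OF skew_antipode_linear C])
  have fC: "cong_mod N (\<Sum>j<n. (\<Sum>k<n. conv (f k) (C k j) h) * g j i)
      (\<Sum>k<n. sweedler \<Delta> h (\<lambda>a b. f k a * act b (g k i)))" if i: "i < l" for f i h
  proof -
    have "(\<Sum>j<n. (\<Sum>k<n. conv (f k) (C k j) h) * g j i)
        = (\<Sum>k<n. sweedler \<Delta> h (\<lambda>a b. f k a * (\<Sum>j<n. C k j b * g j i)))"
      unfolding sum_distrib_right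
      by (subst sum.swap) (simp add: conv_def sweedler_mult_right sum_distrib_left sweedler_sum mult.assoc)
    also have "cong_mod N \<dots> (\<Sum>k<n. sweedler \<Delta> h (\<lambda>a b. f k a * act b (g k i)))"
    proof (rule Nc(7))
      fix m assume "m \<in> {..<n}"
      then have "f m a * (\<Sum>k<n. C m k b * g k i) - f m a * act b (g m i) \<in> N" for a b
        using cong_modD[OF cong_mod_left[OF N(1) Nc(2)[OF gC[OF _ i]]]] by simp
      then show "cong_mod N (sweedler \<Delta> h (\<lambda>a b. f m a * (\<Sum>k<n. C m k b * g k i)))
          (sweedler \<Delta> h (\<lambda>a b. f m a * act b (g m i)))"
        unfolding cong_mod_def sweedler_diff[symmetric] by (rule sweedler_mem[OF Ns])
    qed
    finally show ?thesis .
  qed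
  \<comment> \<open>E C and the identity have the same effect on the generators modulo N, so their
    entries differ by relation coefficients, which lie in I.\<close>
  have EC: "(\<Sum>i<n. conv (E j i) (C i k) h) - (if j = k then conv_one h else 0) \<in> I"
    if j: "j < n" and k: "k < n" for j k h
  proof (rule rel[OF _ k])
    fix i assume i: "i < l"
    have e1: "(\<Sum>k<n. ((\<Sum>m<n. conv (E j m) (C m k) h) - (if j = k then conv_one h else 0)) * g k i)
        = (\<Sum>k<n. (\<Sum>m<n. conv (E j m) (C m k) h) * g k i) - conv_one h * g j i"
      using j by (simp add: left_diff_distrib sum_subtractf if_distrib[of "\<lambda>x. x * _"] sum.delta' cong: if_cong)
    have "cong_mod N (\<Sum>k<n. (\<Sum>m<n. conv (E j m) (C m k) h) * g k i)
        (\<Sum>m<n. sweedler \<Delta> h (\<lambda>a b. E j m a * act b (g m i)))" by (rule fC[OF i])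
    also have "(\<Sum>m<n. sweedler \<Delta> h (\<lambda>a b. E j m a * act b (g m i)))
        = sweedler \<Delta> h (\<lambda>a b. act b (\<Sum>m<n. C j m (S' a) * g m i))"
    proof -
      have "sweedler \<Delta> h (\<lambda>a b. E j m a * act b (g m i))
          = sweedler \<Delta> h (\<lambda>a b. act b (C j m (S' a) * g m i))" for m
      proof -
        have tri: "k_trilinear scaleH scaleQ (\<lambda>x y z. act y (C j m (S' x)) * act z (g m i))"
          unfolding k_trilinear_def
          by (intro conjI allI k_linear_mult_left k_linear_mult_right lin_tau lin_act_right
              k_linear_comp[OF skew_antipode_linear C])
        have "sweedler \<Delta> h (\<lambda>a b. E j m a * act b (g m i))
            = sweedler \<Delta> h (\<lambda>a b. sweedler \<Delta> a (\<lambda>x y. act y (C j m (S' x)) * act b (g m i)))"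
          by (simp add: E_def sweedler_mult_right)
        also have "\<dots> = sweedler \<Delta> h (\<lambda>a b. sweedler \<Delta> b (\<lambda>y z. act y (C j m (S' a)) * act z (g m i)))"
          by (rule H.sweedler_coassoc[OF tri])
        finally show ?thesis unfolding act_sweedler .
      qed
      then show ?thesis by (simp add: act_sum sweedler_sum)
    qed
    also have "cong_mod N \<dots> (sweedler \<Delta> h (\<lambda>a b. act b (act (S' a) (g j i))))"
    proof -
      have "act b (\<Sum>m<n. C j m (S' a) * g m i) - act b (act (S' a) (g j i)) \<in> N" for a b
        using actN[OF cong_modD[OF Nc(2)[OF gC[OF j i]]]] by (simp add: act_diff)
      then show ?thesis unfolding cong_mod_def sweedler_diff[symmetric] by (rule sweedler_mem[OF Ns])
    qed
    also have "sweedler \<Delta> h (\<lambda>a b. act b (act (S' a) (g j i))) = conv_one h * g j i"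
      using act_sweedler_left[of h "\<lambda>a b. b * S' a" "g j i"]
      by (simp add: skew_antipode act_act act_scale_left act_one conv_one_def scale_mult_left)
    finally have "(\<Sum>k<n. (\<Sum>m<n. conv (E j m) (C m k) h) * g k i) - conv_one h * g j i \<in> N"
      by (rule cong_modD)
    then show "(\<Sum>k<n. ((\<Sum>m<n. conv (E j m) (C m k) h) - (if j = k then conv_one h else 0)) * g k i) \<in> N"
      unfolding e1 .
  qed
  \<comment> \<open>Applying h to the given relation stays in N and produces a relation with these
    coefficients.\<close>
  have sC: "(\<Sum>k<n. conv (\<lambda>h. act h (s k)) (C k j) h) \<in> I" if j: "j < n" for j h
  proof (rule rel[OF _ j])
    fix i assume i: "i < l"
    have "cong_mod N (\<Sum>j<n. (\<Sum>k<n. conv (\<lambda>h. act h (s k)) (C k j) h) * g j i)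
        (\<Sum>k<n. sweedler \<Delta> h (\<lambda>a b. act a (s k) * act b (g k i)))" by (rule fC[OF i])
    also have "(\<Sum>k<n. sweedler \<Delta> h (\<lambda>a b. act a (s k) * act b (g k i))) = act h (\<Sum>k<n. s k * g k i)"
      by (simp add: act_sum act_sweedler)
    finally have "cong_mod N (\<Sum>j<n. (\<Sum>k<n. conv (\<lambda>h. act h (s k)) (C k j) h) * g j i)
        (act h (\<Sum>k<n. s k * g k i))" .
    then show "(\<Sum>j<n. (\<Sum>k<n. conv (\<lambda>h. act h (s k)) (C k j) h) * g j i) \<in> N"
      by (rule Nc(6)) (rule actN[OF s[OF i]])
  qed
  \<comment> \<open>The unit column at k. With C z' = z modulo I, multiplying the row of
    \<open>sC\<close> by z' gives back the single entry \<open>act h (s k)\<close>.\<close>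
  define z where "z = (\<lambda>j::nat. if j = k then conv_one else (\<lambda>_. 0))"
  have z: "lin (z j)" for j by (simp add: z_def lin_conv_one lin_zero)
  obtain z' where z': "\<And>k. lin (z' k)" "\<And>k h. k < n \<Longrightarrow> z k h - (\<Sum>i<n. conv (C k i) (z' i) h) \<in> I"
    by (rule conv_matrix_surjective[where C = C and E = E and z = z, OF art I C E EC z]) blast+
  have e1: "(\<Sum>i<n. conv (\<lambda>h. act h (s i)) (z i) h) = act h (s k)"
  proof -
    have "conv (\<lambda>h. act h (s i)) (z i) h = (if i = k then act h (s i) else 0)" for i
      by (simp add: z_def conv_one_right[OF lin_tau] conv_zero_right)
    then show ?thesis using k by (simp add: sum.delta)
  qed
  have c1: "cong_mod I (\<Sum>i<n. conv (\<lambda>h. act h (s i)) (z i) h)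
      (\<Sum>i<n. conv (\<lambda>h. act h (s i)) (\<lambda>h. \<Sum>j<n. conv (C i j) (z' j) h) h)"
    using z'(2) by (intro cong_mod_sum[OF Is])
      (auto simp: cong_mod_def conv_diff_right[symmetric] intro!: conv_mem_right ideal_left[OF I])
  have e2: "(\<Sum>i<n. conv (\<lambda>h. act h (s i)) (\<lambda>h. \<Sum>j<n. conv (C i j) (z' j) h) h)
      = (\<Sum>j<n. conv (\<lambda>h. \<Sum>i<n. conv (\<lambda>h. act h (s i)) (C i j) h) (z' j) h)"
    unfolding conv_sum_right conv_sum_left
    by (subst sum.swap) (simp add: conv_assoc[OF lin_tau C z'(1)])
  have m: "(\<Sum>j<n. conv (\<lambda>h. \<Sum>i<n. conv (\<lambda>h. act h (s i)) (C i j) h) (z' j) h) \<in> I"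
    by (intro add_subgroup_sum[OF Is] conv_mem_left[OF I] sC) simp
  from cong_mod_mem[OF Is c1[unfolded e1 e2] m] show ?thesis .
qed

end

section \<open>Stable left ideals\<close>

lemma power_mult_distrib_commute:
  fixes a b :: "'a::monoid_mult"
  assumes "a * b = b * a" shows "(a * b) ^ n = a ^ n * b ^ n"
proof (induct n)
  case (Suc n)
  have "(a * b) ^ Suc n = a * (b * a ^ n) * b ^ n" by (simp add: Suc mult.assoc)
  also have "\<dots> = a ^ Suc n * b ^ Suc n"
    unfolding power_commuting_commutes[OF assms, symmetric] by (simp add: mult.assoc)
  finally show ?case .
qed simp

text \<open>Powers in \<open>ideal_power\<close> start from the whole ring, so the second power is
  the whole ring times J times J, which vanishes with the products of elements of J.\<close>

lemma H_semiprimeD: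
  assumes "H_semiprime act" "two_sided_ideal J" "H_stable act J"
    and "\<And>x y. x \<in> J \<Longrightarrow> y \<in> J \<Longrightarrow> x * y = 0"
  shows "J = {0}"
proof -
  note J = add_subgroupD[OF ideal_subgroup[OF assms(2)]]
  have 1: "add_prod UNIV J \<subseteq> J"
    unfolding add_prod_def
    by (rule hull_minimal) (use ideal_mult_left[OF assms(2)] ideal_subgroup[OF assms(2)] in auto)
  have "add_prod (add_prod UNIV J) J \<subseteq> {0}"
    unfolding add_prod_def[of _ J]
  proof (rule hull_minimal)
    show "{s * t | s t. s \<in> add_subgroup hull {s * t | s t. s \<in> UNIV \<and> t \<in> J} \<and> t \<in> J} \<subseteq> {0}"
      using 1 assms(4) unfolding add_prod_def by blast
    show "add_subgroup {0}" by (simp add: add_subgroup_def)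
  qed
  moreover have "0 \<in> add_prod (add_prod UNIV J) J"
    unfolding add_prod_def[of _ J] by (rule add_subgroup_zero[OF add_subgroup_hull])
  ultimately have "ideal_power J (Suc (Suc 0)) = {0}" by auto
  then have "nilpotent_ideal J" unfolding nilpotent_ideal_def by blast
  then show ?thesis using assms(1-3) unfolding H_semiprime_def by blast
qed

section \<open>Minimal stable ideals and splittings\<close>

context semisimple_module_algebra
begin

lemma generated_ideal_stable:
  assumes "\<And>h x. x \<in> T \<Longrightarrow> act h x \<in> generated_ideal T"
  shows "H_stable act (generated_ideal T)"
  unfolding H_stable_def
proof (intro allI ballI)
  fix h x assume "x \<in> generated_ideal T"
  then show "act h x \<in> generated_ideal T"
    unfolding generated_ideal_def[of T]
  proof (induct rule: add_subgroup_hull_induct)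
    case (base x)
    then obtain u y v where x: "x = u * y * v" "y \<in> T" by blast
    have "act h x \<in> generated_ideal T"
      unfolding x(1) act_sweedler sweedler_mult_right[symmetric]
      by (intro sweedler_mem ideal_subgroup ideal_mult_right[OF generated_ideal]
          ideal_mult_left[OF generated_ideal] generated_ideal assms x)
    then show ?case by (simp add: generated_ideal_def)
  qed (simp_all add: act_zero act_add_right act_minus add_subgroupD[OF add_subgroup_hull])
qed

text \<open>The zero ideal is included; that X is nonzero is asked for separately.\<close>

definition minimal_stable_ideal :: "'q set \<Rightarrow> bool" where
  "minimal_stable_ideal X \<longleftrightarrow> two_sided_ideal X \<and> H_stable act X \<and>
    (\<forall>Y. two_sided_ideal Y \<and> H_stable act Y \<and> Y \<subseteq> X \<longrightarrow> Y = {0} \<or> Y = X)"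

text \<open>I is generated by all coefficients of relations; the prime P certifies that I is proper.
  As W = X W + N, modulo N the vector \<open>g 0\<close> is a combination of the generators with
  coefficients in X, so \<open>1 - s 0\<close> is a relation coefficient. Hence X is not inside I,
  and minimality of X makes the intersection zero.\<close>

lemma stable_quotient_free:
  assumes art: "right_artinian TYPE('q)" and X: "minimal_stable_ideal X"
    and WN: "left_quotient W N" "H_stable act W" "H_stable act N"
    and fg: "left_quotient.fin_gen W N r w" and XW: "W \<subseteq> left_quotient.mult_plus W N X" and ne: "W \<noteq> N"
  obtains l n :: nat and g I c where "l > 0" "\<forall>k<n. \<forall>i<l. g k i \<in> W"
    "\<forall>x. (\<forall>i<l. x i \<in> W) \<longrightarrow> (\<exists>s. \<forall>i<l. cong_mod N (x i) (\<Sum>k<n. s k * g k i))"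
    "\<forall>s. (\<forall>i<l. (\<Sum>k<n. s k * g k i) \<in> N) \<longrightarrow> (\<forall>k<n. s k \<in> I)"
    "two_sided_ideal I" "H_stable act I" "X \<inter> I = {0}" "c \<in> X" "1 - c \<in> I"
proof -
  interpret left_quotient W N by fact
  have Xi: "two_sided_ideal X" and Xst: "H_stable act X"
    and Xmin: "\<And>Y. two_sided_ideal Y \<Longrightarrow> H_stable act Y \<Longrightarrow> Y \<subseteq> X \<Longrightarrow> Y = {0} \<or> Y = X"
    using X by (auto simp: minimal_stable_ideal_def)
  note Xs = ideal_subgroup[OF Xi]
  note Ns = left_ideal_subgroup[OF N]
  note Nc = cong_mod_subgroup[OF Ns]
  obtain l n :: nat and g P where P: "prime_ideal P" and l: "l > 0" and n: "n > 0"
    and g: "\<forall>k<n. \<forall>i<l. g k i \<in> W"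
    and gen: "\<forall>x. (\<forall>i<l. x i \<in> W) \<longrightarrow> (\<exists>s. \<forall>i<l. cong_mod N (x i) (\<Sum>k<n. s k * g k i))"
    and rel: "\<forall>s. (\<forall>i<l. (\<Sum>k<n. s k * g k i) \<in> N) \<longrightarrow> (\<forall>k<n. s k \<in> P)"
    by (rule maximal_rank[OF art fg ne])
  define T where "T = {s k | s k. (\<forall>i<l. (\<Sum>k<n. s k * g k i) \<in> N) \<and> k < n}"
  define I where "I = generated_ideal T"
  have I: "two_sided_ideal I" unfolding I_def by (rule generated_ideal)
  have TI: "T \<subseteq> I" unfolding I_def by (rule generated_ideal_inc)
  have relI: "\<forall>s. (\<forall>i<l. (\<Sum>k<n. s k * g k i) \<in> N) \<longrightarrow> (\<forall>k<n. s k \<in> I)"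
  proof (intro allI impI)
    fix s k assume "\<forall>i<l. (\<Sum>k<n. s k * g k i) \<in> N" "k < n"
    then have "s k \<in> T" unfolding T_def by blast
    then show "s k \<in> I" using TI by blast
  qed
  have IP: "I \<subseteq> P"
    unfolding I_def
  proof (rule generated_ideal_minimal[OF prime_ideal_ideal[OF P]])
    show "T \<subseteq> P" using rel by (auto simp: T_def)
  qed
  have Ist: "H_stable act I"
    unfolding I_def
  proof (rule generated_ideal_stable)
    fix h x assume "x \<in> T"
    then obtain s k where s: "x = s k" "\<forall>i<l. (\<Sum>k<n. s k * g k i) \<in> N" "k < n" unfolding T_def by blast
    have "act h (s k) \<in> I"
      by (rule relation_coefficients_stable[where W = W and N = N and g = g and l = l and n = n])
        (use art W N WN(2,3) I g gen relI s in auto)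
    then show "act h x \<in> generated_ideal T" by (simp add: s I_def)
  qed
  have single: "\<exists>s. (\<forall>k. s k \<in> X) \<and> (\<forall>i<l. cong_mod N (if i = i0 then y else 0) (\<Sum>k<n. s k * g k i))"
    if "y \<in> mult_plus X" for y i0
  proof (rule mult_plus_coeff[OF Xi that])
    fix x assume "x \<in> W"
    then have "\<forall>i<l. (if i = i0 then x else 0) \<in> W"
      using add_subgroup_zero[OF left_ideal_subgroup[OF W]] by simp
    then show "\<exists>s. \<forall>i<l. cong_mod N (if i = i0 then x else 0) (\<Sum>k<n. s k * g k i)"
      using gen[rule_format, of "\<lambda>i. if i = i0 then x else 0"] by blast
  qed
  \<comment> \<open>\<open>single\<close> treats an element of W in one coordinate; summing over
    \<open>i0\<close> reassembles the vector \<open>g 0\<close>.\<close>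
  have "\<exists>s. (\<forall>k. s k \<in> X) \<and> (\<forall>i<l. cong_mod N (g 0 i) (\<Sum>k<n. s k * g k i))"
  proof -
    have "\<forall>i0. \<exists>s. i0 < l \<longrightarrow> (\<forall>k. s k \<in> X) \<and>
        (\<forall>i<l. cong_mod N (if i = i0 then g 0 i0 else 0) (\<Sum>k<n. s k * g k i))"
      using single g n XW by blast
    then have "\<exists>s. \<forall>i0. i0 < l \<longrightarrow> (\<forall>k. s i0 k \<in> X) \<and>
        (\<forall>i<l. cong_mod N (if i = i0 then g 0 i0 else 0) (\<Sum>k<n. s i0 k * g k i))"
      by (rule choice)
    then obtain s where s': "\<forall>i0. i0 < l \<longrightarrow> (\<forall>k. s i0 k \<in> X) \<and>
        (\<forall>i<l. cong_mod N (if i = i0 then g 0 i0 else 0) (\<Sum>k<n. s i0 k * g k i))" ..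
    have s: "s i0 k \<in> X" "i < l \<Longrightarrow> cong_mod N (if i = i0 then g 0 i0 else 0) (\<Sum>k<n. s i0 k * g k i)"
      if "i0 < l" for i0 i k using s' that by blast+
    have "cong_mod N (g 0 i) (\<Sum>k<n. (\<Sum>i0<l. s i0 k) * g k i)" if "i < l" for i
    proof -
      have "cong_mod N (\<Sum>i0<l. if i = i0 then g 0 i0 else 0) (\<Sum>i0<l. \<Sum>k<n. s i0 k * g k i)"
        by (intro Nc(7) s that) simp
      moreover have "(\<Sum>i0<l. \<Sum>k<n. s i0 k * g k i) = (\<Sum>k<n. (\<Sum>i0<l. s i0 k) * g k i)"
        unfolding sum_distrib_right by (rule sum.swap)
      ultimately show ?thesis using that by (simp add: sum.delta')
    qed
    moreover have "(\<Sum>i0<l. s i0 k) \<in> X" for k by (intro add_subgroup_sum[OF Xs] s) simp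
    ultimately show ?thesis by (intro exI[of _ "\<lambda>k. \<Sum>i0<l. s i0 k"]) simp
  qed
  then obtain s where s: "\<And>k. s k \<in> X" "\<And>i. i < l \<Longrightarrow> cong_mod N (g 0 i) (\<Sum>k<n. s k * g k i)" by blast
  have "(\<Sum>k<n. ((if k = 0 then 1 else 0) - s k) * g k i) \<in> N" if "i < l" for i
  proof -
    have "(\<Sum>k<n. (if k = 0 then 1 else 0) * g k i) = (\<Sum>k<n. if k = 0 then g k i else 0)"
      by (rule sum.cong) auto
    also have "\<dots> = g 0 i" using n by (simp add: sum.delta)
    finally show ?thesis
      using cong_modD[OF s(2)[OF that]] by (simp add: left_diff_distrib sum_subtractf)
  qed
  then have c: "1 - s 0 \<in> I"
    using relI[rule_format, of "\<lambda>k. (if k = 0 then 1 else 0) - s k" 0] n by simp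
  have "X \<inter> I = {0}"
  proof -
    have "X \<inter> I = {0} \<or> X \<inter> I = X"
      using Xst Ist by (intro Xmin ideal_Int Xi I) (auto simp: H_stable_def)
    moreover have "X \<inter> I \<noteq> X"
    proof
      assume "X \<inter> I = X"
      then have "s 0 + (1 - s 0) \<in> I" using s(1) c by (intro add_subgroup_add[OF ideal_subgroup[OF I]]) auto
      then show False using IP prime_ideal_proper[OF P] by auto
    qed
    ultimately show ?thesis by blast
  qed
  then show thesis by (rule that[OF l g gen relI I Ist _ s(1) c])
qed

text \<open>The element \<open>f\<close> is a power of a lift of a central idempotent of the semisimple quotient of
  \<open>Q\<close>.\<close>

lemma minimal_stable_ideal_left_unit:
  assumes art: "right_artinian TYPE('q)" and sp: "H_semiprime act"
    and X: "minimal_stable_ideal X" "X \<noteq> {0}"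
  obtains f y where "f \<in> X" "f \<noteq> 0" "y \<in> X" "y * f = f"
proof -
  have Xi: "two_sided_ideal X" and Xst: "H_stable act X"
    and Xmin: "\<And>Y. two_sided_ideal Y \<Longrightarrow> H_stable act Y \<Longrightarrow> Y \<subseteq> X \<Longrightarrow> Y = {0} \<or> Y = X"
    using X by (auto simp: minimal_stable_ideal_def)
  note Xs = add_subgroupD[OF ideal_subgroup[OF Xi]] idealD[OF Xi]
  \<comment> \<open>The products from X generate a stable ideal that is nonzero by H-semiprimeness,
    hence X itself.\<close>
  define T where "T = {x * y | x y. x \<in> X \<and> y \<in> X}"
  have XT: "generated_ideal T = X"
  proof -
    have "H_stable act (generated_ideal T)"
    proof (rule generated_ideal_stable)
      fix h z assume "z \<in> T"
      then obtain x y where z: "z = x * y" "x \<in> X" "y \<in> X" unfolding T_def by blast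
      have "act a x * act b y \<in> generated_ideal T" for a b
        using z Xst generated_ideal_inc[of T] unfolding T_def H_stable_def by blast
      then show "act h z \<in> generated_ideal T"
        unfolding z act_sweedler by (intro sweedler_mem ideal_subgroup generated_ideal)
    qed
    moreover have "T \<subseteq> X" using Xs(9) by (auto simp: T_def)
    then have "generated_ideal T \<subseteq> X" by (rule generated_ideal_minimal[OF Xi])
    moreover have "generated_ideal T \<noteq> {0}"
    proof
      assume 0: "generated_ideal T = {0}"
      have "x * y = 0" if "x \<in> X" "y \<in> X" for x y
      proof -
        have "x * y \<in> T" using that unfolding T_def by blast
        then show ?thesis using generated_ideal_inc[of T] 0 by blast
      qed
      then show False using H_semiprimeD[OF sp Xi Xst] X(2) by blast
    qed
    ultimately show ?thesis using Xmin generated_ideal by blast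
  qed
  obtain F where F: "finite F" "\<And>P. P \<in> F \<Longrightarrow> prime_ideal P"
    and nil: "\<And>x::'q. x \<in> \<Inter>F \<Longrightarrow> \<exists>n. x ^ n = 0"
    by (rule finite_prime_radical[OF art]) blast
  \<comment> \<open>Otherwise all elements of X are nilpotent. A right ideal Y minimal with Y X
    nonzero equals y X for some y in it, so y = y z with z in X, and nilpotency of z makes y
    zero.\<close>
  have "\<not> X \<subseteq> \<Inter>F"
  proof
    assume XF: "X \<subseteq> \<Inter>F"
    let ?C = "{Y. right_ideal Y \<and> (\<exists>y\<in>Y. \<exists>x\<in>X. y * x \<noteq> 0)}"
    obtain x where x: "x \<in> X" "x \<noteq> 0" using X(2) Xs(1) by blast
    have "UNIV \<in> ?C"
    proof -
      have "right_ideal (UNIV :: 'q set)" by (simp add: right_ideal_def add_subgroup_def)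
      moreover have "1 * x \<noteq> 0" using x(2) by simp
      ultimately show ?thesis using x(1) by blast
    qed
    then have "?C \<noteq> {}" by (rule ex_in_conv[THEN iffD1, OF exI])
    then have "\<exists>Y\<in>?C. \<forall>K\<in>?C. K \<subseteq> Y \<longrightarrow> K = Y"
      by (rule right_artinian_minimal[OF art]) simp
    then obtain Y where YC: "Y \<in> ?C" and Ym: "\<forall>K\<in>?C. K \<subseteq> Y \<longrightarrow> K = Y" ..
    from YC obtain y x where Y: "right_ideal Y" and y: "y \<in> Y" "x \<in> X" "y * x \<noteq> 0" by blast
    define K where "K = {y * x | x. x \<in> X}"
    have "K = (*) y ` X" by (auto simp: K_def)
    then have KI: "right_ideal K" using right_ideal_image_mult[OF Xs(6)] by simp
    have KY: "K \<subseteq> Y" using right_ideal_mult[OF Y y(1)] by (auto simp: K_def)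
    have "\<exists>a\<in>K. \<exists>b\<in>X. a * b \<noteq> 0"
    proof (rule ccontr)
      assume no: "\<not> (\<exists>a\<in>K. \<exists>b\<in>X. a * b \<noteq> 0)"
      have "y * x = 0" if "x \<in> generated_ideal T" for x
        using that unfolding generated_ideal_def
      proof (induct rule: add_subgroup_hull_induct)
        case (base x)
        then obtain u a b v where x: "x = u * (a * b) * v" "a \<in> X" "b \<in> X" unfolding T_def by blast
        have "y * (u * a) \<in> K" unfolding K_def using Xs(8)[OF x(2)] by blast
        then have "y * (u * a) * b = 0" using no x(3) by blast
        then have "y * (u * a) * b * v = 0" by simp
        then show ?case by (simp add: x mult.assoc)
      qed (simp_all add: distrib_left)
      then show False using y XT by blast
    qed
    then have "K = Y" using Ym KI KY by blast
    then obtain z where z: "z \<in> X" "y = y * z" using y(1) unfolding K_def by blast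
    have "y = y * z ^ n" for n
    proof (induct n)
      case (Suc n)
      have "y * z ^ Suc n = y * z * z ^ n" by (simp add: mult.assoc)
      then show ?case using Suc z(2) by simp
    qed simp
    moreover obtain n where "z ^ n = 0" using nil[of z] z(1) XF by blast
    ultimately have "y = 0" by (metis mult_zero_right)
    then show False using y(3) by simp
  qed
  then obtain P where P: "P \<in> F" "\<not> X \<subseteq> P" by blast
  note Pi = prime_ideal_ideal[OF F(2)[OF P(1)]]
  \<comment> \<open>x is 1 modulo P and 0 modulo the other members of F, so
    \<open>(1 - x) * x\<close> lies in all of them and is nilpotent. The n-th powers of the two
    factors then multiply to zero.\<close>
  obtain x where x: "x \<in> X" "1 - x \<in> P" and x': "\<And>P'. P' \<in> F \<Longrightarrow> P' \<noteq> P \<Longrightarrow> x \<in> P'"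
    using prime_ideal_crt[OF art F P(1) Xi P(2)] by metis
  have comm: "(1 - x) * x = x * (1 - x)" by (simp add: algebra_simps)
  have "(1 - x) * x \<in> \<Inter>F"
  proof
    fix P' assume P': "P' \<in> F"
    show "(1 - x) * x \<in> P'"
    proof (cases "P' = P")
      case True
      then show ?thesis using ideal_mult_right[OF Pi x(2)] by simp
    next
      case False
      then show ?thesis
        using ideal_mult_left[OF prime_ideal_ideal[OF F(2)[OF P']]] x'[OF P'] by blast
    qed
  qed
  then obtain n where "((1 - x) * x) ^ n = 0" using nil by blast
  then have zero: "(1 - x) ^ n * x ^ n = 0" by (simp add: power_mult_distrib_commute[OF comm])
  \<comment> \<open>As a polynomial in x this has no constant term; it fixes \<open>x ^ n\<close>
    from the left.\<close>
  have y: "1 - (1 - x) ^ n \<in> X"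
  proof (induct n)
    case (Suc n)
    have "1 - (1 - x) ^ Suc n = (1 - (1 - x) ^ n) + x * (1 - x) ^ n" by (simp add: algebra_simps)
    moreover have "(1 - (1 - x) ^ n) + x * (1 - x) ^ n \<in> X" using Suc by (intro Xs(2) Xs(9)[OF x(1)])
    ultimately show ?case by (simp only:)
  qed (simp add: Xs)
  have yf: "(1 - (1 - x) ^ n) * x ^ n = x ^ n" using zero by (simp add: left_diff_distrib)
  have "1 - x ^ n \<in> P"
  proof (induct n)
    case (Suc n)
    have "1 - x ^ Suc n = (1 - x) + x * (1 - x ^ n)" by (simp add: algebra_simps)
    moreover have "(1 - x) + x * (1 - x ^ n) \<in> P"
      using Suc x(2) by (intro add_subgroup_add[OF ideal_subgroup[OF Pi]] ideal_mult_left[OF Pi])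
    ultimately show ?case by (simp only:)
  qed (simp add: add_subgroup_zero[OF ideal_subgroup[OF Pi]])
  then have "x ^ n \<noteq> 0" using prime_ideal_proper[OF F(2)[OF P(1)]] by auto
  moreover have "x ^ n \<in> X" using Xs(9)[OF y, of "x ^ n"] yf by simp
  ultimately show thesis using that y yf by blast
qed

text \<open>W is generated by all h f, finitely many of which suffice as H has a finite basis. From
  \<open>y * f = f\<close> with y in X, h f is the sum of (h1 y) (h2 f), whence W = X W. The
  resulting c is an identity of X because X and I annihilate each other.\<close>

lemma minimal_stable_ideal_identity:
  assumes art: "right_artinian TYPE('q)" and sp: "H_semiprime act"
    and X: "minimal_stable_ideal X" "X \<noteq> {0}"
  obtains c where "c \<in> X" "\<And>x. x \<in> X \<Longrightarrow> x * c = x" "\<And>q. c * q = q * c" "c \<in> QH"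
proof -
  have Xi: "two_sided_ideal X" and Xst: "H_stable act X"
    using X by (auto simp: minimal_stable_ideal_def)
  note Xs = add_subgroupD[OF ideal_subgroup[OF Xi]] idealD[OF Xi]
  obtain f y where f: "f \<in> X" "f \<noteq> 0" "y \<in> X" "y * f = f"
    by (rule minimal_stable_ideal_left_unit[OF assms])
  define W where "W = add_subgroup hull {q * act h f | q h. True}"
  have qW: "q * act h f \<in> W" for q h unfolding W_def by (rule hull_inc) blast
  have Ws: "add_subgroup W" unfolding W_def by (rule add_subgroup_hull)
  have W: "left_ideal W"
    unfolding W_def
  proof (rule left_ideal_hull)
    fix a x assume "x \<in> {q * act h f |q h. True}"
    then obtain q h where "x = q * act h f" by blast
    then show "a * x \<in> add_subgroup hull {q * act h f |q h. True}"
      using qW[of "a * q" h] by (simp add: W_def mult.assoc)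
  qed
  have Wst: "H_stable act W"
    unfolding H_stable_def
  proof (intro allI ballI)
    fix h x assume "x \<in> W"
    then show "act h x \<in> W"
      unfolding W_def
    proof (induct rule: add_subgroup_hull_induct)
      case (base x)
      then obtain q h' where x: "x = q * act h' f" by blast
      have "act h x = sweedler \<Delta> h (\<lambda>a b. act a q * act (b * h') f)" by (simp add: x act_sweedler act_act)
      also have "\<dots> \<in> W" by (intro sweedler_mem Ws qW)
      finally show ?case by (simp add: W_def)
    qed (simp_all add: act_zero act_add_right act_minus add_subgroupD[OF add_subgroup_hull])
  qed
  have N: "left_ideal {0::'q}" by (simp add: left_ideal_def add_subgroup_def)
  have lq: "left_quotient W {0}" using W N add_subgroup_zero[OF Ws] by unfold_locales auto
  obtain h where h: "bij_betw h {..<card B} B"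
    using ex_bij_betw_nat_finite[OF basis(1)] by (auto simp: lessThan_atLeast0)
  have span: "\<exists>q. x = (\<Sum>j<card B. q j * act (h j) f)" if "x \<in> W" for x
    using that unfolding W_def
  proof (induct rule: add_subgroup_hull_induct)
    case (base x)
    then obtain q h' where x: "x = q * act h' f" by blast
    let ?r = "H.representation B h'"
    have "h' = (\<Sum>b\<in>B. scaleH (?r b) b)"
      using H.sum_representation_eq[OF basis(2) _ basis(1) order_refl, of h'] basis(3) by simp
    then have "act h' f = act (\<Sum>b\<in>B. scaleH (?r b) b) f" by (rule arg_cong)
    also have "\<dots> = (\<Sum>b\<in>B. scaleQ (?r b) (act b f))"
      by (subst k_linear_sum[OF lin_tau]) (simp add: act_scale_left)
    also have "\<dots> = (\<Sum>j<card B. scaleQ (?r (h j)) (act (h j) f))"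
      by (rule sum.reindex_bij_betw[OF h, symmetric])
    finally have "x = (\<Sum>j<card B. scaleQ (?r (h j)) q * act (h j) f)"
      by (simp add: x sum_distrib_left scale_mult_left scale_mult_right)
    then show ?case by (rule exI[of _ "\<lambda>j. scaleQ (?r (h j)) q"])
  next
    case zero
    show ?case by (intro exI[of _ "\<lambda>_. 0"]) simp
  next
    case (add x y)
    then obtain q q' where "x = (\<Sum>j<card B. q j * act (h j) f)" "y = (\<Sum>j<card B. q' j * act (h j) f)" by blast
    then show ?case by (intro exI[of _ "\<lambda>j. q j + q' j"]) (simp add: distrib_right sum.distrib)
  next
    case (minus x)
    then obtain q where "x = (\<Sum>j<card B. q j * act (h j) f)" by blast
    then show ?case by (intro exI[of _ "\<lambda>j. - q j"]) (simp add: sum_negf)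
  qed
  have fg: "left_quotient.fin_gen W {0} (card B) (\<lambda>j. act (h j) f)"
    unfolding left_quotient.fin_gen_def[OF lq]
    using span qW[of 1] by (auto simp: cong_mod_def)
  have "add_subgroup hull {q * act h f |q h. True} \<subseteq> left_quotient.mult_plus W {0} X"
  proof (rule hull_minimal)
    show "{q * act h f |q h. True} \<subseteq> left_quotient.mult_plus W {0} X"
    proof clarify
      fix q h
      have "q * act h f = q * act h (y * f)" by (simp only: f(4))
      also have "\<dots> = sweedler \<Delta> h (\<lambda>a b. (q * act a y) * act b f)"
        unfolding act_sweedler sweedler_mult_left by (simp only: mult.assoc)
      also have "\<dots> \<in> left_quotient.mult_plus W {0} X"
      proof (rule sweedler_mem[OF left_quotient.mult_plus_subgroup[OF lq]])
        fix a b
        have "q * act a y \<in> X" using Xst f(3) Xs(8) by (simp add: H_stable_def)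
        then show "q * act a y * act b f \<in> left_quotient.mult_plus W {0} X"
          using qW[of 1 b] by (intro left_quotient.mult_plus_base[OF lq]) simp_all
      qed
      finally show "q * act h f \<in> left_quotient.mult_plus W {0} X" .
    qed
  qed (rule left_quotient.mult_plus_subgroup[OF lq])
  then have XW: "W \<subseteq> left_quotient.mult_plus W {0} X" unfolding W_def[symmetric] .
  have ne: "W \<noteq> {0}" using qW[of 1 1] f(2) by (auto simp: act_one)
  have Nst: "H_stable act {0}" by (simp add: H_stable_def act_zero)
  obtain I c where I: "two_sided_ideal I" and Ist: "H_stable act I" and XI: "X \<inter> I = {0}"
    and c: "c \<in> X" "1 - c \<in> I"
    by (rule stable_quotient_free[OF art X(1) lq Wst Nst fg XW ne]) blast
  have XI0: "z = 0" if "z \<in> X" "z \<in> I" for z using that XI by blast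
  have right: "x * c = x" if "x \<in> X" for x
  proof -
    have "x * (1 - c) = 0" using that Xs(9) ideal_mult_left[OF I c(2)] by (intro XI0)
    then show ?thesis by (simp add: right_diff_distrib)
  qed
  have left: "c * x = x" if "x \<in> X" for x
  proof -
    have "(1 - c) * x = 0" using that Xs(8) ideal_mult_right[OF I c(2)] by (intro XI0)
    then show ?thesis by (simp add: left_diff_distrib)
  qed
  \<comment> \<open>Both \<open>c * q\<close> and \<open>q * c\<close> lie in X, so each equals
    \<open>c * q * c\<close>.\<close>
  have central: "c * q = q * c" for q
  proof -
    have "c * q = c * q * c" using right[OF Xs(9)[OF c(1)]] by simp
    also have "\<dots> = q * c" using left[OF Xs(8)[OF c(1)], of q] by (simp add: mult.assoc)
    finally show ?thesis .
  qed
  have "act h c = scaleQ (\<epsilon> h) c" for h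
  proof -
    have sc: "scaleQ a x = scaleQ a 1 * x" for a x by (simp add: scale_mult_left)
    \<comment> \<open>The defect of invariance lies in X since c does and, rewritten through 1 - c,
      also in I; so it is zero.\<close>
    have "act h c - scaleQ (\<epsilon> h) c = scaleQ (\<epsilon> h) (1 - c) - act h (1 - c)"
      by (simp add: act_diff act_one_right scale_right_diff_distrib)
    also have "\<dots> \<in> I"
      using Ist c(2) ideal_mult_left[OF I c(2)]
      by (subst sc) (intro add_subgroup_diff[OF ideal_subgroup[OF I]], auto simp: H_stable_def)
    finally have "act h c - scaleQ (\<epsilon> h) c \<in> I" .
    moreover have "act h c - scaleQ (\<epsilon> h) c \<in> X"
      using Xst c(1) Xs(8)[OF c(1)]
      by (subst sc) (intro Xs(4), auto simp: H_stable_def)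
    ultimately show ?thesis using XI0 by force
  qed
  then have "c \<in> QH" by (simp add: invariants_def)
  then show thesis using that c(1) right central by blast
qed

text \<open>As X and I meet in zero, relations with coefficients in X are trivial. Expand the vector
  (c, 0, ..., 0) and let e be coordinate 0 of the expansion. Multiplying by x in N gives a relation
  with coefficients in X, so x e = 0. Right multiplication by e thus induces a section of the
  projection from X to X / N.\<close>

lemma stable_left_ideal_splits:
  assumes art: "right_artinian TYPE('q)" and X: "minimal_stable_ideal X"
    and c: "c \<in> X" "\<And>x. x \<in> X \<Longrightarrow> x * c = x" "\<And>q. c * q = q * c"
    and N: "left_ideal N" "H_stable act N" "N \<subseteq> X"
  obtains e where "c - e \<in> N" "\<forall>x\<in>N. x * e = 0"
proof (cases "X = N")
  case True
  then show thesis using that[of 0] c(1) by simp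
next
  case False
  have Xi: "two_sided_ideal X" and Xst: "H_stable act X"
    using X by (auto simp: minimal_stable_ideal_def)
  note Xs = add_subgroupD[OF ideal_subgroup[OF Xi]] idealD[OF Xi]
  note Ns = left_ideal_subgroup[OF N(1)]
  note Nc = cong_mod_subgroup[OF Ns]
  have lq: "left_quotient X N" using Xs(5) N by unfold_locales
  have "\<exists>q. cong_mod N x (\<Sum>j<Suc 0. q j * c)" if "x \<in> X" for x
    using c(2)[OF that] add_subgroup_zero[OF Ns]
    by (intro exI[of _ "\<lambda>_. x"]) (simp add: cong_mod_def)
  then have fg: "left_quotient.fin_gen X N (Suc 0) (\<lambda>_. c)"
    unfolding left_quotient.fin_gen_def[OF lq] using c(1) by blast
  have XX: "X \<subseteq> left_quotient.mult_plus X N X"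
  proof
    fix x assume "x \<in> X"
    from left_quotient.mult_plus_base[OF lq this c(1)] c(2)[OF this]
    show "x \<in> left_quotient.mult_plus X N X" by simp
  qed
  obtain l n :: nat and g I where l: "l > 0"
    and gen: "\<forall>x. (\<forall>i<l. x i \<in> X) \<longrightarrow> (\<exists>s. \<forall>i<l. cong_mod N (x i) (\<Sum>k<n. s k * g k i))"
    and rel: "\<forall>s. (\<forall>i<l. (\<Sum>k<n. s k * g k i) \<in> N) \<longrightarrow> (\<forall>k<n. s k \<in> I)"
    and XI: "X \<inter> I = {0}"
    by (rule stable_quotient_free[OF art X lq Xst N(2) fg XX False]) blast
  have "\<forall>i<l. (if i = 0 then c else 0) \<in> X" using c(1) Xs(1) by simp
  then obtain s where s: "\<And>i. i < l \<Longrightarrow> cong_mod N (if i = 0 then c else 0) (\<Sum>k<n. s k * g k i)"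
    using gen[rule_format, of "\<lambda>i. if i = 0 then c else 0"] by blast
  define s' where "s' k = c * s k" for k
  have s': "cong_mod N (if i = 0 then c else 0) (\<Sum>k<n. s' k * g k i)" if "i < l" for i
  proof -
    have "cong_mod N (c * (if i = 0 then c else 0)) (c * (\<Sum>k<n. s k * g k i))"
      by (intro cong_mod_left[OF N(1)] s that)
    moreover have "c * (if i = 0 then c else 0) = (if i = 0 then c else 0)" using c(2)[OF c(1)] by simp
    ultimately show ?thesis by (simp add: s'_def sum_distrib_left mult.assoc)
  qed
  define e where "e = (\<Sum>k<n. s' k * g k 0)"
  show thesis
  proof (rule that[of e])
    show "c - e \<in> N" using cong_modD[OF s'[OF l]] by (simp add: e_def)
    show "\<forall>x\<in>N. x * e = 0"
    proof
      fix x assume x: "x \<in> N"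
      have xc: "x * c = x" using x N(3) c(2) by blast
      have "(\<Sum>k<n. x * s' k * g k i) \<in> N" if "i < l" for i
      proof -
        have "cong_mod N (x * (\<Sum>k<n. s' k * g k i)) (x * (if i = 0 then c else 0))"
          by (rule cong_mod_left[OF N(1) Nc(2)[OF s'[OF that]]])
        moreover have "x * (if i = 0 then c else 0) \<in> N"
          using xc x add_subgroup_zero[OF Ns] by simp
        ultimately have "x * (\<Sum>k<n. s' k * g k i) \<in> N" by (rule Nc(6))
        then show ?thesis by (simp add: sum_distrib_left mult.assoc)
      qed
      then have "\<forall>k<n. x * s' k \<in> I" using rel[rule_format, of "\<lambda>k. x * s' k"] by blast
      moreover have "x * s' k \<in> X" for k using x N(3) Xs(9) by blast
      ultimately have "\<forall>k<n. x * s' k = 0" using XI by blast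
      then show "x * e = 0" by (simp add: e_def sum_distrib_left flip: mult.assoc)
    qed
  qed
qed

text \<open>Take a minimal nonzero stable ideal X = Q c inside the ideal generated by Y, and split N
  = c Y by e. Since t kills N and fixes c, t e = c. For x in N, \<open>mult_act\<close> writes x = x
  (t e) as the sum of t2 ((S'(t1) x) e), which is 0. So c annihilates the ideal generated by Y,
  which contains c.\<close>

lemma stable_left_ideal_trace_zero:
  assumes art: "right_artinian TYPE('q)" and sp: "H_semiprime act"
    and Y: "left_ideal Y" "H_stable act Y" "\<And>y. y \<in> Y \<Longrightarrow> act t y = 0"
  shows "Y = {0}"
proof (rule ccontr)
  assume ne: "Y \<noteq> {0}"
  note Ys = add_subgroupD[OF left_ideal_subgroup[OF Y(1)]]
  let ?C = "{Z. two_sided_ideal Z \<and> H_stable act Z \<and> Z \<subseteq> generated_ideal Y \<and> Z \<noteq> {0}}"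
  have "H_stable act (generated_ideal Y)"
    using Y(2) generated_ideal_inc[of Y] by (intro generated_ideal_stable) (auto simp: H_stable_def)
  moreover have "generated_ideal Y \<noteq> {0}" using ne Ys(1) generated_ideal_inc[of Y] by blast
  ultimately have "generated_ideal Y \<in> ?C" by (simp add: generated_ideal)
  then have "?C \<noteq> {}" by (rule ex_in_conv[THEN iffD1, OF exI])
  then have "\<exists>X\<in>?C. \<forall>K\<in>?C. K \<subseteq> X \<longrightarrow> K = X"
    by (rule right_artinian_minimal[OF art]) (simp add: ideal_right)
  then obtain X where XC: "X \<in> ?C" and Xm: "\<forall>K\<in>?C. K \<subseteq> X \<longrightarrow> K = X" ..
  have X: "minimal_stable_ideal X" "X \<noteq> {0}" "X \<subseteq> generated_ideal Y"
    using XC Xm unfolding minimal_stable_ideal_def by auto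
  then have Xi: "two_sided_ideal X" by (simp add: minimal_stable_ideal_def)
  obtain c where c: "c \<in> X" "\<And>x. x \<in> X \<Longrightarrow> x * c = x" "\<And>q. c * q = q * c" "c \<in> QH"
    by (rule minimal_stable_ideal_identity[OF art sp X(1,2)]) blast
  define N where "N = {c * y | y. y \<in> Y}"
  have NY: "N \<subseteq> Y" using left_ideal_mult[OF Y(1)] by (auto simp: N_def)
  have NX: "N \<subseteq> X" using ideal_mult_right[OF Xi c(1)] by (auto simp: N_def)
  have N: "left_ideal N"
    unfolding left_ideal_def
  proof (intro conjI ballI allI)
    have "N = (*) c ` Y" by (auto simp: N_def)
    then show "add_subgroup N"
      using add_subgroup_image[OF left_ideal_subgroup[OF Y(1)], of "(*) c"] by (simp add: distrib_left)
    fix a b assume "a \<in> N"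
    then obtain u where u: "a = c * u" "u \<in> Y" unfolding N_def by blast
    show "b * a \<in> N"
      unfolding N_def using left_ideal_mult[OF Y(1) u(2), of b] u(1) c(3)[of b]
      by (intro CollectI exI[of _ "b * u"]) (simp flip: mult.assoc)
  qed
  have Nst: "H_stable act N"
    unfolding H_stable_def
  proof (intro allI ballI)
    fix h x assume "x \<in> N"
    then obtain y where y: "x = c * y" "y \<in> Y" unfolding N_def by blast
    have "act h x = c * act h y" unfolding y(1) c(3)[of y] act_mult_invariant[OF c(4)] c(3) ..
    then show "act h x \<in> N" unfolding N_def using y(2) Y(2) by (auto simp: H_stable_def)
  qed
  obtain e where e: "c - e \<in> N" "\<forall>x\<in>N. x * e = 0"
    by (rule stable_left_ideal_splits[OF art X(1) c(1-3) N Nst NX])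
  have "act t c = c" using c(4) by (simp add: invariants_def counit_integral)
  moreover have "act t (c - e) = 0" using Y(3) NY e(1) by blast
  ultimately have te: "act t e = c" by (simp add: act_diff)
  have "x = 0" if x: "x \<in> N" for x
  proof -
    have "x * c = sweedler \<Delta> t (\<lambda>a b. act b (act (S' a) x * e))" by (simp add: mult_act flip: te)
    also have "\<dots> = 0"
      using Nst x by (simp add: H_stable_def e(2) act_zero sweedler_zero)
    finally show ?thesis using c(2) NX x by auto
  qed
  then have cY: "c * y = 0" if "y \<in> Y" for y using that unfolding N_def by blast
  have "c * z = 0" if "z \<in> generated_ideal Y" for z
    using that unfolding generated_ideal_def
  proof (induct rule: add_subgroup_hull_induct)
    case (base z)
    then obtain u y v where z: "z = u * y * v" "y \<in> Y" by blast
    have "c * z = u * (c * y) * v" unfolding z by (simp add: c(3) mult.assoc)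
    then show ?case using cY[OF z(2)] by simp
  qed (simp_all add: distrib_left)
  then have "c * c = 0" using c(1) X(3) by blast
  then have "c = 0" using c(2)[OF c(1)] by simp
  then have "x = 0" if "x \<in> X" for x using c(2)[OF that] by simp
  then show False using X(2) add_subgroup_zero[OF ideal_subgroup[OF Xi]] by blast
qed

end

section \<open>Descent to the subalgebra\<close>

lemma hopf_algebra_semisimple_data:
  fixes scaleH :: "'k::field \<Rightarrow> 'h::{ring,monoid_mult} \<Rightarrow> 'h"
    and scaleQ :: "'k \<Rightarrow> 'q::{ring,monoid_mult} \<Rightarrow> 'q"
  assumes "hopf_algebra scaleH \<Delta> \<epsilon> S" "finite_dimensional scaleH" "semisimple_ring TYPE('h)"
    and "hmodule_algebra scaleH \<Delta> scaleQ act"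
  obtains t S' B where "semisimple_module_algebra scaleH \<Delta> \<epsilon> S scaleQ act t S' B"
proof -
  interpret H: hopf_algebra scaleH \<Delta> \<epsilon> S by fact
  interpret Q: hmodule_algebra scaleH \<Delta> scaleQ act by fact
  obtain t where t: "\<And>h. h * t = scaleH (\<epsilon> h) t" "\<epsilon> t = 1"
    using H.semisimple_integral[OF assms(3)] by metis
  obtain S' where S': "k_linear scaleH scaleH S'" "\<And>h. sweedler \<Delta> h (\<lambda>a b. b * S' a) = scaleH (\<epsilon> h) 1"
    using H.skew_antipode[OF assms(3,2)] by metis
  obtain B0 where B0: "finite B0" "H.span B0 = UNIV" using assms(2) by (auto simp: finite_dimensional_def)
  obtain B where B: "B \<subseteq> B0" "H.independent B" "B0 \<subseteq> H.span B"
    using H.maximal_independent_subset[of B0] by metis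
  have "H.span B = UNIV"
    using H.span_minimal[OF B(3) H.subspace_span] B0(2) by blast
  moreover have "finite B" using B(1) B0(1) by (rule finite_subset)
  ultimately have "semisimple_module_algebra scaleH \<Delta> \<epsilon> S scaleQ act t S' B"
    using t S' B(2) by unfold_locales
  then show thesis by (rule that)
qed

text \<open>Each q is an element of A times the inverse of some s in A; as s maps Y into itself,
  \<open>inverse_stable\<close> makes its inverse do so too.\<close>

lemma (in semisimple_module_algebra) fraction_left_stable:
  assumes art: "right_artinian TYPE('q)" and cq: "classical_right_quotient_ring \<iota>"
    and Y: "add_subgroup Y" "\<And>y z. y \<in> Y \<Longrightarrow> z \<in> QH \<Longrightarrow> y * z \<in> Y"
    and AY: "\<And>a y. y \<in> Y \<Longrightarrow> \<iota> a * y \<in> Y"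
  shows "left_ideal Y"
  unfolding left_ideal_def
proof (intro conjI allI ballI Y(1))
  fix q y assume y: "y \<in> Y"
  obtain a s u where us: "u * \<iota> s = 1" and "q = \<iota> a * u"
    using cq unfolding classical_right_quotient_ring_def by metis
  have "u * y \<in> Y" by (rule inverse_stable[where s = "\<iota> s", OF art Y(1) Y(2) AY us y])
  then show "q * y \<in> Y" using AY[of "u * y" a] \<open>q = \<iota> a * u\<close> by (simp add: mult.assoc)
qed

text \<open>The contraction of J to A is stable and nilpotent, hence zero; clearing the denominator
  of an element of J leads into this contraction.\<close>

lemma H_semiprime_quotient_ring:
  assumes sp: "H_semiprime actA" and cq: "classical_right_quotient_ring \<iota>"
    and act: "\<And>h a. actQ h (\<iota> a) = \<iota> (actA h a)"
  shows "H_semiprime actQ"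
  unfolding H_semiprime_def
proof (intro allI impI, elim conjE)
  fix J assume J: "two_sided_ideal J" "H_stable actQ J" "nilpotent_ideal J"
  have \<iota>: "\<iota> (a + b) = \<iota> a + \<iota> b" "\<iota> (a * b) = \<iota> a * \<iota> b" and inj: "inj \<iota>" for a b
    using cq by (auto simp: classical_right_quotient_ring_def)
  have \<iota>0: "\<iota> 0 = 0" using \<iota>(1)[of 0 0] by simp
  have \<iota>m: "\<iota> (- a) = - \<iota> a" for a
    using \<iota>(1)[of a "- a"] \<iota>0 by (simp add: eq_neg_iff_add_eq_0 add.commute)
  note Js = add_subgroupD[OF ideal_subgroup[OF J(1)]] idealD[OF J(1)]
  define JA where "JA = \<iota> -` J"
  have JA: "two_sided_ideal JA"
    by (simp add: JA_def two_sided_ideal_def left_ideal_def right_ideal_def add_subgroup_def \<iota> \<iota>0 \<iota>m Js)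
  have "H_stable actA JA" using J(2) by (simp add: JA_def H_stable_def flip: act)
  moreover have "nilpotent_ideal JA"
  proof -
    obtain n where n: "ideal_power J n = {0}" using J(3) by (auto simp: nilpotent_ideal_def)
    have "\<iota> x \<in> ideal_power J m" if "x \<in> ideal_power JA m" for x m
      using that
    proof (induct m arbitrary: x)
      case (Suc m)
      have "x \<in> add_subgroup hull {s * t |s t. s \<in> ideal_power JA m \<and> t \<in> JA}"
        using Suc(2) by (simp add: add_prod_def)
      then have "\<iota> x \<in> add_subgroup hull {s * t |s t. s \<in> ideal_power J m \<and> t \<in> J}"
      proof (induct rule: add_subgroup_hull_induct)
        case (base x)
        then obtain s t where x: "x = s * t" "s \<in> ideal_power JA m" "t \<in> JA" by blast
        then have "\<iota> s \<in> ideal_power J m" "\<iota> t \<in> J" using Suc(1) by (auto simp: JA_def)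
        then show ?case unfolding x(1) \<iota>(2) by (intro hull_inc) blast
      qed (simp_all add: \<iota> \<iota>0 \<iota>m add_subgroupD[OF add_subgroup_hull])
      then show ?case by (simp add: add_prod_def)
    qed simp
    from this[of _ n] have "\<iota> x = \<iota> 0" if "x \<in> ideal_power JA n" for x
      using that by (simp add: n \<iota>0)
    then have "ideal_power JA n \<subseteq> {0}" using inj by (auto dest: injD)
    moreover have "0 \<in> ideal_power JA n"
      by (cases n) (simp_all add: add_prod_def add_subgroup_zero[OF add_subgroup_hull])
    ultimately show ?thesis unfolding nilpotent_ideal_def by blast
  qed
  ultimately have JA0: "JA = {0}" using sp JA unfolding H_semiprime_def by blast
  have "q = 0" if q: "q \<in> J" for q
  proof -
    obtain a s u where s: "\<iota> s * u = 1" "u * \<iota> s = 1" "q = \<iota> a * u"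
      using cq unfolding classical_right_quotient_ring_def by metis
    have "q * \<iota> s = \<iota> a" by (simp add: s mult.assoc)
    then have "a \<in> JA" using Js(9)[OF q, of "\<iota> s"] by (simp add: JA_def)
    then have "a = 0" using JA0 by simp
    then show ?thesis by (simp add: s \<iota>0)
  qed
  then show "J = {0}" using Js(1) by blast
qed

theorem lemma4p7:
  fixes scaleH :: "'k::field \<Rightarrow> 'h::{ring,monoid_mult} \<Rightarrow> 'h"
    and \<Delta> :: "'h \<Rightarrow> ('h \<times> 'h) multiset"
    and \<epsilon> :: "'h \<Rightarrow> 'k"
    and S :: "'h \<Rightarrow> 'h"
    and scaleA :: "'k \<Rightarrow> 'a::{ring,monoid_mult} \<Rightarrow> 'a"
    and actA :: "'h \<Rightarrow> 'a \<Rightarrow> 'a"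
    and scaleQ :: "'k \<Rightarrow> 'q::{ring,monoid_mult} \<Rightarrow> 'q"
    and actQ :: "'h \<Rightarrow> 'q \<Rightarrow> 'q"
    and \<iota> :: "'a \<Rightarrow> 'q"
    and I :: "'a set"
  assumes "hopf_algebra scaleH \<Delta> \<epsilon> S"
    and "finite_dimensional scaleH"
    and "semisimple_ring TYPE('h)"
    and "hmodule_algebra scaleH \<Delta> scaleA actA"
    and "H_semiprime actA"
    and "classical_right_quotient_ring \<iota>"
    and "right_artinian TYPE('q)"
    and "hmodule_algebra scaleH \<Delta> scaleQ actQ"
    and "\<And>c a. scaleQ c (\<iota> a) = \<iota> (scaleA c a)"
    and "\<And>h a. actQ h (\<iota> a) = \<iota> (actA h a)"
    and "left_ideal I"
    and "H_stable actA I"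
  defines "IH \<equiv> I \<inter> invariants \<epsilon> scaleA actA"
    and "QH \<equiv> invariants \<epsilon> scaleQ actQ"
  shows "(IH = {0} \<longrightarrow> I = {0}) \<and>
         (add_prod UNIV (\<iota> ` I) = UNIV \<longrightarrow> add_prod (\<iota> ` IH) QH = QH)"
proof -
  obtain t S' B where "semisimple_module_algebra scaleH \<Delta> \<epsilon> S scaleQ actQ t S' B"
    by (rule hopf_algebra_semisimple_data[OF assms(1-3,8)])
  then interpret Q: semisimple_module_algebra scaleH \<Delta> \<epsilon> S scaleQ actQ t S' B .
  interpret A: hmodule_algebra scaleH \<Delta> scaleA actA by fact
  note art = assms(7) and cq = assms(6) and act = assms(10)
  have inj: "inj \<iota>" and \<iota>: "\<iota> 1 = 1" "\<iota> (a + b) = \<iota> a + \<iota> b" "\<iota> (a * b) = \<iota> a * \<iota> b" for a b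
    using cq by (auto simp: classical_right_quotient_ring_def)
  have \<iota>0: "\<iota> 0 = 0" using \<iota>(2)[of 0 0] by simp
  note Is = left_ideal_subgroup[OF assms(11)]
  have inv: "\<iota> a \<in> QH \<longleftrightarrow> a \<in> invariants \<epsilon> scaleA actA" for a
    unfolding QH_def invariants_def using inj by (simp add: act assms(9) inj_eq)
  \<comment> \<open>The operator t maps I into I^H. Both a and h appear because part (i) tests with
    both; part (ii) takes h = 1.\<close>
  have tI: "\<exists>x\<in>IH. actQ t (\<iota> a * actQ h (\<iota> x')) = \<iota> x" if "x' \<in> I" for a h x'
  proof -
    have eq: "actQ t (\<iota> a * actQ h (\<iota> x')) = \<iota> (actA t (a * actA h x'))" by (simp add: act flip: \<iota>)
    have "actA t (a * actA h x') \<in> I"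
      using assms(12) that left_ideal_mult[OF assms(11)] by (simp add: H_stable_def)
    moreover have "actA t (a * actA h x') \<in> invariants \<epsilon> scaleA actA"
      unfolding inv[symmetric] eq[symmetric] QH_def by (rule Q.act_integral_invariant)
    ultimately show ?thesis using eq by (auto simp: IH_def)
  qed
  have part1: "I = {0}" if IH: "IH = {0}"
  proof -
    \<comment> \<open>Testing with all h gives stability under H, and h (b y) = (h1 b) (h2 y) gives
      stability under A. The case a = 1, h = 1 is the vanishing of t.\<close>
    define Y where "Y = {y. \<forall>a h. actQ t (\<iota> a * actQ h y) = 0}"
    have Y: "left_ideal Y"
    proof (rule Q.fraction_left_stable[OF art cq])
      show "add_subgroup Y"
        by (simp add: Y_def add_subgroup_def Q.act_zero Q.act_add_right Q.act_minus distrib_left)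
      show "y * z \<in> Y" if "y \<in> Y" "z \<in> invariants \<epsilon> scaleQ actQ" for y z
        using that by (simp add: Y_def Q.act_mult_invariant flip: mult.assoc)
      show "\<iota> b * y \<in> Y" if y: "y \<in> Y" for b y
        unfolding Y_def
      proof (intro CollectI allI)
        fix a h
        have "actQ t (\<iota> a * actQ h (\<iota> b * y))
            = sweedler \<Delta> h (\<lambda>x z. actQ t (\<iota> (a * actA x b) * actQ z y))"
          by (simp add: Q.act_sweedler[of h] sweedler_mult_left Q.act_sweedler_sum act \<iota> mult.assoc)
        also have "\<dots> = 0" using y by (simp add: Y_def sweedler_zero)
        finally show "actQ t (\<iota> a * actQ h (\<iota> b * y)) = 0" .
      qed
    qed
    have Yst: "H_stable actQ Y"
      unfolding H_stable_def Y_def by (simp flip: Q.act_act)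
    have Yt: "actQ t y = 0" if "y \<in> Y" for y
    proof -
      have "actQ t (\<iota> 1 * actQ 1 y) = 0" using that unfolding Y_def by blast
      then show ?thesis by (simp add: \<iota> Q.act_one)
    qed
    have sp: "H_semiprime actQ" by (rule H_semiprime_quotient_ring[where actA = actA and actQ = actQ, OF assms(5) cq act])
    have Y0: "Y = {0}" by (rule Q.stable_left_ideal_trace_zero[OF art sp Y Yst Yt])
    have "x = 0" if x: "x \<in> I" for x
    proof -
      have "\<iota> x \<in> Y" using tI[OF x] IH \<iota>0 unfolding Y_def by auto
      then have "\<iota> x = \<iota> 0" using Y0 \<iota>0 by simp
      then show ?thesis using inj by (simp add: inj_eq)
    qed
    then show ?thesis using add_subgroup_zero[OF Is] by blast
  qed
  have part2: "add_prod (\<iota> ` IH) QH = QH" if QI: "add_prod UNIV (\<iota> ` I) = UNIV"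
  proof -
    define M where "M = add_prod (\<iota> ` IH) QH"
    have M: "add_subgroup M" unfolding M_def add_prod_def by (rule add_subgroup_hull)
    have MQ: "x * z \<in> M" if "x \<in> M" "z \<in> QH" for x z
      using that(1) unfolding M_def add_prod_def
    proof (induct rule: add_subgroup_hull_induct)
      case (base x)
      then obtain u v where x: "x = u * v" "u \<in> \<iota> ` IH" "v \<in> QH" by blast
      have "v * z \<in> QH" using x(3) that(2) unfolding QH_def by (rule Q.invariants_mult)
      then have "u * (v * z) \<in> {s * t |s t. s \<in> \<iota> ` IH \<and> t \<in> QH}" using x(2) by blast
      then show ?case unfolding x mult.assoc by (rule hull_inc)
    qed (simp_all add: distrib_right add_subgroupD[OF add_subgroup_hull])
    \<comment> \<open>Testing with all a gives stability under A; invariant right factors pass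
      through t and are absorbed by M.\<close>
    define Y where "Y = {y. \<forall>a. actQ t (\<iota> a * y) \<in> M}"
    have Y: "left_ideal Y"
    proof (rule Q.fraction_left_stable[OF art cq])
      show "add_subgroup Y"
        using add_subgroupD[OF M]
        by (simp add: Y_def add_subgroup_def Q.act_zero Q.act_add_right Q.act_minus distrib_left)
      show "y * z \<in> Y" if "y \<in> Y" "z \<in> invariants \<epsilon> scaleQ actQ" for y z
        using that MQ[of _ z] by (simp add: QH_def Y_def Q.act_mult_invariant flip: mult.assoc)
      show "\<iota> b * y \<in> Y" if "y \<in> Y" for b y
        using that by (simp add: Y_def flip: mult.assoc \<iota>)
    qed
    have one: "1 \<in> QH" using Q.act_integral_invariant[of 1] by (simp add: QH_def Q.act_integral_one)
    have "\<iota> ` I \<subseteq> Y"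
    proof
      fix y assume "y \<in> \<iota> ` I"
      then obtain x where x: "y = \<iota> x" "x \<in> I" by blast
      have "actQ t (\<iota> a * y) \<in> M" for a
      proof -
        obtain x' where x': "x' \<in> IH" "actQ t (\<iota> a * actQ 1 (\<iota> x)) = \<iota> x'" using tI[OF x(2)] by blast
        have "\<iota> x' * 1 \<in> M"
          unfolding M_def add_prod_def using x'(1) one by (intro hull_inc) blast
        then show ?thesis using x' x by (simp add: Q.act_one)
      qed
      then show "y \<in> Y" by (simp add: Y_def)
    qed
    then have "add_prod UNIV (\<iota> ` I) \<subseteq> Y"
      unfolding add_prod_def using left_ideal_mult[OF Y]
      by (intro hull_minimal left_ideal_subgroup[OF Y]) blast
    then have "1 \<in> Y" using QI by blast
    \<comment> \<open>Because t 1 = 1, membership of 1 in Y puts 1 into M.\<close>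
    then have "actQ t (\<iota> 1 * 1) \<in> M" unfolding Y_def by blast
    then have "1 \<in> M" by (simp add: \<iota> Q.act_integral_one)
    then have "QH \<subseteq> M" using MQ[of 1] by auto
    moreover have "M \<subseteq> QH"
      unfolding M_def add_prod_def
    proof (rule hull_minimal)
      show "{s * t |s t. s \<in> \<iota> ` IH \<and> t \<in> QH} \<subseteq> QH"
        using Q.invariants_mult inv unfolding QH_def[symmetric] IH_def by blast
      show "add_subgroup QH" unfolding QH_def by (rule Q.invariants_subgroup)
    qed
    ultimately show ?thesis unfolding M_def by blast
  qed
  show ?thesis using part1 part2 by blast
qed

end
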